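(* Let $\gamma\in(0,\infty)$ and let $(f_n)_{n\in\mathbb N}\subset L^{1,+}_{\rm loc}(\mathbb R_+)$ be a sequence of functions satisfying $$\lim_{n\to\infty}(I^1f_n)(x)=\gamma\qquad\text{for all }x>0 .$$ Let $\eta_n:=\eta_{f_n}$, $n\in\mathbb N$, be the Poisson point processes with densities $f_n$ and let $\eta^\gamma$ be a homogeneous Poisson point process in $\mathbb R^d$ with intensity $\gamma$. Then the random closed sets $\mathrm{skel}(\mathcal L(\eta_n))$ and $\mathrm{skel}(\mathcal L^*(\eta_n))$ converge weakly to $\mathrm{skel}(\mathcal L(\eta^\gamma))$ and $\mathrm{skel}(\mathcal L^*(\eta^\gamma))$, respectively, as $n\to\infty$.
   Context: Let $d\ge2$. Points of $\mathbb R^d\times\mathbb R$ are written $(v,h)$. Put $\mathrm{pow}(w,(v,h))=\|w-v\|^2+h$. For a countable set $A\subset\mathbb R^d\times\mathbb R$ and $(v,h)\in A$ the Laguerre cell is $C((v,h),A)=\{w\in\mathbb R^d:\mathrm{pow}(w,(v,h))\le \mathrm{pow}(w,(v',h'))\ \forall (v',h')\in A\}$, and the Laguerre diagram $\mathcal L(A)$ is the collection of all Laguerre cells with non-empty interior. A tessellation in $\mathbb R^d$ is a locally finite system of convex polytopes (cells) with non-empty, pairwise disjoint interiors covering $\mathbb R^d$, such that the intersection of two distinct cells is empty or a face of both. It is normal if each $k$-dimensional face is contained in precisely $d+1-k$ cells, $0\le k\le d-1$. If $\mathcal L(A)$ is a normal tessellation, its dual $\mathcal L^*(A)$ is the collection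 of simplices $\mathrm{conv}(v_1,\dots,v_{d+1})$ over distinct $(v_1,h_1),\dots,(v_{d+1},h_{d+1})\in A$ with $\bigcap_{i=1}^{d+1}C((v_i,h_i),A)\ne\varnothing$. The skeleton is $\mathrm{skel}(X)=\bigcup_{c\in X}\mathrm{bd}\,c$. $L^{1,+}_{\rm loc}(\mathbb R_+)$, $\mathbb R_+=[0,\infty)$, is the set of functions $f:(0,\infty)\to[0,\infty)$ with $\int_K f\,dx<\infty$ for all compact $K\subset[0,\infty)$; such $f$ is regarded as $0$ on $(-\infty,0)$. $(I^1f)(x)=\int_{-\infty}^xf(t)\,dt$. $\eta_f$ is the Poisson point process in $\mathbb R^d\times\mathbb R_+$ with intensity measure $\Lambda_f(\cdot)=\int_{\mathbb R^d}\int_0^\infty f(h)\mathbf 1((v,h)\in\cdot)\,dh\,dv$, assumed non-trivial; then $\mathcal L(\eta_f)$ is almost surely a normal random tessellation. A point process in $\mathbb R^d$ (such as $\eta^\gamma$) is viewed as a point process in $\mathbb R^d\times\mathbb R$ by identifying $v$ with $(v,0)$; thus $\mathcal L(\eta^\gamma)$ is the Poisson-Voronoi tessellation and $\mathcal L^*(\eta^\gamma)$ the Poisson-Delaunay tessellation. Weak convergence of random closed sets is weak convergence of their distributions on the space of closed subsets of $\mathbb R^d$ with the Fell topology. Equivalently, with $T_Z(C)=\mathbb P(Z\cap C\neq\varnothing)$, $T_{Z_n}(C)\to T_Z(C)$ for all compact $C$ with $T_Z(\mathrm{int}\,C)=T_Z(C)$. *)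

theory Defs
  imports "HOL-Probability.Probability"
begin

section \<open>Laguerre diagrams, their duals and skeletons\<close>

text \<open>A point \<open>(v, h)\<close> of $\mathbb R^d \times \mathbb R$ is an element of \<open>'a \<times> real\<close>,
  where \<open>'a\<close> is a Euclidean space with \<open>DIM('a) = d\<close>.\<close>

definition power_fun :: "'a::euclidean_space \<Rightarrow> 'a \<times> real \<Rightarrow> real" where
  "power_fun w p = (norm (w - fst p))\<^sup>2 + snd p"

definition laguerre_cell :: "'a::euclidean_space \<times> real \<Rightarrow> ('a \<times> real) set \<Rightarrow> 'a set" where
  "laguerre_cell p A = {w. \<forall>q\<in>A. power_fun w p \<le> power_fun w q}"

definition laguerre_diagram :: "('a::euclidean_space \<times> real) set \<Rightarrow> 'a set set" where
  "laguerre_diagram A = {laguerre_cell p A | p. p \<in> A \<and> interior (laguerre_cell p A) \<noteq> {}}"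

text \<open>The dual is only meaningful if the Laguerre diagram of \<open>A\<close> is a normal tessellation; the
  formula is used as it stands for every \<open>A\<close>. For the Poisson processes below the Laguerre diagram
  is almost surely normal, and the notion of law used for random sets ignores null sets. A set \<open>S\<close>
  of \<open>d + 1\<close> elements plays the role of \<open>d + 1\<close> distinct weighted points.\<close>

definition dual_laguerre :: "('a::euclidean_space \<times> real) set \<Rightarrow> 'a set set" where
  "dual_laguerre A =
     {convex hull (fst ` S) | S.
        S \<subseteq> A \<and> card S = DIM('a) + 1 \<and> (\<Inter>p\<in>S. laguerre_cell p A) \<noteq> {}}"

definition skel :: "'a::euclidean_space set set \<Rightarrow> 'a set" where
  "skel X = (\<Union>c\<in>X. frontier c)"

definition zero_weight :: "'a::euclidean_space set \<Rightarrow> ('a \<times> real) set" where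
  "zero_weight A = (\<lambda>v. (v, 0)) ` A"

section \<open>Poisson point processes\<close>

text \<open>All intensity measures in question are diffuse, so a Poisson process is almost surely simple
  and is represented by the random locally finite set of its points.\<close>

definition num_points :: "'b set \<Rightarrow> 'b set \<Rightarrow> ennreal" where
  "num_points A B = emeasure (count_space UNIV) (A \<inter> B)"

definition point_process :: "'w measure \<Rightarrow> ('w \<Rightarrow> 'b::euclidean_space set) \<Rightarrow> bool" where
  "point_process M X \<longleftrightarrow>
     prob_space M \<and>
     (\<forall>\<omega>\<in>space M. \<forall>K. compact K \<longrightarrow> finite (X \<omega> \<inter> K)) \<and>
     (\<forall>B\<in>sets borel. (\<lambda>\<omega>. num_points (X \<omega>) B) \<in> borel_measurable M)"

definition poisson_process ::
    "'w measure \<Rightarrow> 'b::euclidean_space measure \<Rightarrow> ('w \<Rightarrow> 'b set) \<Rightarrow> bool" where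
  "poisson_process M \<Lambda> X \<longleftrightarrow>
     point_process M X \<and>
     (\<forall>B\<in>sets borel. emeasure \<Lambda> B < \<infinity> \<longrightarrow>
        (\<forall>k::nat. measure M {\<omega> \<in> space M. num_points (X \<omega>) B = of_nat k} =
           measure \<Lambda> B ^ k / fact k * exp (- measure \<Lambda> B))) \<and>
     (\<forall>B\<in>sets borel. emeasure \<Lambda> B = \<infinity> \<longrightarrow> (AE \<omega> in M. num_points (X \<omega>) B = \<infinity>)) \<and>
     (\<forall>F. finite F \<and> F \<subseteq> sets borel \<and> disjoint F \<longrightarrow>
        prob_space.indep_vars M (\<lambda>_. borel) (\<lambda>B \<omega>. num_points (X \<omega>) B) F)"

text \<open>Functions on \<open>(0, \<infinity>)\<close> are represented by their extension by \<open>0\<close> to the whole line.\<close>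

definition L1_loc_plus :: "(real \<Rightarrow> real) set" where
  "L1_loc_plus =
     {f. (\<forall>x. 0 \<le> f x) \<and> (\<forall>x\<le>0. f x = 0) \<and>
         (\<forall>K. compact K \<and> K \<subseteq> {0..} \<longrightarrow> set_integrable lborel K f)}"

definition I1 :: "(real \<Rightarrow> real) \<Rightarrow> real \<Rightarrow> real" where
  "I1 f x = (LBINT t:{..x}. f t)"

text \<open>As \<open>f\<close> vanishes on the negative half-line, this is the measure
  $\int\int_0^\infty f(h) \mathbf 1((v,h)\in\cdot)\,dh\,dv$, viewed on $\mathbb R^d \times \mathbb R$.\<close>

definition intensity :: "(real \<Rightarrow> real) \<Rightarrow> ('a::euclidean_space \<times> real) measure" where
  "intensity f = density (lborel \<Otimes>\<^sub>M lborel) (\<lambda>(v, h). ennreal (f h))"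

section \<open>Weak convergence of random closed sets\<close>

definition fell_topology :: "'a::euclidean_space set topology" where
  "fell_topology = topology_generated_by
     ({{F. closed F \<and> F \<inter> K = {}} | K. compact K} \<union>
      {{F. closed F \<and> F \<inter> G \<noteq> {}} | G. open G})"

lemma topspace_fell_topology: "topspace fell_topology = {F. closed F}"
proof (rule set_eqI, rule iffI)
  fix F :: "'a set"
  assume "F \<in> topspace fell_topology"
  then show "F \<in> {F. closed F}"
    unfolding fell_topology_def topology_generated_by_topspace by blast
next
  fix F :: "'a set"
  assume "F \<in> {F. closed F}"
  then have "F \<in> {F. closed F \<and> F \<inter> {} = {}}"
    by simp
  moreover have "{F::'a set. closed F \<and> F \<inter> {} = {}} \<in> {{F. closed F \<and> F \<inter> K = {}} | K. compact K}"
    using compact_empty by (intro CollectI exI conjI) (rule refl)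
  ultimately show "F \<in> topspace fell_topology"
    unfolding fell_topology_def topology_generated_by_topspace by (meson UnI1 UnionI)
qed

definition fell_borel :: "'a::euclidean_space set measure" where
  "fell_borel = sigma {F. closed F} {U. openin fell_topology U}"

text \<open>The skeletons are closed only almost surely, so a random closed set is a map \<open>Z\<close> that
  agrees almost surely with a measurable map into the closed sets. The law does not depend on the
  choice of the latter.\<close>

definition closed_set_law ::
    "'w measure \<Rightarrow> ('w \<Rightarrow> 'a::euclidean_space set) \<Rightarrow> 'a set measure \<Rightarrow> bool" where
  "closed_set_law M Z \<mu> \<longleftrightarrow>
     (\<exists>Z'. Z' \<in> measurable M fell_borel \<and> (AE \<omega> in M. Z \<omega> = Z' \<omega>) \<and> \<mu> = distr M fell_borel Z')"

lemma closed_set_law_unique: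
  assumes "closed_set_law M Z \<mu>" "closed_set_law M Z \<nu>"
  shows "\<mu> = \<nu>"
proof -
  obtain Z1 Z2 where "Z1 \<in> measurable M fell_borel" "Z2 \<in> measurable M fell_borel"
    and 1: "AE \<omega> in M. Z \<omega> = Z1 \<omega>" and 2: "AE \<omega> in M. Z \<omega> = Z2 \<omega>"
    and "\<mu> = distr M fell_borel Z1" "\<nu> = distr M fell_borel Z2"
    using assms unfolding closed_set_law_def by blast
  moreover have "AE \<omega> in M. Z1 \<omega> = Z2 \<omega>"
    using 1 2 by eventually_elim simp
  ultimately show ?thesis
    by (simp add: distr_cong_AE)
qed

definition weak_conv_in :: "'b topology \<Rightarrow> (nat \<Rightarrow> 'b measure) \<Rightarrow> 'b measure \<Rightarrow> bool" where
  "weak_conv_in T \<mu> \<nu> \<longleftrightarrow>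
     (\<forall>g. continuous_map T euclideanreal g \<and> bounded (g ` topspace T) \<longrightarrow>
        (\<lambda>n. \<integral>x. g x \<partial>\<mu> n) \<longlonglongrightarrow> (\<integral>x. g x \<partial>\<nu>))"

definition weak_conv_closed_sets ::
    "(nat \<Rightarrow> 'w measure) \<Rightarrow> (nat \<Rightarrow> 'w \<Rightarrow> 'a::euclidean_space set) \<Rightarrow>
      'v measure \<Rightarrow> ('v \<Rightarrow> 'a set) \<Rightarrow> bool" where
  "weak_conv_closed_sets M Z N W \<longleftrightarrow>
     (\<exists>\<mu> \<nu>. (\<forall>n. closed_set_law (M n) (Z n) (\<mu> n)) \<and> closed_set_law N W \<nu> \<and>
        weak_conv_in fell_topology \<mu> \<nu>)"

end

theory Submission
  imports Defs
begin

text \<open>Write a configuration \<open>A\<close> of weighted points through the numbers of its points in the cubes of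
  a fine grid. Both skeletons are continuous at a typical configuration with respect to these
  counts: if \<open>A'\<close> has the same counts as \<open>A\<close> at finer and finer levels, the points of \<open>A'\<close> converge
  to those of \<open>A\<close>, and the skeletons converge in the Fell topology. For the Laguerre skeleton this
  holds for every locally finite configuration of non-negative weights that is not contained in a
  half-space. For the dual, a limit of \<open>d + 1\<close> cells with a common point is again of this kind, and
  conversely a common point of \<open>d + 1\<close> cells survives small perturbations if the points are in
  general position, which holds almost surely.

  The joint law of the counts of a Poisson process is a product of Poisson laws with the masses of
  the cubes as parameters. Here \<open>I1 (f n) x \<longlongrightarrow> \<gamma>\<close> says that these masses converge to those of
  $\gamma$ times Lebesgue measure on the hyperplane $h = 0$, so the laws of the counts converge.
  Sandwiching a bounded continuous functional of the skeleton between functions of the counts then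
  gives weak convergence, without any coupling of the processes.\<close>

section \<open>Subsequences\<close>

text \<open>Equality of counts, unlike closeness of points, is a discrete event: at each level the
  count vectors form a countable set, so convergence of their laws is convergence of point
  probabilities. Counting points instead of recording occupied cubes matters, since only counts keep
  two distinct points from merging in the limit. Two obstacles shape the rest. First, the limit
  process has all its weights at height 0, on the boundary of the admissible heights; the half-open
  cubes have 0 as a lower endpoint at every level and the densities vanish below 0, so a single
  layer of cubes still receives the full mass \<gamma>. Second, the skeletons are not known
  beforehand to be measurable functions of the configuration; measurability is derived from the same
  continuity statement as the convergence, so almost sure continuity is established for every
  process of the sequence and not only for the limit. Both kinds of process are therefore treated at
  once, as Poisson processes with intensity \<open>lborel \<Otimes>\<^sub>M \<rho>\<close> for a
  measure \<rho> on heights that may have atoms.\<close>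

lemma subseq_of_not_eventually:
  assumes "\<not> eventually P sequentially"
  obtains r :: "nat \<Rightarrow> nat" where "strict_mono r" "\<And>j. \<not> P (r j)"
proof -
  have "\<forall>m. \<exists>n\<ge>m. \<not> P n"
    using assms by (auto simp: eventually_sequentially)
  then have "infinite {n. \<not> P n}"
    by (auto simp: infinite_nat_iff_unbounded_le)
  then show ?thesis
    using infinite_enumerate[of "{n. \<not> P n}"] that by auto
qed

lemma bounded_tuple_subseq:
  fixes x :: "nat \<Rightarrow> 'i \<Rightarrow> 'b::heine_borel"
  assumes "finite I" "\<And>i. i \<in> I \<Longrightarrow> bounded (range (\<lambda>j. x j i))"
  obtains r :: "nat \<Rightarrow> nat" and l where "strict_mono r" "\<And>i. i \<in> I \<Longrightarrow> (\<lambda>j. x (r j) i) \<longlonglongrightarrow> l i"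
proof -
  have "\<exists>r l. strict_mono r \<and> (\<forall>i\<in>I. (\<lambda>j. x (r j) i) \<longlonglongrightarrow> l i)"
    using assms
  proof (induction I)
    case empty
    show ?case by (intro exI[of _ id]) (auto simp: strict_mono_def)
  next
    case (insert a I)
    then obtain r l where r: "strict_mono r" and l: "\<And>i. i \<in> I \<Longrightarrow> (\<lambda>j. x (r j) i) \<longlonglongrightarrow> l i"
      by fastforce
    have "bounded (range (\<lambda>j. x (r j) a))"
      using insert.prems[of a] by (rule bounded_subset) auto
    from bounded_imp_convergent_subsequence[OF this] obtain s c
      where s: "strict_mono s" and c: "((\<lambda>j. x (r j) a) \<circ> s) \<longlonglongrightarrow> c"
      by blast
    have "(\<lambda>j. x ((r \<circ> s) j) i) \<longlonglongrightarrow> (l(a := c)) i" if "i \<in> insert a I" for i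
    proof (cases "i = a")
      case True
      then show ?thesis using c by (simp add: o_def)
    next
      case False
      then show ?thesis
        using LIMSEQ_subseq_LIMSEQ[OF l s] that by (auto simp: o_def)
    qed
    then show ?case
      using strict_mono_o[OF r s] by blast
  qed
  then show ?thesis using that by blast
qed

section \<open>Counting points in small cubes\<close>

text \<open>A cube is named by its lower corner. The side is \<open>1 / Suc m\<close>, so level 0
  makes sense; successive grids are not nested, only the mesh size matters. Every level has 0 as a
  grid coordinate, on which the convergence of the height masses relies.\<close>

definition gridpt :: "nat \<Rightarrow> 'b::euclidean_space \<Rightarrow> 'b" where
  "gridpt m x = (\<Sum>b\<in>Basis. (of_int \<lfloor>(x \<bullet> b) * real (Suc m)\<rfloor> / real (Suc m)) *\<^sub>R b)"

definition cube :: "nat \<Rightarrow> 'b::euclidean_space \<Rightarrow> 'b set" where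
  "cube m z = {x. gridpt m x = z}"

definition grid_window :: "nat \<Rightarrow> real \<Rightarrow> 'b::euclidean_space set" where
  "grid_window m R = {z \<in> range (gridpt m). \<forall>b\<in>Basis. \<bar>z \<bullet> b\<bar> \<le> R}"

text \<open>The window grows with the level: finitely many cubes at each level, yet every point is
  seen eventually. The value 0 outside the window lets agreement of counts be plain equality of
  functions.\<close>

definition cube_counts :: "nat \<Rightarrow> 'b::euclidean_space set \<Rightarrow> 'b \<Rightarrow> nat" where
  "cube_counts m A z = (if z \<in> grid_window m (real m) then card (A \<inter> cube m z) else 0)"

lemma gridpt_inner: "b \<in> Basis \<Longrightarrow> gridpt m x \<bullet> b = of_int \<lfloor>(x \<bullet> b) * real (Suc m)\<rfloor> / real (Suc m)"
  by (simp add: gridpt_def inner_sum_left_Basis del: of_nat_Suc)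

lemma gridpt_bounds:
  assumes "b \<in> Basis"
  shows "gridpt m x \<bullet> b \<le> x \<bullet> b" "x \<bullet> b < gridpt m x \<bullet> b + 1 / real (Suc m)"
  using floor_correct[of "(x \<bullet> b) * real (Suc m)"]
  by (simp_all add: gridpt_inner[OF assms] divide_simps del: of_nat_Suc)

lemma dist_gridpt: "dist (gridpt m x) x \<le> real DIM('b) / real (Suc m)" for x :: "'b::euclidean_space"
proof -
  have "norm (gridpt m x - x) \<le> (\<Sum>b\<in>Basis. \<bar>(gridpt m x - x) \<bullet> b\<bar>)"
    by (rule norm_le_l1)
  also have "\<dots> \<le> (\<Sum>b\<in>(Basis::'b set). 1 / real (Suc m))"
  proof (intro sum_mono)
    fix b :: 'b assume "b \<in> Basis"
    from gridpt_bounds[OF this, where m = m and x = x]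
    show "\<bar>(gridpt m x - x) \<bullet> b\<bar> \<le> 1 / real (Suc m)"
      unfolding inner_diff_left by linarith
  qed
  finally show ?thesis by (simp add: dist_norm)
qed

lemma gridpt_inj_coords:
  assumes "\<And>b. b \<in> Basis \<Longrightarrow> \<lfloor>(x \<bullet> b) * real (Suc m)\<rfloor> = \<lfloor>(y \<bullet> b) * real (Suc m)\<rfloor>"
  shows "gridpt m x = gridpt m y"
  unfolding gridpt_def using assms by (intro sum.cong) auto

lemma cube_eq_box:
  "cube m (gridpt m x) = {y. \<forall>b\<in>Basis. gridpt m x \<bullet> b \<le> y \<bullet> b \<and> y \<bullet> b < gridpt m x \<bullet> b + 1 / real (Suc m)}"
  for x :: "'b::euclidean_space"
proof (intro set_eqI iffI)
  fix y assume "y \<in> cube m (gridpt m x)"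
  then have "gridpt m y = gridpt m x" by (simp add: cube_def)
  then show "y \<in> {y. \<forall>b\<in>Basis. gridpt m x \<bullet> b \<le> y \<bullet> b \<and> y \<bullet> b < gridpt m x \<bullet> b + 1 / real (Suc m)}"
    using gridpt_bounds[where m = m and x = y] by auto
next
  fix y assume y: "y \<in> {y. \<forall>b\<in>Basis. gridpt m x \<bullet> b \<le> y \<bullet> b \<and> y \<bullet> b < gridpt m x \<bullet> b + 1 / real (Suc m)}"
  have "\<lfloor>(y \<bullet> b) * real (Suc m)\<rfloor> = \<lfloor>(x \<bullet> b) * real (Suc m)\<rfloor>" if b: "b \<in> Basis" for b
  proof -
    have "of_int \<lfloor>(x \<bullet> b) * real (Suc m)\<rfloor> / real (Suc m) \<le> y \<bullet> b"
      "y \<bullet> b < of_int \<lfloor>(x \<bullet> b) * real (Suc m)\<rfloor> / real (Suc m) + 1 / real (Suc m)"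
      using y b by (auto simp: gridpt_inner simp del: of_nat_Suc)
    then have "of_int \<lfloor>(x \<bullet> b) * real (Suc m)\<rfloor> \<le> (y \<bullet> b) * real (Suc m)"
      "(y \<bullet> b) * real (Suc m) < of_int \<lfloor>(x \<bullet> b) * real (Suc m)\<rfloor> + 1"
      by (simp_all add: divide_simps del: of_nat_Suc)
    then show ?thesis by linarith
  qed
  then show "y \<in> cube m (gridpt m x)"
    unfolding cube_def by (auto intro: gridpt_inj_coords)
qed

lemma measurable_gridpt [measurable]: "gridpt m \<in> borel_measurable borel"
  unfolding gridpt_def by measurable

lemma cube_borel [measurable]: "cube m z \<in> sets borel"
proof -
  have "gridpt m -` {z} \<inter> space borel \<in> sets borel"
    by (rule measurable_sets[OF measurable_gridpt]) simp
  then show ?thesis by (simp add: cube_def vimage_def)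
qed

lemma finite_grid_window: "finite (grid_window m R :: 'b::euclidean_space set)"
proof -
  let ?K = "{- \<lceil>R * real (Suc m)\<rceil>..\<lceil>R * real (Suc m)\<rceil>}"
  let ?g = "\<lambda>k::'b \<Rightarrow> int. \<Sum>b\<in>Basis. (of_int (k b) / real (Suc m)) *\<^sub>R b"
  have "grid_window m R \<subseteq> ?g ` (Basis \<rightarrow>\<^sub>E ?K)"
  proof
    fix z :: 'b assume z: "z \<in> grid_window m R"
    then obtain x where x: "z = gridpt m x" by (auto simp: grid_window_def)
    have "\<lfloor>(x \<bullet> b) * real (Suc m)\<rfloor> \<in> ?K" if b: "b \<in> Basis" for b
    proof -
      have "\<bar>of_int \<lfloor>(x \<bullet> b) * real (Suc m)\<rfloor> / real (Suc m)\<bar> \<le> R"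
        using z b by (auto simp: x grid_window_def gridpt_inner simp del: of_nat_Suc)
      then have "\<bar>of_int \<lfloor>(x \<bullet> b) * real (Suc m)\<rfloor>\<bar> \<le> R * real (Suc m)"
        by (simp add: divide_simps del: of_nat_Suc)
      then show ?thesis unfolding atLeastAtMost_iff by linarith
    qed
    then have "restrict (\<lambda>b. \<lfloor>(x \<bullet> b) * real (Suc m)\<rfloor>) Basis \<in> Basis \<rightarrow>\<^sub>E ?K"
      by auto
    moreover have "z = ?g (restrict (\<lambda>b. \<lfloor>(x \<bullet> b) * real (Suc m)\<rfloor>) Basis)"
      unfolding x gridpt_def by (intro sum.cong) auto
    ultimately show "z \<in> ?g ` (Basis \<rightarrow>\<^sub>E ?K)" by blast
  qed
  moreover have "finite (Basis \<rightarrow>\<^sub>E ?K)" by (intro finite_PiE) auto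
  ultimately show ?thesis using finite_subset by blast
qed

lemma bounded_cube: "bounded (cube m z)" for z :: "'b::euclidean_space"
proof -
  have "cube m z \<subseteq> cball z (real DIM('b) / real (Suc m))"
    using dist_gridpt[of m] by (auto simp: cube_def)
  then show ?thesis using bounded_cball bounded_subset by blast
qed

lemma gridpt_in_window:
  fixes x :: "'b::euclidean_space"
  assumes "norm x + real DIM('b) / real (Suc m) \<le> R"
  shows "gridpt m x \<in> grid_window m R"
proof -
  have "norm (gridpt m x) \<le> norm x + dist (gridpt m x) x"
    by (metis add.commute dist_norm norm_triangle_sub)
  then have "norm (gridpt m x) \<le> R"
    using dist_gridpt[of m x] assms by linarith
  then show ?thesis
    using order_trans[OF Basis_le_norm[of _ "gridpt m x"]] unfolding grid_window_def by blast
qed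

definition locally_finite :: "'b::euclidean_space set \<Rightarrow> bool" where
  "locally_finite A \<longleftrightarrow> (\<forall>K. compact K \<longrightarrow> finite (A \<inter> K))"

lemma locally_finite_bounded: "locally_finite A \<Longrightarrow> bounded K \<Longrightarrow> finite (A \<inter> K)"
  unfolding locally_finite_def
  by (meson closure_subset compact_closure finite_subset inf_mono order_refl)

text \<open>The point \<open>p\<close> need not belong to \<open>A\<close>. This is what later shows
  that a limit of points of \<open>A\<close> lies in \<open>A\<close>.\<close>

lemma locally_finite_isolated:
  assumes "locally_finite A"
  obtains e where "0 < e" "\<And>q. q \<in> A \<Longrightarrow> dist p q < e \<Longrightarrow> q = p"
proof -
  have fin: "finite ((\<lambda>q. dist p q) ` (A \<inter> ball p 1 - {p}))"
    using locally_finite_bounded[OF assms bounded_ball[of p 1]] by auto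
  have "\<exists>e>0. \<forall>q \<in> A \<inter> ball p 1 - {p}. e \<le> dist p q"
  proof (cases "A \<inter> ball p 1 - {p} = {}")
    case True
    show ?thesis unfolding True by (auto intro: exI[of _ 1])
  next
    case False
    show ?thesis
      by (rule exI[of _ "Min ((\<lambda>q. dist p q) ` (A \<inter> ball p 1 - {p}))"])
         (use fin False in \<open>auto simp: Min_gr_iff\<close>)
  qed
  then obtain e where e: "0 < e" "\<And>q. q \<in> A \<inter> ball p 1 - {p} \<Longrightarrow> e \<le> dist p q" by blast
  show ?thesis
  proof (rule that[of "min e 1"])
    show "q = p" if "q \<in> A" "dist p q < min e 1" for q
      using e(2)[of q] that by (cases "q = p") auto
  qed (use e(1) in simp)
qed

section \<open>Convergence of point configurations\<close>

text \<open>Equality of the cube counts at finer and finer levels stands in for vague convergence.\<close>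

definition conf_conv :: "(nat \<Rightarrow> 'b::euclidean_space set) \<Rightarrow> 'b set \<Rightarrow> bool" where
  "conf_conv A' A \<longleftrightarrow> locally_finite A \<and> (\<forall>j. locally_finite (A' j)) \<and>
     (\<exists>m. filterlim m at_top sequentially \<and> (\<forall>j. cube_counts (m j) (A' j) = cube_counts (m j) A))"

lemma conf_conv_const: "locally_finite A \<Longrightarrow> conf_conv (\<lambda>_. A) A"
  unfolding conf_conv_def by (auto intro!: exI[of _ id] filterlim_ident simp: id_def)

lemma conf_conv_subseq:
  assumes "conf_conv A' A" "strict_mono r"
  shows "conf_conv (\<lambda>j. A' (r j)) A"
proof -
  obtain m where m: "filterlim m at_top sequentially" "\<And>j. cube_counts (m j) (A' j) = cube_counts (m j) A"
    using assms(1) unfolding conf_conv_def by blast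
  have "filterlim (\<lambda>j. m (r j)) at_top sequentially"
    using filterlim_compose[OF m(1) filterlim_subseq[OF assms(2)]] .
  then show ?thesis
    using assms(1) m(2) unfolding conf_conv_def by blast
qed

text \<open>Two points of one cube are at most two mesh bounds apart, and the mesh vanishes as the
  level grows.\<close>

lemma gridpt_tendsto:
  fixes y :: "nat \<Rightarrow> 'b::euclidean_space"
  assumes m: "filterlim m at_top sequentially"
    and g: "\<And>j. gridpt (m j) (x j) = gridpt (m j) (y j)" and x: "x \<longlonglongrightarrow> l"
  shows "y \<longlonglongrightarrow> l"
proof -
  have "dist (y j) (x j) \<le> 2 * (real DIM('b) / real (Suc (m j)))" for j
  proof -
    have "dist (y j) (x j) \<le> dist (gridpt (m j) (y j)) (y j) + dist (gridpt (m j) (x j)) (x j)"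
      using dist_triangle2[of "y j" "x j" "gridpt (m j) (x j)"] g[of j] by (simp add: dist_commute)
    then show ?thesis
      using dist_gridpt[of "m j" "x j"] dist_gridpt[of "m j" "y j"] by linarith
  qed
  moreover have "(\<lambda>j. 2 * (real DIM('b) / real (Suc (m j)))) \<longlonglongrightarrow> 0"
  proof -
    have *: "(\<lambda>n. 2 * (real DIM('b) / real (Suc n))) \<longlonglongrightarrow> 0"
      using tendsto_mult_right_zero[OF LIMSEQ_Suc[OF lim_const_over_n[of "real DIM('b)"]], of 2] by simp
    show ?thesis using filterlim_compose[OF * m] .
  qed
  ultimately have "(\<lambda>j. dist (y j) (x j)) \<longlonglongrightarrow> 0"
    by (intro Lim_null_comparison[of "\<lambda>j. dist (y j) (x j)"]) auto
  then have "(\<lambda>j. y j - x j) \<longlonglongrightarrow> 0"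
    unfolding dist_norm by (rule tendsto_norm_zero_cancel)
  from tendsto_add[OF this x] show ?thesis by simp
qed

lemma eventually_in_window:
  fixes x :: "nat \<Rightarrow> 'b::euclidean_space"
  assumes m: "filterlim m at_top sequentially" and x: "x \<longlonglongrightarrow> l"
  shows "\<forall>\<^sub>F j in sequentially. gridpt (m j) (x j) \<in> grid_window (m j) (real (m j))"
proof -
  obtain B where B: "\<And>j. norm (x j) \<le> B"
    using convergent_imp_Bseq[OF convergentI[OF x]] by (auto simp: Bseq_def)
  have "\<forall>\<^sub>F j in sequentially. nat \<lceil>B + real DIM('b)\<rceil> \<le> m j"
    using m unfolding filterlim_at_top by blast
  then show ?thesis
  proof eventually_elim
    case (elim j)
    have "real DIM('b) / real (Suc (m j)) \<le> real DIM('b)"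
      by (simp add: divide_le_eq)
    then have "norm (x j) + real DIM('b) / real (Suc (m j)) \<le> real (m j)"
      using B[of j] elim by linarith
    then show ?case by (rule gridpt_in_window)
  qed
qed

lemma card_cube_eq:
  "cube_counts m A' = cube_counts m A \<Longrightarrow> z \<in> grid_window m (real m) \<Longrightarrow>
     card (A' \<inter> cube m z) = card (A \<inter> cube m z)"
  by (drule fun_cong[of _ _ z]) (simp add: cube_counts_def)

text \<open>The cube around \<open>p\<close> has positive count in \<open>A\<close>, hence in
  \<open>A' j\<close> as soon as the window reaches it, and any point of \<open>A' j\<close> in that
  shrinking cube will do.\<close>

lemma conf_conv_approx:
  assumes "conf_conv A' A" "p \<in> A"
  obtains p' where "\<forall>\<^sub>F j in sequentially. p' j \<in> A' j" "p' \<longlonglongrightarrow> p"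
proof -
  obtain m where m: "filterlim m at_top sequentially" "\<And>j. cube_counts (m j) (A' j) = cube_counts (m j) A"
    and lf: "locally_finite A"
    using assms(1) unfolding conf_conv_def by blast
  \<comment> \<open>The default \<open>p\<close> lies in its own cube, so \<open>p' j\<close> and
    \<open>p\<close> share a cube for every \<open>j\<close> and convergence needs no case
    distinction.\<close>
  define p' where "p' j = (if A' j \<inter> cube (m j) (gridpt (m j) p) = {} then p
      else SOME q. q \<in> A' j \<inter> cube (m j) (gridpt (m j) p))" for j
  have in_cube: "p' j \<in> A' j \<inter> cube (m j) (gridpt (m j) p)" if "A' j \<inter> cube (m j) (gridpt (m j) p) \<noteq> {}" for j
    using that some_in_eq[of "A' j \<inter> cube (m j) (gridpt (m j) p)"] unfolding p'_def by simp
  have "\<forall>\<^sub>F j in sequentially. p' j \<in> A' j"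
    using eventually_in_window[OF m(1) tendsto_const[of p]]
  proof eventually_elim
    case (elim j)
    have "card (A \<inter> cube (m j) (gridpt (m j) p)) \<noteq> 0"
      using assms(2) locally_finite_bounded[OF lf bounded_cube] by (auto simp: cube_def)
    then have "A' j \<inter> cube (m j) (gridpt (m j) p) \<noteq> {}"
      using card_cube_eq[OF m(2) elim] by (intro notI) simp
    then show ?case using in_cube by auto
  qed
  moreover have "gridpt (m j) p = gridpt (m j) (p' j)" for j
    using in_cube[of j] by (cases "A' j \<inter> cube (m j) (gridpt (m j) p) = {}") (auto simp: p'_def cube_def)
  then have "p' \<longlonglongrightarrow> p"
    using gridpt_tendsto[OF m(1) _ tendsto_const[of p]] by blast
  ultimately show ?thesis using that by blast
qed

lemma same_counts_nearby:
  assumes lf: "locally_finite A" "locally_finite B"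
    and eq: "cube_counts m B = cube_counts m A"
    and p: "p \<in> B" "gridpt m p \<in> grid_window m (real m)"
  obtains q where "q \<in> A" "gridpt m q = gridpt m p"
proof -
  have "card (B \<inter> cube m (gridpt m p)) \<noteq> 0"
    using p(1) locally_finite_bounded[OF lf(2) bounded_cube] by (auto simp: cube_def)
  then have "A \<inter> cube m (gridpt m p) \<noteq> {}"
    using card_cube_eq[OF eq p(2)] by (intro notI) simp
  then show ?thesis using that by (auto simp: cube_def)
qed

text \<open>Each \<open>p' j\<close> shares its cube with a point of \<open>A\<close> once it lies
  in the window; these companions also converge to \<open>p\<close>, and local finiteness forces
  them to equal \<open>p\<close> eventually.\<close>

lemma conf_conv_limit_in:
  assumes "conf_conv A' A" "\<And>j. p' j \<in> A' j" "p' \<longlonglongrightarrow> p"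
  shows "p \<in> A"
proof -
  obtain m where m: "filterlim m at_top sequentially" "\<And>j. cube_counts (m j) (A' j) = cube_counts (m j) A"
    and lf: "locally_finite A" "\<And>j. locally_finite (A' j)"
    using assms(1) unfolding conf_conv_def by metis
  \<comment> \<open>Outside the window \<open>p' j\<close> itself serves as companion, so the
    equality of grid points holds for all \<open>j\<close>.\<close>
  have "\<exists>q. (gridpt (m j) (p' j) \<in> grid_window (m j) (real (m j)) \<longrightarrow> q \<in> A) \<and> gridpt (m j) (p' j) = gridpt (m j) q" for j
  proof (cases "gridpt (m j) (p' j) \<in> grid_window (m j) (real (m j))")
    case True
    obtain q where "q \<in> A" "gridpt (m j) q = gridpt (m j) (p' j)"
      using same_counts_nearby[OF lf m(2) assms(2) True] .
    then show ?thesis by metis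
  qed auto
  then obtain q where q: "\<And>j. gridpt (m j) (p' j) \<in> grid_window (m j) (real (m j)) \<Longrightarrow> q j \<in> A"
    "\<And>j. gridpt (m j) (p' j) = gridpt (m j) (q j)" by metis
  have "\<forall>\<^sub>F j in sequentially. q j \<in> A"
    using eventually_in_window[OF m(1) assms(3)] by (rule eventually_mono) (rule q(1))
  moreover have lim: "q \<longlonglongrightarrow> p"
    using gridpt_tendsto[OF m(1) q(2) assms(3)] .
  obtain e where e: "0 < e" "\<And>q. q \<in> A \<Longrightarrow> dist p q < e \<Longrightarrow> q = p"
    using locally_finite_isolated[OF lf(1)] by blast
  have "\<forall>\<^sub>F j in sequentially. dist (q j) p < e"
    using lim e(1) by (rule tendstoD)
  ultimately have "\<forall>\<^sub>F j in sequentially. p \<in> A"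
  proof eventually_elim
    case (elim j)
    then show ?case using e(2)[of "q j"] by (simp add: dist_commute)
  qed
  then show ?thesis by simp
qed

text \<open>Multiplicities enter here. If both sequences tended to \<open>q\<close>, both points
  would finally lie in the cube of \<open>q\<close>; that cube contains at most one point of
  \<open>A\<close>, hence at most one of \<open>A' j\<close>.\<close>

lemma conf_conv_limits_distinct:
  assumes "conf_conv A' A" and p: "\<And>j. p' j \<in> A' j" "p' \<longlonglongrightarrow> p"
    and q: "\<And>j. q' j \<in> A' j" "q' \<longlonglongrightarrow> q" and ne: "\<And>j. p' j \<noteq> q' j"
  shows "p \<noteq> q"
proof
  assume [simp]: "p = q"
  obtain m where m: "filterlim m at_top sequentially" "\<And>j. cube_counts (m j) (A' j) = cube_counts (m j) A"
    and lf: "locally_finite A" "\<And>j. locally_finite (A' j)"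
    using assms(1) unfolding conf_conv_def by metis
  obtain e where e: "0 < e" "\<And>r. r \<in> A \<Longrightarrow> dist q r < e \<Longrightarrow> r = q"
    using locally_finite_isolated[OF lf(1)] by blast
  \<comment> \<open>The whole cube of \<open>s j\<close>, not only \<open>s j\<close>, ends up in
    the isolating ball of \<open>q\<close>; otherwise points of these cubes staying outside the ball
    would converge to \<open>q\<close>.\<close>
  have *: "\<forall>\<^sub>F j in sequentially. \<forall>r. gridpt (m j) r = gridpt (m j) (s j) \<longrightarrow> dist q r < e"
    if s: "s \<longlonglongrightarrow> q" for s
  proof (rule ccontr)
    assume "\<not> ?thesis"
    from subseq_of_not_eventually[OF this] obtain k :: "nat \<Rightarrow> nat" where k: "strict_mono k"
      and k': "\<And>j. \<not> (\<forall>r. gridpt (m (k j)) r = gridpt (m (k j)) (s (k j)) \<longrightarrow> dist q r < e)" by metis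
    have "\<forall>j. \<exists>r. gridpt (m (k j)) (s (k j)) = gridpt (m (k j)) r \<and> \<not> dist q r < e"
      using k' by metis
    then obtain r where r: "\<And>j. gridpt (m (k j)) (s (k j)) = gridpt (m (k j)) (r j)" "\<And>j. \<not> dist q (r j) < e"
      by metis
    have "r \<longlonglongrightarrow> q"
      using gridpt_tendsto[OF filterlim_compose[OF m(1) filterlim_subseq[OF k]] r(1)]
        LIMSEQ_subseq_LIMSEQ[OF s k] by (simp add: o_def)
    then have "\<forall>\<^sub>F j in sequentially. dist (r j) q < e" using e(1) by (rule tendstoD)
    then show False using r(2) by (simp add: dist_commute)
  qed
  have "p' \<longlonglongrightarrow> q" using p(2) by simp
  from eventually_in_window[OF m(1) this] eventually_in_window[OF m(1) q(2)] *[OF this] *[OF q(2)]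
  have "\<forall>\<^sub>F j in sequentially. False"
  proof eventually_elim
    case (elim j)
    let ?zp = "gridpt (m j) (p' j)" and ?zq = "gridpt (m j) (q' j)"
    obtain r1 where r1: "r1 \<in> A" "gridpt (m j) r1 = ?zp"
      using same_counts_nearby[OF lf m(2) p(1) elim(1)] .
    obtain r2 where r2: "r2 \<in> A" "gridpt (m j) r2 = ?zq"
      using same_counts_nearby[OF lf m(2) q(1) elim(2)] .
    have "r1 = q" "r2 = q" using r1 r2 elim(3,4) e(2) by auto
    then have zz: "?zp = ?zq" using r1 r2 by simp
    have "A \<inter> cube (m j) ?zq \<subseteq> {q}"
      using elim(4) e(2) by (auto simp: cube_def)
    then have "card (A \<inter> cube (m j) ?zq) \<le> 1"
      by (metis card_mono finite.emptyI finite.insertI card.empty card_insert_disjoint empty_iff One_nat_def)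
    then have "card (A' j \<inter> cube (m j) ?zq) \<le> 1"
      using card_cube_eq[OF m(2) elim(2)] by simp
    moreover have "{p' j, q' j} \<subseteq> A' j \<inter> cube (m j) ?zq"
      using p(1) q(1) zz by (auto simp: cube_def)
    then have "card {p' j, q' j} \<le> card (A' j \<inter> cube (m j) ?zq)"
      by (intro card_mono locally_finite_bounded[OF lf(2) bounded_cube])
    ultimately show False using ne[of j] by simp
  qed
  then show False by simp
qed

section \<open>Laguerre cells\<close>

text \<open>The last clause says that the convex hull of the centres is all of space. Non-negative
  weights make \<open>power_fun w\<close> coercive in the weighted point.\<close>

definition admissible :: "('a::euclidean_space \<times> real) set \<Rightarrow> bool" where
  "admissible A \<longleftrightarrow> locally_finite A \<and> (\<forall>p\<in>A. 0 \<le> snd p) \<and>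
     (\<forall>u x. u \<noteq> 0 \<longrightarrow> (\<exists>p\<in>A. u \<bullet> x < u \<bullet> fst p))"

lemma admissible_nonempty: "admissible A \<Longrightarrow> A \<noteq> {}"
  unfolding admissible_def using nonempty_Basis nonzero_Basis by blast

text \<open>Coercivity of the power, the source of all finiteness and compactness below. The square
  root is avoided by the crude step from \<open>t^2 <= c\<close> to \<open>t <= c + 1\<close>; the
  weight contributes another \<open>c\<close>.\<close>

lemma norm_le_of_power_fun_le:
  assumes "norm w \<le> r" "0 \<le> snd p" "power_fun w p \<le> c"
  shows "norm p \<le> r + 2 * c + 1"
proof -
  have *: "(norm (w - fst p))\<^sup>2 \<le> c" "snd p \<le> c"
    using assms unfolding power_fun_def by (auto intro: order_trans[rotated] simp: add_increasing)
  have "norm (w - fst p) \<le> c + 1"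
  proof (cases "norm (w - fst p) \<le> 1")
    case True
    then show ?thesis using assms(2) *(2) by linarith
  next
    case False
    then have "norm (w - fst p) * 1 \<le> norm (w - fst p) * norm (w - fst p)"
      by (intro mult_left_mono) auto
    then show ?thesis using *(1) by (simp add: power2_eq_square)
  qed
  then have "norm (fst p) \<le> r + c + 1"
    using norm_triangle_sub[of "fst p" w] assms(1) by (simp add: norm_minus_commute)
  moreover have "norm p \<le> norm (fst p) + norm (snd p)"
    using norm_Pair_le[of "fst p" "snd p"] by simp
  ultimately show ?thesis using * assms(2) by simp
qed

lemma tendsto_power_fun [tendsto_intros]:
  assumes "(w \<longlongrightarrow> w') F" "(p \<longlongrightarrow> p') F"
  shows "((\<lambda>j. power_fun (w j) (p j)) \<longlongrightarrow> power_fun w' p') F"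
  unfolding power_fun_def by (intro tendsto_intros assms)

lemma closed_laguerre_cell: "closed (laguerre_cell p A)"
proof -
  have "laguerre_cell p A = (\<Inter>q\<in>A. {w. power_fun w p \<le> power_fun w q})"
    by (auto simp: laguerre_cell_def)
  moreover have "closed {w. power_fun w p \<le> power_fun w q}" for q :: "'a \<times> real"
    unfolding power_fun_def by (intro closed_Collect_le continuous_intros)
  ultimately show ?thesis by auto
qed

text \<open>The quadratic term in \<open>w\<close> cancels. Differences of powers are affine in
  \<open>w\<close>, so equality of powers is a linear equation for \<open>w\<close>.\<close>

lemma power_fun_diff:
  "power_fun w p - power_fun w q =
     (norm (fst p))\<^sup>2 + snd p - (norm (fst q))\<^sup>2 - snd q - 2 * (w \<bullet> (fst p - fst q))"
  unfolding power_fun_def power2_norm_eq_inner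
  by (simp add: inner_diff_left inner_diff_right inner_commute)

lemma minimiser_exists:
  assumes "admissible A"
  obtains p where "p \<in> A" "w \<in> laguerre_cell p A"
proof -
  obtain p0 where p0: "p0 \<in> A" using admissible_nonempty[OF assms] by blast
  define F where "F = {p \<in> A. power_fun w p \<le> power_fun w p0}"
  have "F \<subseteq> A \<inter> cball 0 (norm w + 2 * power_fun w p0 + 1)"
    using assms norm_le_of_power_fun_le[of w "norm w"] unfolding F_def admissible_def by auto
  then have "finite F"
    using locally_finite_bounded[OF _ bounded_cball] assms unfolding admissible_def
    by (meson finite_subset)
  moreover have "p0 \<in> F" using p0 by (simp add: F_def)
  then have "F \<noteq> {}" by blast
  ultimately obtain p where p: "p \<in> F" "\<And>q. q \<in> F \<Longrightarrow> power_fun w p \<le> power_fun w q"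
    using arg_min_if_finite(1)[of F "power_fun w"] arg_min_least[of F _ "power_fun w"] by metis
  have "power_fun w p \<le> power_fun w q" if "q \<in> A" for q
    using p that by (cases "q \<in> F") (auto simp: F_def)
  then show ?thesis
    using that[of p] p(1) by (simp add: F_def laguerre_cell_def)
qed

lemma two_minimisers_fst_neq:
  assumes "p \<in> A" "q \<in> A" "p \<noteq> q" "x \<in> laguerre_cell p A" "x \<in> laguerre_cell q A"
  shows "fst p \<noteq> fst q"
proof
  assume "fst p = fst q"
  moreover have "power_fun x p = power_fun x q"
    using assms by (auto simp: laguerre_cell_def intro: antisym)
  ultimately have "snd p = snd q" by (simp add: power_fun_def)
  with \<open>fst p = fst q\<close> \<open>p \<noteq> q\<close> show False by (simp add: prod_eq_iff)
qed

text \<open>Moving from \<open>x\<close> in the direction from the centre of \<open>p\<close> to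
  that of \<open>q\<close> makes \<open>q\<close> strictly better than \<open>p\<close>. The
  direction is nonzero because two points with equal centre and equal power at \<open>x\<close>
  coincide.\<close>

lemma two_minimisers_not_interior:
  assumes pq: "p \<in> A" "q \<in> A" "p \<noteq> q" "x \<in> laguerre_cell p A" "x \<in> laguerre_cell q A"
  shows "x \<notin> interior (laguerre_cell p A)"
proof
  assume "x \<in> interior (laguerre_cell p A)"
  then obtain e where e: "0 < e" "ball x e \<subseteq> laguerre_cell p A"
    by (meson mem_interior)
  define d where "d = fst q - fst p"
  have d: "d \<noteq> 0" using two_minimisers_fst_neq[OF pq] by (simp add: d_def)
  define t where "t = e / (2 * norm d)"
  have t: "0 < t" using d e by (simp add: t_def)
  have "dist x (x + t *\<^sub>R d) = e / 2" using d e by (simp add: dist_norm t_def)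
  then have "x + t *\<^sub>R d \<in> laguerre_cell p A" using e by auto
  then have "power_fun (x + t *\<^sub>R d) p - power_fun (x + t *\<^sub>R d) q \<le> 0"
    using pq(2) by (simp add: laguerre_cell_def)
  moreover have "power_fun x p - power_fun x q = 0"
    using pq by (auto simp: laguerre_cell_def intro: antisym)
  moreover have "power_fun (x + t *\<^sub>R d) p - power_fun (x + t *\<^sub>R d) q
      = power_fun x p - power_fun x q + 2 * t * (d \<bullet> d)"
    unfolding power_fun_diff d_def by (simp add: inner_diff_left inner_diff_right inner_add_left inner_commute algebra_simps)
  ultimately have "2 * t * (d \<bullet> d) \<le> 0" by simp
  moreover have "0 < d \<bullet> d" using d by simp
  ultimately show False using t by (simp add: mult_le_0_iff)
qed

text \<open>A fixed point of \<open>A\<close> has approximants in \<open>A' j\<close> whose power at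
  \<open>w j\<close> stays bounded; minimisers have smaller power, and coercivity bounds them. The
  index \<open>J\<close> appears because approximants belong to \<open>A' j\<close> only
  eventually.\<close>

lemma cell_points_bounded:
  assumes "conf_conv A' A" "A \<noteq> {}" "\<And>j. \<forall>p\<in>A' j. 0 \<le> snd p" "w \<longlonglongrightarrow> l"
  obtains J B where "\<And>j p. J \<le> j \<Longrightarrow> p \<in> A' j \<Longrightarrow> w j \<in> laguerre_cell p (A' j) \<Longrightarrow> norm p \<le> B"
proof -
  obtain q where "q \<in> A" using assms(2) by blast
  then obtain q' where q': "\<forall>\<^sub>F j in sequentially. q' j \<in> A' j" "q' \<longlonglongrightarrow> q"
    using conf_conv_approx[OF assms(1)] by blast
  obtain J where J: "\<And>j. J \<le> j \<Longrightarrow> q' j \<in> A' j"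
    using q'(1) by (auto simp: eventually_sequentially)
  have "(\<lambda>j. power_fun (w j) (q' j)) \<longlonglongrightarrow> power_fun l q"
    by (intro tendsto_intros assms(4) q'(2))
  then have "Bseq (\<lambda>j. power_fun (w j) (q' j))"
    by (intro convergent_imp_Bseq convergentI)
  then obtain c where c: "\<And>j. norm (power_fun (w j) (q' j)) \<le> c"
    by (auto simp: Bseq_def)
  obtain r where r: "\<And>j. norm (w j) \<le> r"
    using convergent_imp_Bseq[OF convergentI[OF assms(4)]] by (auto simp: Bseq_def)
  show ?thesis
  proof (rule that[of J "r + 2 * c + 1"])
    fix j p assume *: "J \<le> j" "p \<in> A' j" "w j \<in> laguerre_cell p (A' j)"
    then have "power_fun (w j) p \<le> power_fun (w j) (q' j)"
      using J by (auto simp: laguerre_cell_def)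
    also have "\<dots> \<le> c" using c[of j] by simp
    finally show "norm p \<le> r + 2 * c + 1"
      using norm_le_of_power_fun_le[OF r] assms(3) * by blast
  qed
qed

text \<open>Each competitor \<open>q\<close> in \<open>A\<close> is approximated by competitors in
  \<open>A' j\<close>, and the defining inequality passes to the limit.\<close>

lemma cell_limit:
  assumes "conf_conv A' A" "\<And>j. w j \<in> laguerre_cell (p j) (A' j)" "w \<longlonglongrightarrow> l" "p \<longlonglongrightarrow> p'"
  shows "l \<in> laguerre_cell p' A"
proof -
  have "power_fun l p' \<le> power_fun l q" if q: "q \<in> A" for q
  proof -
    obtain q' where q': "\<forall>\<^sub>F j in sequentially. q' j \<in> A' j" "q' \<longlonglongrightarrow> q"
      using conf_conv_approx[OF assms(1) q] by blast
    show ?thesis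
    proof (rule tendsto_le[OF sequentially_bot])
      show "(\<lambda>j. power_fun (w j) (q' j)) \<longlonglongrightarrow> power_fun l q" by (intro tendsto_intros assms q')
      show "(\<lambda>j. power_fun (w j) (p j)) \<longlonglongrightarrow> power_fun l p'" by (intro tendsto_intros assms q')
      show "\<forall>\<^sub>F j in sequentially. power_fun (w j) (p j) \<le> power_fun (w j) (q' j)"
        using q'(1) by eventually_elim (use assms(2) in \<open>auto simp: laguerre_cell_def\<close>)
    qed
  qed
  then show ?thesis by (simp add: laguerre_cell_def)
qed

lemma cell_subseq:
  assumes "conf_conv A' A" "A \<noteq> {}" "\<And>j. \<forall>p\<in>A' j. 0 \<le> snd p" "w \<longlonglongrightarrow> l"
    and p: "\<And>j. p j \<in> A' j" "\<And>j. w j \<in> laguerre_cell (p j) (A' j)"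
  obtains r :: "nat \<Rightarrow> nat" and p' where "strict_mono r" "(\<lambda>j. p (r j)) \<longlonglongrightarrow> p'" "p' \<in> A" "l \<in> laguerre_cell p' A"
proof -
  obtain J B where JB: "\<And>j p. J \<le> j \<Longrightarrow> p \<in> A' j \<Longrightarrow> w j \<in> laguerre_cell p (A' j) \<Longrightarrow> norm p \<le> B"
    using cell_points_bounded[OF assms(1-4)] by blast
  have "bounded (range (\<lambda>j. p (j + J)))"
    unfolding bounded_iff using JB[OF _ p] by (intro exI[of _ B]) auto
  from bounded_imp_convergent_subsequence[OF this] obtain s p' where
    s: "strict_mono s" and l: "((\<lambda>j. p (j + J)) \<circ> s) \<longlonglongrightarrow> p'" by blast
  define r where "r j = s j + J" for j
  have r: "strict_mono r" using s by (simp add: r_def strict_mono_def)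
  have l: "(\<lambda>j. p (r j)) \<longlonglongrightarrow> p'" using l by (simp add: r_def o_def)
  have c: "conf_conv (\<lambda>j. A' (r j)) A" using conf_conv_subseq[OF assms(1) r] .
  have wl: "(\<lambda>j. w (r j)) \<longlonglongrightarrow> l" using LIMSEQ_subseq_LIMSEQ[OF assms(4) r] by (simp add: o_def)
  show ?thesis
    by (rule that[OF r l conf_conv_limit_in[OF c p(1) l] cell_limit[OF c p(2) wl l]])
qed

text \<open>Points outside the cell and tending to \<open>y\<close> have minimisers other than
  \<open>p\<close>. The limit lemmas, applied to the constant sequence of configurations, yield a
  limiting minimiser at \<open>y\<close> that still differs from \<open>p\<close>.\<close>

lemma frontier_cell_second_minimiser:
  assumes A: "admissible A" and "p \<in> A" and y: "y \<in> frontier (laguerre_cell p A)"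
  obtains q where "q \<in> A" "q \<noteq> p" "y \<in> laguerre_cell p A" "y \<in> laguerre_cell q A"
proof -
  have "y \<in> closure (- laguerre_cell p A)"
    using y by (simp add: frontier_closures)
  then obtain w where w: "\<And>j. w j \<notin> laguerre_cell p A" "w \<longlonglongrightarrow> y"
    by (auto simp: closure_sequential)
  have "\<exists>q. q \<in> A \<and> w j \<in> laguerre_cell q A" for j
    using minimiser_exists[OF A] by metis
  then obtain q where q: "\<And>j. q j \<in> A" "\<And>j. w j \<in> laguerre_cell (q j) A" by metis
  have c: "conf_conv (\<lambda>_. A) A" using A by (simp add: admissible_def conf_conv_const)
  obtain r q' where r: "strict_mono r" "(\<lambda>j. q (r j)) \<longlonglongrightarrow> q'" "q' \<in> A" "y \<in> laguerre_cell q' A"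
    by (rule cell_subseq[OF c admissible_nonempty[OF A] _ w(2) q])
       (use A in \<open>auto simp: admissible_def\<close>)
  have "p \<noteq> q'"
  proof (rule conf_conv_limits_distinct[OF c _ tendsto_const _ r(2)])
    show "p \<noteq> q (r j)" for j using w(1)[of "r j"] q(2)[of "r j"] by metis
  qed (use assms q in auto)
  moreover have "y \<in> laguerre_cell p A"
    using y closed_laguerre_cell[of p A] by (metis Diff_iff closure_closed frontier_def)
  ultimately show ?thesis using that r by metis
qed

lemma interior_Union_empty_interiors:
  assumes "finite F" "\<And>S. S \<in> F \<Longrightarrow> closed S" "\<And>S. S \<in> F \<Longrightarrow> interior S = {}"
  shows "interior (\<Union>F) = {}"
  using assms
proof (induction F)
  case (insert S F)
  then have "interior (S \<union> \<Union>F) = interior S"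
    by (intro interior_closed_Un_empty_interior) auto
  then show ?case using insert by simp
qed simp

text \<open>A Laguerre diagram drops cells without interior, so such cells must not be needed to
  cover space. Only finitely many cells meet the unit ball around \<open>x\<close>; what the fat
  ones leave uncovered there is open and covered by finitely many closed sets with empty interior,
  hence empty.\<close>

lemma fat_cell_exists:
  assumes A: "admissible A"
  obtains p where "p \<in> A" "x \<in> laguerre_cell p A" "interior (laguerre_cell p A) \<noteq> {}"
proof -
  define P where "P = {p \<in> A. laguerre_cell p A \<inter> ball x 1 \<noteq> {}}"
  \<comment> \<open>A bound, over the whole unit ball around \<open>x\<close>, for the power of one
    reference point of \<open>A\<close>.\<close>
  define c where "c = (norm x + 1 + norm (fst (SOME p. p \<in> A)))\<^sup>2 + snd (SOME p. p \<in> A)"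
  have some: "(SOME p. p \<in> A) \<in> A"
    using admissible_nonempty[OF A] by (simp add: some_in_eq)
  have "P \<subseteq> A \<inter> cball 0 (norm x + 1 + 2 * c + 1)"
  proof
    fix p assume "p \<in> P"
    then obtain w where p: "p \<in> A" "w \<in> laguerre_cell p A" "w \<in> ball x 1" by (auto simp: P_def)
    have w: "norm w \<le> norm x + 1"
      using p(3) norm_triangle_sub[of w x] by (simp add: dist_norm norm_minus_commute)
    have "power_fun w p \<le> power_fun w (SOME p. p \<in> A)"
      using p(2) some by (auto simp: laguerre_cell_def)
    also have "\<dots> \<le> c"
      unfolding c_def power_fun_def
      using norm_triangle_ineq4[of w "fst (SOME p. p \<in> A)"] w by (auto intro!: power_mono)
    finally show "p \<in> A \<inter> cball 0 (norm x + 1 + 2 * c + 1)"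
      using norm_le_of_power_fun_le[OF w] p(1) A by (auto simp: admissible_def)
  qed
  then have fin: "finite P"
    using locally_finite_bounded[OF _ bounded_cball] A unfolding admissible_def
    by (meson finite_subset)
  define P1 where "P1 = {p \<in> P. interior (laguerre_cell p A) \<noteq> {}}"
  define U where "U = ball x 1 - (\<Union>p\<in>P1. laguerre_cell p A)"
  have "open U"
    unfolding U_def using fin by (intro open_Diff closed_UN) (auto simp: P1_def closed_laguerre_cell)
  moreover have "U \<subseteq> (\<Union>((\<lambda>p. laguerre_cell p A) ` (P - P1)))"
  proof
    fix w assume w: "w \<in> U"
    obtain p where "p \<in> A" "w \<in> laguerre_cell p A" using minimiser_exists[OF A] .
    then show "w \<in> (\<Union>((\<lambda>p. laguerre_cell p A) ` (P - P1)))"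
      using w unfolding U_def P_def by blast
  qed
  ultimately have "U \<subseteq> interior (\<Union>((\<lambda>p. laguerre_cell p A) ` (P - P1)))"
    by (rule interior_maximal[rotated])
  also have "\<dots> = {}"
    using fin by (intro interior_Union_empty_interiors) (auto simp: closed_laguerre_cell P1_def)
  finally have "x \<notin> U" by blast
  then show ?thesis using that by (auto simp: U_def P1_def P_def)
qed

text \<open>Boundaries are traded for pairs of minimisers, which behave well under limits. For the
  converse, \<open>x\<close> lies in a fat cell, and any second minimiser keeps it out of the
  interior of that cell.\<close>

lemma skel_laguerre_iff:
  assumes A: "admissible A"
  shows "x \<in> skel (laguerre_diagram A) \<longleftrightarrow>
    (\<exists>p\<in>A. \<exists>q\<in>A. p \<noteq> q \<and> x \<in> laguerre_cell p A \<and> x \<in> laguerre_cell q A)"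
proof
  assume "x \<in> skel (laguerre_diagram A)"
  then obtain p where p: "p \<in> A" "x \<in> frontier (laguerre_cell p A)"
    by (auto simp: skel_def laguerre_diagram_def)
  then obtain q where "q \<in> A" "q \<noteq> p" "x \<in> laguerre_cell p A" "x \<in> laguerre_cell q A"
    using frontier_cell_second_minimiser[OF A p] by metis
  then show "\<exists>p\<in>A. \<exists>q\<in>A. p \<noteq> q \<and> x \<in> laguerre_cell p A \<and> x \<in> laguerre_cell q A"
    using p by metis
next
  assume R: "\<exists>p\<in>A. \<exists>q\<in>A. p \<noteq> q \<and> x \<in> laguerre_cell p A \<and> x \<in> laguerre_cell q A"
  obtain p where p: "p \<in> A" "x \<in> laguerre_cell p A" "interior (laguerre_cell p A) \<noteq> {}"
    using fat_cell_exists[OF A] .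
  obtain q where "q \<in> A" "p \<noteq> q" "x \<in> laguerre_cell q A" using R by metis
  then have "x \<notin> interior (laguerre_cell p A)"
    using two_minimisers_not_interior p by metis
  then have "x \<in> frontier (laguerre_cell p A)"
    using p(2) by (simp add: frontier_def closure_closed closed_laguerre_cell)
  moreover have "laguerre_cell p A \<in> laguerre_diagram A"
    using p unfolding laguerre_diagram_def by blast
  ultimately show "x \<in> skel (laguerre_diagram A)"
    unfolding skel_def by blast
qed

text \<open>Both minimisers converge along a common subsequence, and they cannot merge by
  \<open>conf_conv_limits_distinct\<close>.\<close>

lemma skel_laguerre_upper:
  assumes "conf_conv A' A" "admissible A" "\<And>j. admissible (A' j)"
    and x: "\<And>j. x j \<in> skel (laguerre_diagram (A' j))" "x \<longlonglongrightarrow> l"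
  shows "l \<in> skel (laguerre_diagram A)"
proof -
  have "\<forall>j. \<exists>p q. p \<in> A' j \<and> q \<in> A' j \<and> p \<noteq> q \<and> x j \<in> laguerre_cell p (A' j) \<and> x j \<in> laguerre_cell q (A' j)"
    using x(1) skel_laguerre_iff[OF assms(3)] by blast
  then obtain p q where pq: "\<And>j. p j \<in> A' j" "\<And>j. q j \<in> A' j" "\<And>j. p j \<noteq> q j"
    "\<And>j. x j \<in> laguerre_cell (p j) (A' j)" "\<And>j. x j \<in> laguerre_cell (q j) (A' j)" by metis
  have h: "\<forall>p\<in>A' j. 0 \<le> snd p" for j using assms(3) by (simp add: admissible_def)
  obtain r p' where r: "strict_mono r" "(\<lambda>j. p (r j)) \<longlonglongrightarrow> p'" "p' \<in> A" "l \<in> laguerre_cell p' A"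
    using cell_subseq[OF assms(1) admissible_nonempty[OF assms(2)] h x(2) pq(1) pq(4)] .
  have cr: "conf_conv (\<lambda>j. A' (r j)) A" using conf_conv_subseq[OF assms(1) r(1)] .
  obtain s q' where s: "strict_mono s" "(\<lambda>j. q (r (s j))) \<longlonglongrightarrow> q'" "q' \<in> A" "l \<in> laguerre_cell q' A"
    using cell_subseq[OF cr admissible_nonempty[OF assms(2)] h
        LIMSEQ_subseq_LIMSEQ[OF x(2) r(1), unfolded o_def] pq(2) pq(5)] .
  have "p' \<noteq> q'"
    by (rule conf_conv_limits_distinct[OF conf_conv_subseq[OF cr s(1)] pq(1) _ pq(2) s(2) pq(3)])
       (use LIMSEQ_subseq_LIMSEQ[OF r(2) s(1)] in \<open>simp add: o_def\<close>)
  then show ?thesis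
    using skel_laguerre_iff[OF assms(2)] r(3,4) s(3,4) by blast
qed

text \<open>A ball missing the skeleton lies in a single cell; a limit of such cells is again a cell
  containing the ball.\<close>

lemma skel_laguerre_lower:
  assumes "conf_conv A' A" "admissible A" "\<And>j. admissible (A' j)"
    and x: "x \<in> skel (laguerre_diagram A)" "open G" "x \<in> G"
  shows "\<forall>\<^sub>F j in sequentially. skel (laguerre_diagram (A' j)) \<inter> G \<noteq> {}"
proof (rule ccontr)
  assume "\<not> ?thesis"
  from subseq_of_not_eventually[OF this] obtain r :: "nat \<Rightarrow> nat" where r: "strict_mono r"
    and r': "\<And>j. skel (laguerre_diagram (A' (r j))) \<inter> G = {}" by metis
  obtain e where e: "0 < e" "ball x e \<subseteq> G" using x(2,3) by (meson openE)
  have "\<exists>p. p \<in> A' (r j) \<and> x \<in> laguerre_cell p (A' (r j))" for j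
    using minimiser_exists[OF assms(3)] by metis
  then obtain p where p: "\<And>j. p j \<in> A' (r j)" "\<And>j. x \<in> laguerre_cell (p j) (A' (r j))" by metis
  have ball: "ball x e \<subseteq> laguerre_cell (p j) (A' (r j))" for j
  proof (rule ccontr)
    assume "\<not> ?thesis"
    moreover have "x \<in> ball x e \<inter> laguerre_cell (p j) (A' (r j))" using p(2) e by simp
    ultimately have "ball x e \<inter> frontier (laguerre_cell (p j) (A' (r j))) \<noteq> {}"
      by (intro connected_Int_frontier connected_ball) blast+
    then obtain y where y: "y \<in> ball x e" "y \<in> frontier (laguerre_cell (p j) (A' (r j)))" by blast
    obtain q where "q \<in> A' (r j)" "q \<noteq> p j" "y \<in> laguerre_cell (p j) (A' (r j))" "y \<in> laguerre_cell q (A' (r j))"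
      using frontier_cell_second_minimiser[OF assms(3) p(1) y(2)] .
    then have "y \<in> skel (laguerre_diagram (A' (r j)))"
      using skel_laguerre_iff[OF assms(3)] p(1) by metis
    then show False using r' y(1) e by blast
  qed
  have c: "conf_conv (\<lambda>j. A' (r j)) A" using conf_conv_subseq[OF assms(1) r] .
  have h: "\<forall>p\<in>A' j. 0 \<le> snd p" for j using assms(3) by (simp add: admissible_def)
  obtain s p' where s: "strict_mono s" "(\<lambda>j. p (s j)) \<longlonglongrightarrow> p'" "p' \<in> A" "x \<in> laguerre_cell p' A"
    using cell_subseq[OF c admissible_nonempty[OF assms(2)] h tendsto_const p] .
  have "ball x e \<subseteq> laguerre_cell p' A"
  proof
    fix y assume "y \<in> ball x e"
    then have "y \<in> laguerre_cell (p (s j)) (A' (r (s j)))" for j using ball by blast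
    then show "y \<in> laguerre_cell p' A"
      using cell_limit[OF conf_conv_subseq[OF c s(1)] _ tendsto_const s(2)] by blast
  qed
  then have "x \<in> interior (laguerre_cell p' A)"
    using e(1) by (meson mem_interior)
  moreover obtain q where "q \<in> A" "p' \<noteq> q" "x \<in> laguerre_cell q A"
    using x(1) skel_laguerre_iff[OF assms(2)] by metis
  ultimately show False
    using two_minimisers_not_interior s(3,4) by metis
qed

section \<open>Convex hulls of converging tuples\<close>

text \<open>A hyperplane strictly separating \<open>x\<close> from the limit hull also separates the
  nearby hulls from the nearby points.\<close>

lemma hull_limit:
  fixes v :: "nat \<Rightarrow> 'i \<Rightarrow> 'a::euclidean_space"
  assumes I: "finite I" and v: "\<And>i. i \<in> I \<Longrightarrow> (\<lambda>j. v j i) \<longlonglongrightarrow> l i"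
    and y: "\<And>j. y j \<in> convex hull (v j ` I)" "y \<longlonglongrightarrow> x"
  shows "x \<in> convex hull (l ` I)"
proof (rule ccontr)
  assume x: "x \<notin> convex hull (l ` I)"
  have "closed (convex hull (l ` I))"
    using I by (intro compact_imp_closed finite_imp_compact_convex_hull) auto
  from separating_hyperplane_closed_point[OF convex_convex_hull this x]
  obtain a b where ab: "a \<bullet> x < b" "\<And>z. z \<in> convex hull (l ` I) \<Longrightarrow> b < a \<bullet> z" by blast
  have "\<forall>\<^sub>F j in sequentially. \<forall>i\<in>I. b < a \<bullet> v j i"
  proof (rule eventually_ball_finite[OF I], rule ballI)
    fix i assume i: "i \<in> I"
    have "(\<lambda>j. a \<bullet> v j i) \<longlonglongrightarrow> a \<bullet> l i" by (intro tendsto_intros v i)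
    moreover have "b < a \<bullet> l i" using ab(2) i by (simp add: hull_inc)
    ultimately show "\<forall>\<^sub>F j in sequentially. b < a \<bullet> v j i" by (rule order_tendstoD)
  qed
  moreover have "(\<lambda>j. a \<bullet> y j) \<longlonglongrightarrow> a \<bullet> x" by (intro tendsto_intros y)
  then have "\<forall>\<^sub>F j in sequentially. a \<bullet> y j < b" using ab(1) by (rule order_tendstoD)
  ultimately have "\<forall>\<^sub>F j in sequentially. False"
  proof eventually_elim
    case (elim j)
    have "convex hull (v j ` I) \<subseteq> {z. b < a \<bullet> z}"
      using elim(1) by (intro hull_minimal convex_halfspace_gt) auto
    then show False using y(1)[of j] elim(2) by auto
  qed
  then show False by simp
qed

text \<open>The convex weights representing \<open>y\<close> are kept fixed while the vertices
  move.\<close>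

lemma hull_approx:
  fixes v :: "nat \<Rightarrow> 'i \<Rightarrow> 'a::euclidean_space"
  assumes I: "finite I" and v: "\<And>i. i \<in> I \<Longrightarrow> (\<lambda>j. v j i) \<longlonglongrightarrow> l i"
    and y: "y \<in> convex hull (l ` I)"
  obtains z where "\<And>j. z j \<in> convex hull (v j ` I)" "z \<longlonglongrightarrow> y"
proof -
  obtain u where u: "\<And>x. x \<in> l ` I \<Longrightarrow> 0 \<le> u x" "sum u (l ` I) = 1" "y = (\<Sum>x\<in>l ` I. u x *\<^sub>R x)"
    using y I by (auto simp: convex_hull_finite)
  \<comment> \<open>The map \<open>l\<close> may identify indices, and the weights belong to points;
    \<open>g\<close> picks one index for each point.\<close>
  define g where "g = inv_into I l"
  have g: "g x \<in> I" "l (g x) = x" if "x \<in> l ` I" for x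
    using that by (auto simp: g_def inv_into_into f_inv_into_f)
  show ?thesis
  proof (rule that[of "\<lambda>j. \<Sum>x\<in>l ` I. u x *\<^sub>R v j (g x)"])
    show "(\<Sum>x\<in>l ` I. u x *\<^sub>R v j (g x)) \<in> convex hull (v j ` I)" for j
      using I u g by (intro convex_sum convex_convex_hull) (auto intro!: hull_inc)
    have "(\<lambda>j. \<Sum>x\<in>l ` I. u x *\<^sub>R v j (g x)) \<longlonglongrightarrow> (\<Sum>x\<in>l ` I. u x *\<^sub>R l (g x))"
      by (intro tendsto_intros v g)
    also have "(\<Sum>x\<in>l ` I. u x *\<^sub>R l (g x)) = y"
      unfolding u(3) using g by (intro sum.cong) auto
    finally show "(\<lambda>j. \<Sum>x\<in>l ` I. u x *\<^sub>R v j (g x)) \<longlonglongrightarrow> y" .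
  qed
qed

text \<open>Points outside the hulls and close to \<open>y j\<close> are separated from the hulls by unit normals; a
  limit of these normals supports the limiting hull at \<open>x\<close>.\<close>

lemma frontier_hull_limit:
  fixes v :: "nat \<Rightarrow> 'i \<Rightarrow> 'a::euclidean_space"
  assumes I: "finite I" and v: "\<And>i. i \<in> I \<Longrightarrow> (\<lambda>j. v j i) \<longlonglongrightarrow> l i"
    and y: "\<And>j. y j \<in> frontier (convex hull (v j ` I))" "y \<longlonglongrightarrow> x"
  shows "x \<in> frontier (convex hull (l ` I))"
proof -
  have cl: "closed (convex hull (u ` I))" for u :: "'i \<Rightarrow> 'a"
    using I by (intro compact_imp_closed finite_imp_compact_convex_hull) auto
  have "y j \<in> convex hull (v j ` I)" for j
    using y(1)[of j] cl by (simp add: frontier_def)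
  then have xin: "x \<in> convex hull (l ` I)"
    by (intro hull_limit[OF I v _ y(2)])
  have "\<exists>z a. dist z (y j) < inverse (real (Suc j)) \<and> norm a = 1 \<and> (\<forall>k\<in>convex hull (v j ` I). a \<bullet> z \<le> a \<bullet> k)" for j
  proof -
    have "y j \<in> closure (- (convex hull (v j ` I)))" using y(1)[of j] by (simp add: frontier_closures)
    then obtain z where z: "z \<notin> convex hull (v j ` I)" "dist z (y j) < inverse (real (Suc j))"
      unfolding closure_approachable by (metis ComplD inverse_positive_iff_positive of_nat_0_less_iff zero_less_Suc)
    from separating_hyperplane_closed_point[OF convex_convex_hull cl z(1)]
    obtain a b where ab: "a \<bullet> z < b" "\<And>k. k \<in> convex hull (v j ` I) \<Longrightarrow> b < a \<bullet> k" by blast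
    have "y j \<in> convex hull (v j ` I)" by fact
    then have "a \<noteq> 0" using ab by force
    then have "norm (a /\<^sub>R norm a) = 1"
      and "\<forall>k\<in>convex hull (v j ` I). (a /\<^sub>R norm a) \<bullet> z \<le> (a /\<^sub>R norm a) \<bullet> k"
      using ab by (auto simp: divide_simps intro: order_trans less_imp_le)
    then show ?thesis using z(2) by blast
  qed
  then obtain z a where z: "\<And>j. dist (z j) (y j) < inverse (real (Suc j))"
    and a: "\<And>j. norm (a j) = 1" "\<And>j k. k \<in> convex hull (v j ` I) \<Longrightarrow> a j \<bullet> z j \<le> a j \<bullet> k"
    by metis
  have "bounded (range a)" using a(1) by (auto simp: bounded_iff)
  from bounded_imp_convergent_subsequence[OF this] obtain c r where
    r: "strict_mono r" "(a \<circ> r) \<longlonglongrightarrow> c" by blast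
  have c: "norm c = 1"
    using tendsto_norm[OF r(2)] a(1) by (simp add: o_def LIMSEQ_const_iff)
  have "(\<lambda>j. dist (z j) (y j)) \<longlonglongrightarrow> 0"
    by (rule Lim_null_comparison[OF _ LIMSEQ_inverse_real_of_nat])
       (use z in \<open>auto intro!: always_eventually less_imp_le\<close>)
  then have "(\<lambda>j. z j - y j) \<longlonglongrightarrow> 0"
    unfolding dist_norm by (rule tendsto_norm_zero_cancel)
  from tendsto_add[OF this y(2)] have zx: "z \<longlonglongrightarrow> x" by simp
  have le: "c \<bullet> x \<le> c \<bullet> l i" if i: "i \<in> I" for i
  proof (rule tendsto_le[OF sequentially_bot])
    show "(\<lambda>j. (a \<circ> r) j \<bullet> v (r j) i) \<longlonglongrightarrow> c \<bullet> l i"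
      using LIMSEQ_subseq_LIMSEQ[OF v[OF i] r(1)] by (intro tendsto_intros r(2)) (simp add: o_def)
    show "(\<lambda>j. (a \<circ> r) j \<bullet> z (r j)) \<longlonglongrightarrow> c \<bullet> x"
      using LIMSEQ_subseq_LIMSEQ[OF zx r(1)] by (intro tendsto_intros r(2)) (simp add: o_def)
    show "\<forall>\<^sub>F j in sequentially. (a \<circ> r) j \<bullet> z (r j) \<le> (a \<circ> r) j \<bullet> v (r j) i"
      using a(2) i by (simp add: hull_inc)
  qed
  have half: "convex hull (l ` I) \<subseteq> {k. c \<bullet> k \<ge> c \<bullet> x}"
    using le by (intro hull_minimal convex_halfspace_ge) auto
  have "x \<notin> interior (convex hull (l ` I))"
  proof
    assume "x \<in> interior (convex hull (l ` I))"
    then have "x \<in> interior {k. c \<bullet> k \<ge> c \<bullet> x}" using interior_mono[OF half] by blast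
    moreover have "c \<noteq> 0" using c by force
    ultimately show False by (simp add: interior_halfspace_ge)
  qed
  then show ?thesis using xin by (simp add: frontier_def cl)
qed

text \<open>Near \<open>x\<close> there are points of the moving hulls and also a point outside the
  limit hull, which stays outside the nearby hulls; a connected ball containing both kinds meets the
  frontier.\<close>

lemma frontier_hull_lower:
  fixes v :: "nat \<Rightarrow> 'i \<Rightarrow> 'a::euclidean_space"
  assumes I: "finite I" and v: "\<And>i. i \<in> I \<Longrightarrow> (\<lambda>j. v j i) \<longlonglongrightarrow> l i"
    and x: "x \<in> frontier (convex hull (l ` I))" "open G" "x \<in> G"
  shows "\<forall>\<^sub>F j in sequentially. frontier (convex hull (v j ` I)) \<inter> G \<noteq> {}"
proof -
  have cl: "closed (convex hull (u ` I))" for u :: "'i \<Rightarrow> 'a"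
    using I by (intro compact_imp_closed finite_imp_compact_convex_hull) auto
  obtain e where e: "0 < e" "ball x e \<subseteq> G" using x(2,3) by (meson openE)
  have "x \<in> convex hull (l ` I)" using x(1) cl by (simp add: frontier_def)
  from hull_approx[where l = l and v = v, OF I v this]
  obtain z where z: "\<And>j. z j \<in> convex hull (v j ` I)" "z \<longlonglongrightarrow> x" by blast
  have "x \<in> closure (- (convex hull (l ` I)))" using x(1) by (simp add: frontier_closures)
  then obtain y where y: "y \<notin> convex hull (l ` I)" "dist y x < e"
    unfolding closure_approachable using e(1) by blast
  have "\<forall>\<^sub>F j in sequentially. y \<notin> convex hull (v j ` I)"
  proof (rule ccontr)
    assume "\<not> ?thesis"
    from subseq_of_not_eventually[OF this] obtain r :: "nat \<Rightarrow> nat" where r: "strict_mono r"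
      and r': "\<And>j. y \<in> convex hull (v (r j) ` I)" by metis
    have "y \<in> convex hull (l ` I)"
      by (rule hull_limit[OF I _ r' tendsto_const])
         (use LIMSEQ_subseq_LIMSEQ[OF v r] in \<open>auto simp: o_def\<close>)
    then show False using y(1) by blast
  qed
  moreover have "\<forall>\<^sub>F j in sequentially. dist (z j) x < e"
    using z(2) e(1) by (rule tendstoD)
  ultimately show ?thesis
  proof eventually_elim
    case (elim j)
    have "ball x e \<inter> frontier (convex hull (v j ` I)) \<noteq> {}"
    proof (rule connected_Int_frontier[OF connected_ball])
      show "ball x e \<inter> convex hull (v j ` I) \<noteq> {}"
        using z(1)[of j] elim(2) by (auto simp: dist_commute)
      show "ball x e - convex hull (v j ` I) \<noteq> {}"
        using elim(1) y(2) by (auto simp: dist_commute)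
    qed
    then show ?case using e(2) by blast
  qed
qed

section \<open>Common points of \<open>d + 1\<close> cells\<close>

text \<open>Tuples of \<open>d + 1\<close> points are indexed by the zero vector and the basis vectors, so that the
  linear system for a common point of their cells is an endomorphism of \<open>'a\<close>.\<close>

abbreviation vertex_ix :: "'a::euclidean_space set" where
  "vertex_ix \<equiv> insert 0 Basis"

lemma zero_notin_Basis: "(0::'a::euclidean_space) \<notin> Basis"
  using nonzero_Basis by blast

lemma card_vertex_ix: "card (vertex_ix :: 'a::euclidean_space set) = DIM('a) + 1"
  by (simp add: zero_notin_Basis)

text \<open>The matrix whose rows are the edge vectors from vertex 0. Its injectivity is affine
  independence of the \<open>d + 1\<close> centres.\<close>

definition edge_map :: "('a::euclidean_space \<Rightarrow> 'a \<times> real) \<Rightarrow> 'a \<Rightarrow> 'a" where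
  "edge_map s u = (\<Sum>b\<in>Basis. (u \<bullet> (fst (s b) - fst (s 0))) *\<^sub>R b)"

definition power_rhs :: "('a::euclidean_space \<Rightarrow> 'a \<times> real) \<Rightarrow> 'a" where
  "power_rhs s = (\<Sum>b\<in>Basis. (((norm (fst (s b)))\<^sup>2 + snd (s b) - (norm (fst (s 0)))\<^sup>2 - snd (s 0)) / 2) *\<^sub>R b)"

text \<open>General position for weighted points: affinely independent centres, and the weighted
  analogue of having no \<open>d + 2\<close> points on a sphere.\<close>

definition generic :: "('a::euclidean_space \<times> real) set \<Rightarrow> bool" where
  "generic A \<longleftrightarrow> (\<forall>s. inj_on s vertex_ix \<and> s ` vertex_ix \<subseteq> A \<longrightarrow>
     (\<forall>u. edge_map s u = 0 \<longrightarrow> u = 0) \<and>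
     (\<forall>q\<in>A - s ` vertex_ix. \<forall>w. \<exists>i\<in>vertex_ix. power_fun w (s i) \<noteq> power_fun w q))"

lemma linear_edge_map: "linear (edge_map s)"
  unfolding edge_map_def
  by (intro linearI) (simp_all add: inner_add_left scaleR_add_left sum.distrib scaleR_sum_right)

lemma equal_power_iff:
  "(\<forall>i\<in>vertex_ix. power_fun w (s i) = power_fun w (s 0)) \<longleftrightarrow> edge_map s w = power_rhs s"
proof -
  have "(power_fun w (s b) = power_fun w (s 0)) \<longleftrightarrow> edge_map s w \<bullet> b = power_rhs s \<bullet> b" if b: "b \<in> Basis" for b
    using power_fun_diff[of w "s b" "s 0"] b
    by (simp add: edge_map_def power_rhs_def inner_sum_left_Basis) linarith
  then show ?thesis by (auto simp: euclidean_eq_iff[of "edge_map s w"])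
qed

text \<open>An injective linear map is bounded below by some \<open>B\<close>; the perturbed maps
  converge in operator norm and keep the bound \<open>B / 2\<close>. This gives solvability and also
  bounds the error by the residual of \<open>w\<close> in the perturbed system.\<close>

lemma perturbed_centre:
  fixes s :: "'a::euclidean_space \<Rightarrow> 'a \<times> real"
  assumes inj: "\<And>u. edge_map s u = 0 \<Longrightarrow> u = 0"
    and s': "\<And>i. i \<in> vertex_ix \<Longrightarrow> (\<lambda>j. s' j i) \<longlonglongrightarrow> s i"
    and w: "edge_map s w = power_rhs s"
  obtains w' where "w' \<longlonglongrightarrow> w" "\<forall>\<^sub>F j in sequentially. edge_map (s' j) (w' j) = power_rhs (s' j)"
proof -
  have "inj (edge_map s)"
    using inj linear_injective_0[OF linear_edge_map] by blast
  then obtain B where B: "0 < B" "\<And>u. B * norm u \<le> norm (edge_map s u)"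
    using linear_inj_bounded_below_pos[OF linear_edge_map] by blast
  \<comment> \<open>An upper bound for the operator norm of the difference of the two edge
    maps.\<close>
  define d where "d j = (\<Sum>b\<in>Basis. norm ((fst (s' j b) - fst (s' j 0)) - (fst (s b) - fst (s 0))))" for j
  have "d \<longlonglongrightarrow> (\<Sum>b\<in>Basis. norm ((fst (s b) - fst (s 0)) - (fst (s b) - fst (s 0))))"
    unfolding d_def by (intro tendsto_intros s') auto
  then have "d \<longlonglongrightarrow> 0" by simp
  have diff: "norm (edge_map (s' j) u - edge_map s u) \<le> d j * norm u" for j u
  proof -
    have "edge_map (s' j) u - edge_map s u
        = (\<Sum>b\<in>Basis. (u \<bullet> ((fst (s' j b) - fst (s' j 0)) - (fst (s b) - fst (s 0)))) *\<^sub>R b)"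
      unfolding edge_map_def by (simp add: sum_subtractf[symmetric] inner_diff_right algebra_simps)
    also have "norm \<dots> \<le> (\<Sum>b\<in>Basis. norm ((fst (s' j b) - fst (s' j 0)) - (fst (s b) - fst (s 0))) * norm u)"
      by (intro sum_norm_le) (auto intro: order_trans[OF Cauchy_Schwarz_ineq2] simp: mult.commute)
    finally show ?thesis by (simp add: d_def sum_distrib_right)
  qed
  have "\<forall>\<^sub>F j in sequentially. d j < B / 2"
    using order_tendstoD(2)[OF \<open>d \<longlonglongrightarrow> 0\<close>, of "B / 2"] B(1) by simp
  then have ev: "\<forall>\<^sub>F j in sequentially. \<forall>u. B / 2 * norm u \<le> norm (edge_map (s' j) u)"
  proof eventually_elim
    case (elim j)
    show ?case
    proof
      fix u
      have "norm (edge_map s u) \<le> norm (edge_map (s' j) u) + norm (edge_map (s' j) u - edge_map s u)"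
        by (metis norm_minus_commute norm_triangle_sub)
      also have "norm (edge_map (s' j) u - edge_map s u) \<le> B / 2 * norm u"
        using diff[of j u] elim by (meson less_imp_le mult_right_mono norm_ge_zero order_trans)
      finally show "B / 2 * norm u \<le> norm (edge_map (s' j) u)" using B(2)[of u] by (simp add: field_simps)
    qed
  qed
  \<comment> \<open>An arbitrary value for those \<open>j\<close> at which the perturbed system has
    no solution; this concerns only an initial segment.\<close>
  define w' where "w' j = (SOME u. edge_map (s' j) u = power_rhs (s' j))" for j
  have sol: "\<forall>\<^sub>F j in sequentially. edge_map (s' j) (w' j) = power_rhs (s' j)"
    using ev
  proof eventually_elim
    case (elim j)
    have "u = 0" if "edge_map (s' j) u = 0" for u
      using elim[rule_format, of u] that B(1) by (simp add: mult_le_0_iff)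
    then have "inj (edge_map (s' j))"
      using linear_injective_0[OF linear_edge_map] by blast
    then have "surj (edge_map (s' j))"
      using linear_injective_imp_surjective[OF linear_edge_map] by blast
    then have "\<exists>u. edge_map (s' j) u = power_rhs (s' j)" by (metis surjD)
    then show ?case unfolding w'_def by (rule someI_ex)
  qed
  have "(\<lambda>j. w' j - w) \<longlonglongrightarrow> 0"
  proof (rule Lim_null_comparison)
    show "\<forall>\<^sub>F j in sequentially. norm (w' j - w) \<le> 2 / B * norm (power_rhs (s' j) - edge_map (s' j) w)"
      using ev sol
    proof eventually_elim
      case (elim j)
      have "edge_map (s' j) (w' j - w) = power_rhs (s' j) - edge_map (s' j) w"
        using elim(2) linear_diff[OF linear_edge_map, of "s' j"] by simp
      then have "B / 2 * norm (w' j - w) \<le> norm (power_rhs (s' j) - edge_map (s' j) w)"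
        using elim(1) by metis
      then show ?case using B(1) by (simp add: field_simps)
    qed
    have "(\<lambda>j. 2 / B * norm (power_rhs (s' j) - edge_map (s' j) w)) \<longlonglongrightarrow> 2 / B * norm (power_rhs s - edge_map s w)"
      unfolding power_rhs_def edge_map_def by (intro tendsto_intros s') auto
    then show "(\<lambda>j. 2 / B * norm (power_rhs (s' j) - edge_map (s' j) w)) \<longlonglongrightarrow> 0"
      using w by simp
  qed
  then have "w' \<longlonglongrightarrow> w" by (simp add: LIM_zero_iff)
  then show ?thesis using that sol by blast
qed

text \<open>Sets of \<open>d + 1\<close> points become injective tuples over a fixed index set, so
  that limits can be taken vertex by vertex.\<close>

lemma skel_dual_iff:
  "x \<in> skel (dual_laguerre (A :: ('a::euclidean_space \<times> real) set)) \<longleftrightarrow>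
     (\<exists>(s :: 'a \<Rightarrow> 'a \<times> real) w. inj_on s vertex_ix \<and> s ` vertex_ix \<subseteq> A \<and> (\<forall>i\<in>vertex_ix. w \<in> laguerre_cell (s i) A) \<and>
        x \<in> frontier (convex hull ((\<lambda>i. fst (s i)) ` vertex_ix)))"
proof
  assume "x \<in> skel (dual_laguerre A)"
  then obtain S where S: "S \<subseteq> A" "card S = DIM('a) + 1" "(\<Inter>p\<in>S. laguerre_cell p A) \<noteq> {}"
    "x \<in> frontier (convex hull (fst ` S))"
    by (auto simp: skel_def dual_laguerre_def)
  have "finite S" using S(2) card_ge_0_finite[of S] by simp
  then obtain s where s: "bij_betw s (vertex_ix :: 'a set) S"
    using finite_same_card_bij[of "vertex_ix :: 'a set" S] S(2) card_vertex_ix[where 'a = 'a] by auto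
  obtain w where w: "\<And>p. p \<in> S \<Longrightarrow> w \<in> laguerre_cell p A" using S(3) by blast
  have im: "s ` vertex_ix = S" and inj: "inj_on s vertex_ix"
    using s by (simp_all add: bij_betw_def)
  have "(\<lambda>i. fst (s i)) ` vertex_ix = fst ` S"
    unfolding im[symmetric] image_image ..
  then have "x \<in> frontier (convex hull ((\<lambda>i. fst (s i)) ` vertex_ix))" using S(4) by simp
  moreover have "\<forall>i\<in>vertex_ix. w \<in> laguerre_cell (s i) A" using w im by blast
  moreover have "s ` vertex_ix \<subseteq> A" using im S(1) by simp
  ultimately show "\<exists>(s :: 'a \<Rightarrow> 'a \<times> real) w. inj_on s vertex_ix \<and> s ` vertex_ix \<subseteq> A \<and> (\<forall>i\<in>vertex_ix. w \<in> laguerre_cell (s i) A) \<and>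
        x \<in> frontier (convex hull ((\<lambda>i. fst (s i)) ` vertex_ix))"
    using inj by blast
next
  assume "\<exists>(s :: 'a \<Rightarrow> 'a \<times> real) w. inj_on s vertex_ix \<and> s ` vertex_ix \<subseteq> A \<and> (\<forall>i\<in>vertex_ix. w \<in> laguerre_cell (s i) A) \<and>
        x \<in> frontier (convex hull ((\<lambda>i. fst (s i)) ` vertex_ix))"
  then obtain s :: "'a \<Rightarrow> 'a \<times> real" and w where s: "inj_on s vertex_ix" "s ` vertex_ix \<subseteq> A"
    "\<And>i. i \<in> vertex_ix \<Longrightarrow> w \<in> laguerre_cell (s i) A"
    "x \<in> frontier (convex hull ((\<lambda>i. fst (s i)) ` vertex_ix))" by blast
  have "card (s ` vertex_ix) = DIM('a) + 1"
    using card_image[OF s(1)] card_vertex_ix[where 'a = 'a] by simp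
  moreover have "w \<in> (\<Inter>p\<in>s ` vertex_ix. laguerre_cell p A)" using s(3) by blast
  ultimately have "convex hull (fst ` (s ` vertex_ix)) \<in> dual_laguerre A"
    using s(2) unfolding dual_laguerre_def by blast
  then show "x \<in> skel (dual_laguerre A)"
    using s(4) unfolding skel_def image_image by blast
qed

text \<open>If the centres escaped to infinity in the direction \<open>u\<close>, the empty balls around them would
  in the limit fill the half-space \<open>u \<bullet> v > u \<bullet> x\<close>. The parameter \<open>\<theta> = 1 / (1 + \<parallel>w - x\<parallel>)\<close> treats
  bounded and unbounded centres at once.\<close>

lemma centre_subseq:
  assumes "conf_conv A' A" "admissible A" and x: "x \<longlonglongrightarrow> l"
    and w: "\<And>j p. p \<in> A' j \<Longrightarrow> (norm (w j - x j))\<^sup>2 \<le> power_fun (w j) p"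
  obtains r :: "nat \<Rightarrow> nat" and c where "strict_mono r" "(\<lambda>j. w (r j)) \<longlonglongrightarrow> c"
proof -
  define t where "t j = norm (w j - x j)" for j
  \<comment> \<open>The fallback to a basis vector keeps \<open>u j\<close> a unit vector when
    \<open>w j = x j\<close>.\<close>
  define u where "u j = (if t j = 0 then SOME b. b \<in> Basis else (w j - x j) /\<^sub>R t j)" for j
  define \<theta> where "\<theta> j = 1 / (1 + t j)" for j
  have t0: "0 \<le> t j" for j by (simp add: t_def)
  have u1: "norm (u j) = 1" for j
    using some_in_eq[of "Basis :: 'a set"] by (auto simp: u_def t_def)
  have wu: "w j = x j + t j *\<^sub>R u j" for j by (auto simp: u_def t_def)
  have \<theta>: "0 < \<theta> j" "\<theta> j \<le> 1" "t j * \<theta> j = 1 - \<theta> j" "t j = 1 / \<theta> j - 1" for j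
    using t0[of j] by (auto simp: \<theta>_def field_simps)
  have "bounded (range (\<lambda>j. (u j, \<theta> j)))"
    unfolding bounded_iff
  proof (intro exI ballI)
    fix z assume "z \<in> range (\<lambda>j. (u j, \<theta> j))"
    then obtain j where "z = (u j, \<theta> j)" by blast
    then show "norm z \<le> 2"
      using norm_Pair_le[of "u j" "\<theta> j"] u1[of j] \<theta>(1,2)[of j] by simp
  qed
  from bounded_imp_convergent_subsequence[OF this] obtain z r where
    r: "strict_mono r" and z: "((\<lambda>j. (u j, \<theta> j)) \<circ> r) \<longlonglongrightarrow> z" by blast
  have ul: "(\<lambda>j. u (r j)) \<longlonglongrightarrow> fst z" using tendsto_fst[OF z] by (simp add: o_def)
  have \<theta>l: "(\<lambda>j. \<theta> (r j)) \<longlonglongrightarrow> snd z" using tendsto_snd[OF z] by (simp add: o_def)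
  have xl: "(\<lambda>j. x (r j)) \<longlonglongrightarrow> l" using LIMSEQ_subseq_LIMSEQ[OF x r] by (simp add: o_def)
  have c: "conf_conv (\<lambda>j. A' (r j)) A" using conf_conv_subseq[OF assms(1) r] .
  have "snd z \<noteq> 0"
  proof
    assume z0: "snd z = 0"
    have "fst z \<bullet> fst p \<le> fst z \<bullet> l" if p: "p \<in> A" for p
    proof -
      obtain p' where p': "\<forall>\<^sub>F j in sequentially. p' j \<in> A' (r j)" "p' \<longlonglongrightarrow> p"
        using conf_conv_approx[OF c p] .
      \<comment> \<open>The hypothesis on \<open>w\<close> is multiplied by \<theta>; as
        \<open>t * \<theta> = 1 - \<theta>\<close>, all terms stay bounded. At \<theta> = 0 only the
        linear term survives and places every centre in one half-space.\<close>
      have "0 \<le> snd z * ((norm (l - fst p))\<^sup>2 + snd p) + 2 * (1 - snd z) * (fst z \<bullet> (l - fst p))"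
      proof (rule tendsto_le[OF sequentially_bot _ tendsto_const])
        show "(\<lambda>j. \<theta> (r j) * ((norm (x (r j) - fst (p' j)))\<^sup>2 + snd (p' j))
            + 2 * (1 - \<theta> (r j)) * (u (r j) \<bullet> (x (r j) - fst (p' j))))
          \<longlonglongrightarrow> snd z * ((norm (l - fst p))\<^sup>2 + snd p) + 2 * (1 - snd z) * (fst z \<bullet> (l - fst p))"
          by (intro tendsto_intros \<theta>l xl ul p'(2))
        show "\<forall>\<^sub>F j in sequentially. 0 \<le> \<theta> (r j) * ((norm (x (r j) - fst (p' j)))\<^sup>2 + snd (p' j))
            + 2 * (1 - \<theta> (r j)) * (u (r j) \<bullet> (x (r j) - fst (p' j)))"
          using p'(1)
        proof eventually_elim
          case (elim j)
          let ?k = "r j"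
          have uu: "u ?k \<bullet> u ?k = 1" using u1[of ?k] by (simp add: norm_eq_1)
          have "(t ?k)\<^sup>2 \<le> (norm (w ?k - fst (p' j)))\<^sup>2 + snd (p' j)"
            using w[OF elim] by (simp add: t_def power_fun_def)
          also have "(norm (w ?k - fst (p' j)))\<^sup>2
              = (norm (x ?k - fst (p' j)))\<^sup>2 + 2 * t ?k * (u ?k \<bullet> (x ?k - fst (p' j))) + (t ?k)\<^sup>2 * (u ?k \<bullet> u ?k)"
            unfolding power2_norm_eq_inner wu[of ?k]
            by (simp add: inner_diff_left inner_diff_right inner_add_left inner_add_right inner_commute
                algebra_simps power2_eq_square)
          finally have "0 \<le> ((norm (x ?k - fst (p' j)))\<^sup>2 + snd (p' j)) + 2 * t ?k * (u ?k \<bullet> (x ?k - fst (p' j)))"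
            using uu by simp
          then have "0 \<le> \<theta> ?k * (((norm (x ?k - fst (p' j)))\<^sup>2 + snd (p' j)) + 2 * t ?k * (u ?k \<bullet> (x ?k - fst (p' j))))"
            using \<theta>(1)[of ?k] by (intro mult_nonneg_nonneg) auto
          also have "\<dots> = \<theta> ?k * ((norm (x ?k - fst (p' j)))\<^sup>2 + snd (p' j))
            + 2 * (t ?k * \<theta> ?k) * (u ?k \<bullet> (x ?k - fst (p' j)))"
            by (simp add: algebra_simps)
          finally show ?case unfolding \<theta>(3) .
        qed
      qed
      then show ?thesis using z0 by (simp add: inner_diff_right)
    qed
    moreover have "norm (fst z) = 1"
      using tendsto_norm[OF ul] u1 by (simp add: LIMSEQ_const_iff)
    then have "fst z \<noteq> 0" by force
    ultimately show False
      using assms(2) unfolding admissible_def by (meson not_less)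
  qed
  then have "(\<lambda>j. x (r j) + (1 / \<theta> (r j) - 1) *\<^sub>R u (r j)) \<longlonglongrightarrow> l + (1 / snd z - 1) *\<^sub>R fst z"
    by (intro tendsto_intros xl ul \<theta>l)
  then have "(\<lambda>j. w (r j)) \<longlonglongrightarrow> l + (1 / snd z - 1) *\<^sub>R fst z"
    unfolding \<theta>(4)[symmetric] wu[symmetric] .
  then show ?thesis using that r by blast
qed

text \<open>As weights are non-negative, the vertices lie within the square root of the minimal
  power from \<open>w j\<close>; so does their hull, and with it \<open>x j\<close>. This is the
  hypothesis of \<open>centre_subseq\<close>. With convergent centres the vertices stay bounded, and
  minimality, distinctness and the frontier condition pass to the limit.\<close>

lemma skel_dual_upper:
  fixes A :: "('a::euclidean_space \<times> real) set"
  assumes "conf_conv A' A" "admissible A" "\<And>j. admissible (A' j)"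
    and x: "\<And>j. x j \<in> skel (dual_laguerre (A' j))" "x \<longlonglongrightarrow> l"
  shows "l \<in> skel (dual_laguerre A)"
proof -
  define R where "R j s w \<longleftrightarrow> inj_on s vertex_ix \<and> s ` vertex_ix \<subseteq> A' j \<and>
      (\<forall>i\<in>vertex_ix. w \<in> laguerre_cell (s i) (A' j)) \<and> x j \<in> frontier (convex hull ((\<lambda>i. fst (s i)) ` vertex_ix))"
    for j and s :: "'a \<Rightarrow> 'a \<times> real" and w
  have "\<exists>s w. R j s w" for j
    using x(1)[of j] unfolding skel_dual_iff R_def by simp
  then obtain s w where "\<And>j. R j (s j) (w j)" by metis
  then have s: "\<And>j. inj_on (s j) vertex_ix" "\<And>j. s j ` vertex_ix \<subseteq> A' j"
    "\<And>j i. i \<in> vertex_ix \<Longrightarrow> w j \<in> laguerre_cell (s j i) (A' j)"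
    "\<And>j. x j \<in> frontier (convex hull ((\<lambda>i. fst (s j i)) ` vertex_ix))"
    unfolding R_def by blast+
  have h: "\<forall>p\<in>A' j. 0 \<le> snd p" for j using assms(3) by (simp add: admissible_def)
  have "(norm (w j - x j))\<^sup>2 \<le> power_fun (w j) p" if p: "p \<in> A' j" for j p
  proof -
    have le: "(norm (w j - fst (s j i)))\<^sup>2 \<le> power_fun (w j) p" if i: "i \<in> vertex_ix" for i
    proof -
      have "s j i \<in> A' j" using s(2) i by blast
      then have "(norm (w j - fst (s j i)))\<^sup>2 \<le> power_fun (w j) (s j i)"
        using h by (auto simp: power_fun_def)
      also have "\<dots> \<le> power_fun (w j) p" using s(3)[OF i] p by (auto simp: laguerre_cell_def)
      finally show ?thesis .
    qed
    then have "dist (w j) (fst (s j i)) \<le> sqrt (power_fun (w j) p)" if "i \<in> vertex_ix" for i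
      using that by (simp add: dist_norm real_le_rsqrt)
    then have "convex hull ((\<lambda>i. fst (s j i)) ` vertex_ix) \<subseteq> cball (w j) (sqrt (power_fun (w j) p))"
      by (intro hull_minimal convex_cball) auto
    moreover have "closed (convex hull ((\<lambda>i. fst (s j i)) ` vertex_ix))"
      by (intro compact_imp_closed finite_imp_compact_convex_hull) auto
    then have "x j \<in> convex hull ((\<lambda>i. fst (s j i)) ` vertex_ix)"
      using s(4)[of j] by (simp add: frontier_def)
    ultimately have "norm (w j - x j) \<le> sqrt (power_fun (w j) p)" by (auto simp: dist_norm)
    moreover have "0 \<le> power_fun (w j) p" using le[of 0] by (auto intro: order_trans[rotated])
    ultimately show ?thesis
      by (metis norm_ge_zero power_mono real_sqrt_pow2)
  qed
  from centre_subseq[OF assms(1,2) x(2) this] obtain r c where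
    r: "strict_mono r" "(\<lambda>j. w (r j)) \<longlonglongrightarrow> c" by blast
  have cr: "conf_conv (\<lambda>j. A' (r j)) A" using conf_conv_subseq[OF assms(1) r(1)] .
  obtain J B where JB: "\<And>j p. J \<le> j \<Longrightarrow> p \<in> A' (r j) \<Longrightarrow> w (r j) \<in> laguerre_cell p (A' (r j)) \<Longrightarrow> norm p \<le> B"
    using cell_points_bounded[OF cr admissible_nonempty[OF assms(2)] h r(2)] by blast
  have "norm (s (r (j + J)) i) \<le> B" if "i \<in> vertex_ix" for i j
    using JB[of "j + J"] s(2) s(3)[OF that] that by (meson image_subset_iff le_add2)
  then have bd: "bounded (range (\<lambda>j. s (r (j + J)) i))" if "i \<in> vertex_ix" for i
    unfolding bounded_iff using that by blast
  have fin: "finite (vertex_ix :: 'a set)" by simp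
  have "\<exists>k q. strict_mono (k :: nat \<Rightarrow> nat) \<and> (\<forall>i\<in>vertex_ix. (\<lambda>j. s (r (k j + J)) i) \<longlonglongrightarrow> q i)"
    by (rule bounded_tuple_subseq[where x = "\<lambda>j i. s (r (j + J)) i", OF fin bd], assumption)
       (intro exI conjI ballI; assumption)
  then obtain k q where k: "strict_mono (k :: nat \<Rightarrow> nat)"
    and q: "\<And>i. i \<in> vertex_ix \<Longrightarrow> (\<lambda>j. s (r (k j + J)) i) \<longlonglongrightarrow> q i" by blast
  define n where "n j = r (k j + J)" for j
  have k': "strict_mono (\<lambda>j. k j + J)" using k by (simp add: strict_mono_def)
  have n: "strict_mono n" unfolding n_def using strict_mono_o[OF r(1) k'] by (simp add: o_def)
  have cn: "conf_conv (\<lambda>j. A' (n j)) A" using conf_conv_subseq[OF assms(1) n] .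
  have wn: "(\<lambda>j. w (n j)) \<longlonglongrightarrow> c"
    using LIMSEQ_subseq_LIMSEQ[OF r(2) k'] by (simp add: n_def o_def)
  have qn: "(\<lambda>j. s (n j) i) \<longlonglongrightarrow> q i" if "i \<in> vertex_ix" for i
    using q[OF that] by (simp add: n_def)
  have mem: "s (n j) i \<in> A' (n j)" if "i \<in> vertex_ix" for i j using s(2) that by blast
  have "inj_on q vertex_ix"
  proof (rule inj_onI, rule ccontr)
    fix i i' assume i: "i \<in> vertex_ix" "i' \<in> vertex_ix" "q i = q i'" "i \<noteq> i'"
    then have "s (n j) i \<noteq> s (n j) i'" for j using s(1) by (meson inj_onD)
    from conf_conv_limits_distinct[OF cn mem[OF i(1)] qn[OF i(1)] mem[OF i(2)] qn[OF i(2)] this]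
    show False using i(3) by blast
  qed
  moreover have "q ` vertex_ix \<subseteq> A"
    using conf_conv_limit_in[OF cn mem qn] by blast
  moreover have "\<forall>i\<in>vertex_ix. c \<in> laguerre_cell (q i) A"
    using cell_limit[OF cn s(3) wn qn] by blast
  moreover have "l \<in> frontier (convex hull ((\<lambda>i. fst (q i)) ` vertex_ix))"
    by (rule frontier_hull_limit[OF _ _ s(4)])
       (use LIMSEQ_subseq_LIMSEQ[OF x(2) n] qn in \<open>auto simp: o_def intro: tendsto_fst\<close>)
  ultimately show ?thesis unfolding skel_dual_iff by blast
qed

text \<open>Vertices of the simplex are approximated in \<open>A' j\<close>, and the perturbed
  centre gives them equal power. If they failed to be minimisers infinitely often, the true
  minimisers would converge to a further point of \<open>A\<close> with the same power at
  \<open>w\<close>, against general position.\<close>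

lemma skel_dual_lower:
  fixes A :: "('a::euclidean_space \<times> real) set"
  assumes "conf_conv A' A" "admissible A" "generic A" "\<And>j. admissible (A' j)"
    and x: "x \<in> skel (dual_laguerre A)" "open G" "x \<in> G"
  shows "\<forall>\<^sub>F j in sequentially. skel (dual_laguerre (A' j)) \<inter> G \<noteq> {}"
proof -
  obtain s :: "'a \<Rightarrow> 'a \<times> real" and w where s: "inj_on s vertex_ix" "s ` vertex_ix \<subseteq> A"
    "\<And>i. i \<in> vertex_ix \<Longrightarrow> w \<in> laguerre_cell (s i) A"
    "x \<in> frontier (convex hull ((\<lambda>i. fst (s i)) ` vertex_ix))"
    using x(1) unfolding skel_dual_iff by blast
  have "\<exists>p. (\<forall>\<^sub>F j in sequentially. p j \<in> A' j) \<and> p \<longlonglongrightarrow> s i" if "i \<in> vertex_ix" for i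
  proof -
    have "s i \<in> A" using s(2) that by blast
    from conf_conv_approx[OF assms(1) this] show ?thesis by blast
  qed
  then have "\<forall>i\<in>vertex_ix. \<exists>p. (\<forall>\<^sub>F j in sequentially. p j \<in> A' j) \<and> p \<longlonglongrightarrow> s i" by blast
  from bchoice[OF this] obtain p where p: "\<And>i. i \<in> vertex_ix \<Longrightarrow> \<forall>\<^sub>F j in sequentially. p i j \<in> A' j"
    "\<And>i. i \<in> vertex_ix \<Longrightarrow> p i \<longlonglongrightarrow> s i" by blast
  define s' where "s' j i = p i j" for i j
  have s': "(\<lambda>j. s' j i) \<longlonglongrightarrow> s i" if "i \<in> vertex_ix" for i
    using p(2)[OF that] by (simp add: s'_def)
  have mem: "\<forall>\<^sub>F j in sequentially. \<forall>i\<in>vertex_ix. s' j i \<in> A' j"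
    unfolding s'_def using p(1) by (intro eventually_ball_finite) auto
  have "\<forall>\<^sub>F j in sequentially. \<forall>i\<in>vertex_ix. \<forall>i'\<in>vertex_ix. i \<noteq> i' \<longrightarrow> s' j i \<noteq> s' j i'"
  proof (intro eventually_ball_finite ballI)
    fix i i' :: 'a assume i: "i \<in> vertex_ix" "i' \<in> vertex_ix"
    show "\<forall>\<^sub>F j in sequentially. i \<noteq> i' \<longrightarrow> s' j i \<noteq> s' j i'"
    proof (cases "i = i'")
      case False
      then have "s i - s i' \<noteq> 0" using inj_onD[OF s(1) _ i] by auto
      moreover have "(\<lambda>j. s' j i - s' j i') \<longlonglongrightarrow> s i - s i'" by (intro tendsto_diff s' i)
      ultimately have "\<forall>\<^sub>F j in sequentially. s' j i - s' j i' \<noteq> 0"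
        by (intro tendsto_imp_eventually_ne)
      then show ?thesis by eventually_elim auto
    qed simp
  qed auto
  then have inj: "\<forall>\<^sub>F j in sequentially. inj_on (s' j) vertex_ix"
    by eventually_elim (metis inj_onI)
  have gen: "\<And>u. edge_map s u = 0 \<Longrightarrow> u = 0"
    "\<And>q w. q \<in> A - s ` vertex_ix \<Longrightarrow> \<exists>i\<in>vertex_ix. power_fun w (s i) \<noteq> power_fun w q"
    using assms(3) s(1,2) unfolding generic_def by blast+
  have pow: "power_fun w (s i) = power_fun w (s i')" if "i \<in> vertex_ix" "i' \<in> vertex_ix" for i i'
    using s(2) s(3)[OF that(1)] s(3)[OF that(2)] that
    unfolding laguerre_cell_def by (intro antisym) blast+
  have "edge_map s w = power_rhs s"
    using pow unfolding equal_power_iff[symmetric] by blast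
  from perturbed_centre[OF gen(1) s' this] obtain w' where
    w': "w' \<longlonglongrightarrow> w" "\<forall>\<^sub>F j in sequentially. edge_map (s' j) (w' j) = power_rhs (s' j)" by blast
  define E where "E j \<longleftrightarrow> (\<forall>i\<in>vertex_ix. s' j i \<in> A' j) \<and> edge_map (s' j) (w' j) = power_rhs (s' j)" for j
  have E: "\<forall>\<^sub>F j in sequentially. E j"
    unfolding E_def using mem w'(2) by (rule eventually_conj)
  have cells: "\<forall>\<^sub>F j in sequentially. E j \<longrightarrow> (\<forall>i\<in>vertex_ix. w' j \<in> laguerre_cell (s' j i) (A' j))"
  proof (rule ccontr)
    assume "\<not> ?thesis"
    from subseq_of_not_eventually[OF this] obtain r :: "nat \<Rightarrow> nat" where r: "strict_mono r"
      and r': "\<And>j. \<not> (E (r j) \<longrightarrow> (\<forall>i\<in>vertex_ix. w' (r j) \<in> laguerre_cell (s' (r j) i) (A' (r j))))" by metis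
    have Er: "s' (r j) i \<in> A' (r j)" "power_fun (w' (r j)) (s' (r j) i) = power_fun (w' (r j)) (s' (r j) 0)"
      if "i \<in> vertex_ix" for i j
      using r'[of j] that equal_power_iff[of "w' (r j)" "s' (r j)"] by (auto simp: E_def)
    have "\<exists>q. q \<in> A' (r j) \<and> w' (r j) \<in> laguerre_cell q (A' (r j))" for j
      using minimiser_exists[OF assms(4)] by metis
    then obtain q where q: "\<And>j. q j \<in> A' (r j)" "\<And>j. w' (r j) \<in> laguerre_cell (q j) (A' (r j))" by metis
    \<comment> \<open>If one vertex were a minimiser, equality of powers would make all of them
      minimisers.\<close>
    have ne: "s' (r j) i \<noteq> q j" if i: "i \<in> vertex_ix" for i j
    proof
      assume "s' (r j) i = q j"
      then have "power_fun (w' (r j)) (s' (r j) i') = power_fun (w' (r j)) (q j)" if "i' \<in> vertex_ix" for i'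
        using Er(2)[OF i, of j] Er(2)[OF that, of j] by simp
      then have "\<forall>i\<in>vertex_ix. w' (r j) \<in> laguerre_cell (s' (r j) i) (A' (r j))"
        using q(2)[of j] unfolding laguerre_cell_def by simp
      then show False using r'[of j] by blast
    qed
    have c: "conf_conv (\<lambda>j. A' (r j)) A" using conf_conv_subseq[OF assms(1) r] .
    have h: "\<forall>p\<in>A' j. 0 \<le> snd p" for j using assms(4) by (simp add: admissible_def)
    obtain k q' where k: "strict_mono k" "(\<lambda>j. q (k j)) \<longlonglongrightarrow> q'" "q' \<in> A" "w \<in> laguerre_cell q' A"
      using cell_subseq[OF c admissible_nonempty[OF assms(2)] h
          LIMSEQ_subseq_LIMSEQ[OF w'(1) r, unfolded o_def] q] .
    have "s i \<noteq> q'" if i: "i \<in> vertex_ix" for i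
    proof (rule conf_conv_limits_distinct[OF conf_conv_subseq[OF c k(1)] _ _ _ k(2)])
      show "(\<lambda>j. s' (r (k j)) i) \<longlonglongrightarrow> s i"
        using LIMSEQ_subseq_LIMSEQ[OF LIMSEQ_subseq_LIMSEQ[OF s'[OF i] r] k(1)] by (simp add: o_def)
    qed (use Er(1)[OF i] q(1) ne[OF i] in auto)
    then have "q' \<in> A - s ` vertex_ix" using k(3) by blast
    moreover have "power_fun w (s i) = power_fun w q'" if i: "i \<in> vertex_ix" for i
      using s(2) s(3)[OF i] k(3,4) i unfolding laguerre_cell_def by (intro antisym) blast+
    ultimately show False using gen(2) by metis
  qed
  have "\<forall>\<^sub>F j in sequentially. frontier (convex hull ((\<lambda>i. fst (s' j i)) ` vertex_ix)) \<inter> G \<noteq> {}"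
    by (rule frontier_hull_lower[OF _ _ s(4) x(2,3)]) (auto intro: tendsto_fst s')
  with E cells inj show ?thesis
  proof eventually_elim
    case (elim j)
    then obtain y where y: "y \<in> frontier (convex hull ((\<lambda>i. fst (s' j i)) ` vertex_ix))" "y \<in> G" by blast
    have "y \<in> skel (dual_laguerre (A' j))"
      unfolding skel_dual_iff using elim y(1) by (intro exI[of _ "s' j"] exI[of _ "w' j"]) (auto simp: E_def)
    then show ?case using y(2) by blast
  qed
qed

section \<open>Continuity in the Fell topology\<close>

text \<open>Continuity relative to a class \<open>\<A>\<close> on which \<open>S\<close> behaves
  well. From some level on, the counts of \<open>A\<close> alone force the value into
  \<open>U\<close>, which turns statements about \<open>S\<close> into statements about a countable
  family of count vectors.\<close>

definition fell_cont_at ::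
    "('b::euclidean_space set \<Rightarrow> 'a::euclidean_space set) \<Rightarrow> 'b set set \<Rightarrow> 'b set \<Rightarrow> bool" where
  "fell_cont_at S \<A> A \<longleftrightarrow> (\<forall>U. openin fell_topology U \<and> S A \<in> U \<longrightarrow>
     (\<forall>\<^sub>F m in sequentially. \<forall>A'\<in>\<A>. cube_counts m A' = cube_counts m A \<longrightarrow> S A' \<in> U))"

text \<open>If the implication fails at infinitely many levels, the counterexamples form a sequence
  converging to \<open>A\<close>. For the sets missing a compact \<open>K\<close>,
  \<open>upper\<close> contradicts this after extracting a convergent sequence in \<open>K\<close>;
  for the sets hitting an open \<open>G\<close>, \<open>lower\<close> does. Finite intersections and
  unions of open sets inherit the property.\<close>

lemma fell_cont_atI:
  fixes S :: "'b::euclidean_space set \<Rightarrow> 'a::euclidean_space set"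
  assumes A: "A \<in> \<A>" and lf: "\<And>A. A \<in> \<A> \<Longrightarrow> locally_finite A" and cl: "\<And>A. A \<in> \<A> \<Longrightarrow> closed (S A)"
    and upper: "\<And>A' x l. conf_conv A' A \<Longrightarrow> (\<And>j. A' j \<in> \<A>) \<Longrightarrow> (\<And>j. x j \<in> S (A' j)) \<Longrightarrow> x \<longlonglongrightarrow> l \<Longrightarrow> l \<in> S A"
    and lower: "\<And>A' x G. conf_conv A' A \<Longrightarrow> (\<And>j. A' j \<in> \<A>) \<Longrightarrow> x \<in> S A \<Longrightarrow> open G \<Longrightarrow> x \<in> G \<Longrightarrow>
      \<forall>\<^sub>F j in sequentially. S (A' j) \<inter> G \<noteq> {}"
  shows "fell_cont_at S \<A> A"
proof -
  let ?ev = "\<lambda>U. \<forall>\<^sub>F m in sequentially. \<forall>A'\<in>\<A>. cube_counts m A' = cube_counts m A \<longrightarrow> S A' \<in> U"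
  have counterexample: thesis
    if "\<not> ?ev U"
      "\<And>A'. conf_conv A' A \<Longrightarrow> (\<And>j. A' j \<in> \<A>) \<Longrightarrow> (\<And>j. S (A' j) \<notin> U) \<Longrightarrow> thesis" for thesis U
  proof -
    from subseq_of_not_eventually[OF that(1)] obtain r :: "nat \<Rightarrow> nat" where r: "strict_mono r"
      and r': "\<And>j. \<exists>A'\<in>\<A>. cube_counts (r j) A' = cube_counts (r j) A \<and> S A' \<notin> U" by metis
    obtain A' where A': "\<And>j. A' j \<in> \<A>" "\<And>j. cube_counts (r j) (A' j) = cube_counts (r j) A" "\<And>j. S (A' j) \<notin> U"
      using r' by metis
    have "conf_conv A' A"
      unfolding conf_conv_def using A'(1,2) lf A filterlim_subseq[OF r] by blast
    then show thesis using that(2) A' by blast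
  qed
  have "S A \<in> U \<longrightarrow> ?ev U"
    if "openin fell_topology U" for U
    using that unfolding fell_topology_def openin_topology_generated_by_iff
  proof (induction rule: generate_topology_on.induct)
    case (Int a b)
    show ?case
    proof
      assume "S A \<in> a \<inter> b"
      then have "?ev a"
        "?ev b"
        using Int by blast+
      then show "?ev (a \<inter> b)"
        by eventually_elim blast
    qed
  next
    case (UN K)
    show ?case
    proof
      assume "S A \<in> \<Union>K"
      then obtain k where k: "k \<in> K" "S A \<in> k" by blast
      then have "?ev k"
        using UN by blast
      then show "?ev (\<Union>K)"
        by eventually_elim (use k(1) in blast)
    qed
  next
    case (Basis U)
    then consider K where "compact K" "U = {F. closed F \<and> F \<inter> K = {}}"
      | G where "open G" "U = {F. closed F \<and> F \<inter> G \<noteq> {}}" by blast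
    then show ?case
    proof cases
      case 1
      show ?thesis
      proof (rule impI, rule ccontr)
        assume SA: "S A \<in> U" and "\<not> ?ev U"
        from counterexample[OF this(2)] obtain A' where A': "conf_conv A' A" "\<And>j. A' j \<in> \<A>" "\<And>j. S (A' j) \<notin> U"
          by metis
        have "\<exists>x. x \<in> S (A' j) \<and> x \<in> K" for j
          using A'(3)[of j] cl[OF A'(2)[of j]] unfolding 1(2) by auto
        then obtain x where x: "\<And>j. x j \<in> S (A' j)" "\<And>j. x j \<in> K" by metis
        obtain l r where l: "l \<in> K" "strict_mono r" "(x \<circ> r) \<longlonglongrightarrow> l"
          using \<open>compact K\<close> x(2) unfolding compact_def by metis
        have "l \<in> S A"
          using upper[OF conf_conv_subseq[OF A'(1) l(2)], of "x \<circ> r"] A'(2) x(1) l(3) by simp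
        then show False using SA l(1) unfolding 1(2) by blast
      qed
    next
      case 2
      show ?thesis
      proof (rule impI, rule ccontr)
        assume SA: "S A \<in> U" and "\<not> ?ev U"
        from counterexample[OF this(2)] obtain A' where A': "conf_conv A' A" "\<And>j. A' j \<in> \<A>" "\<And>j. S (A' j) \<notin> U"
          by metis
        obtain x where x: "x \<in> S A" "x \<in> G" using SA unfolding 2(2) by blast
        have "S (A' j) \<inter> G = {}" for j
          using A'(3)[of j] cl[OF A'(2)[of j]] unfolding 2(2) by auto
        then show False using lower[OF A'(1,2) x(1) \<open>open G\<close> x(2)] by simp
      qed
    qed
  qed simp
  then show ?thesis unfolding fell_cont_at_def by blast
qed

section \<open>Closedness and continuity of the two skeletons\<close>

lemma closed_skel_laguerre:
  assumes "admissible A"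
  shows "closed (skel (laguerre_diagram A))"
proof -
  have "conf_conv (\<lambda>_. A) A" using assms by (simp add: admissible_def conf_conv_const)
  then show ?thesis
    unfolding closed_sequential_limits using skel_laguerre_upper[OF _ assms assms] by blast
qed

lemma closed_skel_dual:
  assumes "admissible A"
  shows "closed (skel (dual_laguerre A))"
proof -
  have "conf_conv (\<lambda>_. A) A" using assms by (simp add: admissible_def conf_conv_const)
  then show ?thesis
    unfolding closed_sequential_limits using skel_dual_upper[OF _ assms assms] by blast
qed

lemma fell_cont_skel_laguerre:
  assumes "admissible A"
  shows "fell_cont_at (\<lambda>A. skel (laguerre_diagram A)) {A. admissible A} A"
proof (rule fell_cont_atI)
  show "\<forall>\<^sub>F j in sequentially. skel (laguerre_diagram (A' j)) \<inter> G \<noteq> {}"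
    if "conf_conv A' A" "\<And>j. A' j \<in> {A. admissible A}" "x \<in> skel (laguerre_diagram A)" "open G" "x \<in> G" for A' x G
    using skel_laguerre_lower[OF that(1) assms _ that(3-5)] that(2) by simp
  show "l \<in> skel (laguerre_diagram A)"
    if "conf_conv A' A" "\<And>j. A' j \<in> {A. admissible A}" "\<And>j. x j \<in> skel (laguerre_diagram (A' j))" "x \<longlonglongrightarrow> l" for A' x l
    using skel_laguerre_upper[OF that(1) assms _ that(3,4)] that(2) by simp
qed (use assms in \<open>auto simp: closed_skel_laguerre admissible_def\<close>)

lemma fell_cont_skel_dual:
  assumes "admissible A" "generic A"
  shows "fell_cont_at (\<lambda>A. skel (dual_laguerre A)) {A. admissible A} A"
proof (rule fell_cont_atI)
  show "\<forall>\<^sub>F j in sequentially. skel (dual_laguerre (A' j)) \<inter> G \<noteq> {}"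
    if "conf_conv A' A" "\<And>j. A' j \<in> {A. admissible A}" "x \<in> skel (dual_laguerre A)" "open G" "x \<in> G" for A' x G
    using skel_dual_lower[OF that(1) assms _ that(3-5)] that(2) by simp
  show "l \<in> skel (dual_laguerre A)"
    if "conf_conv A' A" "\<And>j. A' j \<in> {A. admissible A}" "\<And>j. x j \<in> skel (dual_laguerre (A' j))" "x \<longlonglongrightarrow> l" for A' x l
    using skel_dual_upper[OF that(1) assms(1) _ that(3,4)] that(2) by simp
qed (use assms in \<open>auto simp: closed_skel_dual admissible_def\<close>)

section \<open>Random closed sets as functions of point processes\<close>

lemma space_fell_borel: "space fell_borel = {F. closed F}"
  by (simp add: fell_borel_def space_measure_of_conv)

lemma openin_fell_closed: "openin fell_topology U \<Longrightarrow> U \<subseteq> {F. closed F}"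
  using openin_subset[of fell_topology U] by (simp add: topspace_fell_topology)

lemma openin_fell_sets: "openin fell_topology U \<Longrightarrow> U \<in> sets fell_borel"
  using openin_fell_closed unfolding fell_borel_def by (subst sets_measure_of) auto

lemma measurable_fell_borelI:
  fixes Z :: "'w \<Rightarrow> 'a::euclidean_space set"
  assumes "\<And>\<omega>. \<omega> \<in> space M \<Longrightarrow> closed (Z \<omega>)"
    and "\<And>U. openin fell_topology U \<Longrightarrow> {\<omega> \<in> space M. Z \<omega> \<in> U} \<in> sets M"
  shows "Z \<in> measurable M fell_borel"
  unfolding fell_borel_def
proof (rule measurable_measure_of)
  fix U :: "'a set set" assume "U \<in> {U. openin fell_topology U}"
  then have "{\<omega> \<in> space M. Z \<omega> \<in> U} \<in> sets M" using assms(2) by simp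
  then show "Z -` U \<inter> space M \<in> sets M" by (simp add: vimage_def Int_def conj_commute)
qed (use openin_fell_closed assms(1) in auto)

lemma continuous_map_fell_measurable:
  assumes "continuous_map fell_topology euclideanreal g"
  shows "g \<in> borel_measurable fell_borel"
proof (rule borel_measurableI)
  fix S :: "real set" assume "open S"
  then have "openin fell_topology {F \<in> topspace fell_topology. g F \<in> S}"
    using openin_continuous_map_preimage[OF assms] by (simp add: open_openin[symmetric])
  then have "{F \<in> topspace fell_topology. g F \<in> S} \<in> sets fell_borel" by (rule openin_fell_sets)
  also have "{F \<in> topspace fell_topology. g F \<in> S} = g -` S \<inter> space fell_borel"
    by (auto simp: topspace_fell_topology space_fell_borel)
  finally show "g -` S \<inter> space fell_borel \<in> sets fell_borel" .
qed

definition count_vectors :: "nat \<Rightarrow> ('b::euclidean_space \<Rightarrow> nat) set" where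
  "count_vectors m = {k. \<forall>z. z \<notin> grid_window m (real m) \<longrightarrow> k z = 0}"

lemma cube_counts_in: "cube_counts m A \<in> count_vectors m"
  by (simp add: count_vectors_def cube_counts_def)

lemma countable_count_vectors: "countable (count_vectors m :: ('b::euclidean_space \<Rightarrow> nat) set)"
proof -
  let ?W = "grid_window m (real m) :: 'b set"
  have "count_vectors m \<subseteq> (\<lambda>k z. if z \<in> ?W then k z else 0) ` (?W \<rightarrow>\<^sub>E UNIV)"
  proof
    fix k :: "'b \<Rightarrow> nat" assume k: "k \<in> count_vectors m"
    show "k \<in> (\<lambda>k z. if z \<in> ?W then k z else 0) ` (?W \<rightarrow>\<^sub>E UNIV)"
    proof (rule image_eqI)
      show "k = (\<lambda>z. if z \<in> ?W then restrict k ?W z else 0)"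
        by (rule ext) (use k in \<open>auto simp: count_vectors_def\<close>)
    qed (auto simp: PiE_def extensional_def)
  qed
  moreover have "countable (?W \<rightarrow>\<^sub>E (UNIV :: nat set))"
    by (intro countable_PiE finite_grid_window) auto
  ultimately show ?thesis by (meson countable_image countable_subset)
qed

lemma num_points_cube:
  assumes "locally_finite A"
  shows "num_points A (cube m z) = of_nat (card (A \<inter> cube m z))"
  using locally_finite_bounded[OF assms bounded_cube]
  by (simp add: num_points_def emeasure_count_space)

lemma cube_counts_eq_iff:
  assumes "locally_finite A" "k \<in> count_vectors m"
  shows "cube_counts m A = k \<longleftrightarrow> (\<forall>z\<in>grid_window m (real m). num_points A (cube m z) = of_nat (k z))"
proof
  assume "cube_counts m A = k"
  then show "\<forall>z\<in>grid_window m (real m). num_points A (cube m z) = of_nat (k z)"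
    by (auto simp: num_points_cube[OF assms(1)] cube_counts_def)
next
  assume R: "\<forall>z\<in>grid_window m (real m). num_points A (cube m z) = of_nat (k z)"
  show "cube_counts m A = k"
  proof
    fix z show "cube_counts m A z = k z"
      using R assms(2) by (auto simp: num_points_cube[OF assms(1)] cube_counts_def count_vectors_def)
  qed
qed

lemma point_process_locally_finite:
  "point_process M X \<Longrightarrow> \<omega> \<in> space M \<Longrightarrow> locally_finite (X \<omega>)"
  by (simp add: point_process_def locally_finite_def)

lemma measurable_num_points:
  "point_process M X \<Longrightarrow> B \<in> sets borel \<Longrightarrow> (\<lambda>\<omega>. num_points (X \<omega>) B) \<in> borel_measurable M"
  by (simp add: point_process_def)

lemma num_points_event:
  assumes "point_process M X" "B \<in> sets borel"
  shows "{\<omega> \<in> space M. num_points (X \<omega>) B = c} \<in> sets M"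
  using measurable_sets[OF measurable_num_points[OF assms], of "{c}"]
  by (simp add: vimage_def Int_def conj_commute)

abbreviation count_event :: "'w measure \<Rightarrow> ('w \<Rightarrow> 'b::euclidean_space set) \<Rightarrow> nat \<Rightarrow> ('b \<Rightarrow> nat) \<Rightarrow> 'w set" where
  "count_event M X m k \<equiv> {\<omega> \<in> space M. cube_counts m (X \<omega>) = k}"

lemma cube_counts_event:
  assumes "point_process M X"
  shows "count_event M X m k \<in> sets M"
proof (cases "k \<in> count_vectors m")
  case True
  have "count_event M X m k =
      {\<omega> \<in> space M. \<forall>z\<in>grid_window m (real m). num_points (X \<omega>) (cube m z) = of_nat (k z)}"
    using cube_counts_eq_iff[OF point_process_locally_finite[OF assms] True] by auto
  also have "\<dots> \<in> sets M"
    by (intro sets.sets_Collect_finite_All finite_grid_window num_points_event[OF assms] cube_borel)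
  finally show ?thesis .
next
  case False
  then have "count_event M X m k = {}"
    using cube_counts_in by blast
  then show ?thesis by (simp only: sets.empty_sets)
qed

lemma cube_counts_measurable:
  assumes "point_process M X"
  shows "(\<lambda>\<omega>. cube_counts m (X \<omega>)) \<in> measurable M (count_space (count_vectors m))"
proof (rule measurable_count_space_eq_countable[THEN iffD2], safe)
  show "cube_counts m (X \<omega>) \<in> count_vectors m" for \<omega> by (rule cube_counts_in)
  fix k show "(\<lambda>\<omega>. cube_counts m (X \<omega>)) -` {k} \<inter> space M \<in> sets M"
    using cube_counts_event[OF assms, of m k] by (simp add: vimage_def Int_def conj_commute)
qed (rule countable_count_vectors)

text \<open>Continuity writes \<open>{S (X \<omega>) \<in> U}\<close> as a countable union of events on the cube counts.\<close>

lemma random_closed_set_of_fell_cont: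
  fixes S :: "'b::euclidean_space set \<Rightarrow> 'a::euclidean_space set"
  assumes X: "point_process M X" and cl: "\<And>A. A \<in> \<A> \<Longrightarrow> closed (S A)"
    and ae: "AE \<omega> in M. X \<omega> \<in> \<A> \<and> fell_cont_at S \<A> (X \<omega>)"
  obtains Z where "Z \<in> measurable M fell_borel" "AE \<omega> in M. S (X \<omega>) = Z \<omega>"
proof -
  from ae obtain N where N: "N \<in> null_sets M"
    "\<And>\<omega>. \<omega> \<in> space M - N \<Longrightarrow> X \<omega> \<in> \<A> \<and> fell_cont_at S \<A> (X \<omega>)"
    by (auto simp: eventually_ae_filter)
  \<comment> \<open>The value on the exceptional null set only has to be closed; the empty set
    serves.\<close>
  define Z where "Z \<omega> = (if \<omega> \<in> N then {} else S (X \<omega>))" for \<omega>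
  have "Z \<in> measurable M fell_borel"
  proof (rule measurable_fell_borelI)
    show "closed (Z \<omega>)" if "\<omega> \<in> space M" for \<omega>
      using that N(2)[of \<omega>] cl by (auto simp: Z_def)
    fix U assume U: "openin fell_topology (U :: 'a set set)"
    \<comment> \<open>Counts that already force the value into \<open>U\<close>; continuity says
      that almost every configuration shows such counts at some level.\<close>
    define good where "good m k \<longleftrightarrow> (\<forall>A'\<in>\<A>. cube_counts m A' = k \<longrightarrow> S A' \<in> U)" for m k
    have "{\<omega> \<in> space M. Z \<omega> \<in> U} = (if {} \<in> U then N else {}) \<union>
        ((\<Union>m. (\<Union>k\<in>{k\<in>count_vectors m. good m k}. count_event M X m k)) - N)"
      (is "?L = ?R")
    proof (intro set_eqI iffI)
      fix \<omega> assume \<omega>: "\<omega> \<in> ?L"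
      show "\<omega> \<in> ?R"
      proof (cases "\<omega> \<in> N")
        case False
        then have "S (X \<omega>) \<in> U" "fell_cont_at S \<A> (X \<omega>)" using \<omega> N(2)[of \<omega>] by (auto simp: Z_def)
        then have "\<forall>\<^sub>F m in sequentially. \<forall>A'\<in>\<A>. cube_counts m A' = cube_counts m (X \<omega>) \<longrightarrow> S A' \<in> U"
          using U unfolding fell_cont_at_def by blast
        then obtain m where "good m (cube_counts m (X \<omega>))"
          unfolding good_def eventually_sequentially by blast
        then show ?thesis using False \<omega> cube_counts_in by fastforce
      qed (use \<omega> in \<open>auto simp: Z_def\<close>)
    next
      fix \<omega> assume \<omega>: "\<omega> \<in> ?R"
      show "\<omega> \<in> ?L"
      proof (cases "\<omega> \<in> N")
        case True
        then show ?thesis using \<omega> sets.sets_into_space[OF null_setsD2[OF N(1)]] by (auto simp: Z_def split: if_splits)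
      next
        case False
        then obtain m where "\<omega> \<in> space M" "good m (cube_counts m (X \<omega>))"
          using \<omega> by (auto split: if_splits)
        then show ?thesis using False N(2)[of \<omega>] by (auto simp: Z_def good_def)
      qed
    qed
    also have "\<dots> \<in> sets M"
    proof -
      have "(\<Union>k\<in>{k\<in>count_vectors m. good m k}. count_event M X m k) \<in> sets M" for m
        by (intro sets.countable_UN'' cube_counts_event[OF X] countable_subset[OF _ countable_count_vectors]) auto
      then show ?thesis using null_setsD2[OF N(1)] by auto
    qed
    finally show "{\<omega> \<in> space M. Z \<omega> \<in> U} \<in> sets M" .
  qed
  moreover have "AE \<omega> in M. S (X \<omega>) = Z \<omega>"
    using AE_not_in[OF N(1)] by eventually_elim (simp add: Z_def)
  ultimately show ?thesis using that by blast
qed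

section \<open>Weak convergence from the laws of the cube counts\<close>

lemma count_sum_nn_integral:
  fixes X :: "'w \<Rightarrow> 'b::euclidean_space set"
  assumes X: "point_process M X"
  shows "(\<integral>\<^sup>+\<omega>. c (cube_counts m (X \<omega>)) \<partial>M) =
    (\<integral>\<^sup>+k. c k * emeasure M (count_event M X m k) \<partial>count_space (count_vectors m))"
proof -
  interpret prob_space M using X by (simp add: point_process_def)
  have "(\<integral>\<^sup>+\<omega>. c (cube_counts m (X \<omega>)) \<partial>M) =
      (\<integral>\<^sup>+\<omega>. (\<integral>\<^sup>+k. c k * indicator (count_event M X m k) \<omega> \<partial>count_space (count_vectors m)) \<partial>M)"
  proof (rule nn_integral_cong)
    fix \<omega> assume \<omega>: "\<omega> \<in> space M"
    have "(\<integral>\<^sup>+k. c k * indicator (count_event M X m k) \<omega> \<partial>count_space (count_vectors m))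
        = (\<integral>\<^sup>+k. c k * indicator {cube_counts m (X \<omega>)} k \<partial>count_space (count_vectors m))"
      using \<omega> by (intro nn_integral_cong) (auto simp: indicator_def)
    also have "\<dots> = c (cube_counts m (X \<omega>))"
      using cube_counts_in[of m "X \<omega>"] by (subst nn_integral_indicator_singleton) (auto simp: emeasure_count_space)
    finally show "c (cube_counts m (X \<omega>)) =
      (\<integral>\<^sup>+k. c k * indicator (count_event M X m k) \<omega> \<partial>count_space (count_vectors m))" ..
  qed
  also have "\<dots> = (\<integral>\<^sup>+k. (\<integral>\<^sup>+\<omega>. c k * indicator (count_event M X m k) \<omega> \<partial>M) \<partial>count_space (count_vectors m))"
  proof (rule nn_integral_count_space_nn_integral[OF countable_count_vectors])
    fix k :: "'b \<Rightarrow> nat"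
    note [measurable] = cube_counts_event[OF X, of m k]
    show "(\<lambda>\<omega>. c k * indicator (count_event M X m k) \<omega>) \<in> borel_measurable M"
      by measurable
  qed
  also have "\<dots> = (\<integral>\<^sup>+k. c k * emeasure M (count_event M X m k) \<partial>count_space (count_vectors m))"
    using cube_counts_event[OF X] by (intro nn_integral_cong) (simp add: nn_integral_cmult_indicator)
  finally show ?thesis .
qed

text \<open>Fatou's lemma is applied twice: to the cube counts at a fixed level as \<open>n \<rightarrow> \<infinity>\<close>, where the
  probabilities of all values converge, and to the lower bounds \<open>\<psi> m\<close> as the level grows.\<close>

lemma nn_integral_le_liminf_of_fell_cont:
  fixes S :: "'b::euclidean_space set \<Rightarrow> 'a::euclidean_space set"
  assumes X: "\<And>n. point_process (M n) (X n)" and Y: "point_process N Y"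
    and aeX: "\<And>n. AE \<omega> in M n. X n \<omega> \<in> \<A>"
    and aeY: "AE \<omega> in N. fell_cont_at S \<A> (Y \<omega>)" and clY: "AE \<omega> in N. closed (S (Y \<omega>))"
    and conv: "\<And>m k. (\<lambda>n. measure (M n) (count_event (M n) (X n) m k))
        \<longlonglongrightarrow> measure N (count_event N Y m k)"
    and g: "continuous_map fell_topology euclideanreal g" "\<And>F. closed F \<Longrightarrow> g F \<le> C"
  shows "(\<integral>\<^sup>+\<omega>. ennreal (g (S (Y \<omega>))) \<partial>N) \<le> liminf (\<lambda>n. \<integral>\<^sup>+\<omega>. ennreal (g (S (X n \<omega>))) \<partial>M n)"
proof -
  \<comment> \<open>The best lower bound for \<open>g\<close> of the skeleton that the counts
    \<open>k\<close> alone give. The cap \<open>C\<close> keeps it finite when no configuration of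
    the class has counts \<open>k\<close>, where the infimum is infinite; finiteness is needed to
    multiply limits in \<open>ennreal\<close>.\<close>
  define \<psi> where "\<psi> m k = min (ennreal C) (INF A\<in>{A\<in>\<A>. cube_counts m A = k}. ennreal (g (S A)))" for m k
  have lower: "AE \<omega> in N. ennreal (g (S (Y \<omega>))) \<le> liminf (\<lambda>m. \<psi> m (cube_counts m (Y \<omega>)))"
    using aeY clY
  proof eventually_elim
    case (elim \<omega>)
    show ?case unfolding le_Liminf_iff
    proof (intro allI impI)
      fix y assume y: "y < ennreal (g (S (Y \<omega>)))"
      then obtain y' where y': "y < y'" "y' < ennreal (g (S (Y \<omega>)))" using dense by blast
      define r where "r = enn2real y'"
      have "y' < top" using y'(2) by (rule order.strict_trans) simp
      then have y'r: "y' = ennreal r" by (simp add: r_def)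
      have r: "r < g (S (Y \<omega>))"
        using y'(2) unfolding y'r by (metis ennreal_leI not_less)
      have "openin fell_topology {F \<in> topspace fell_topology. g F \<in> {r<..}}"
        using openin_continuous_map_preimage[OF g(1), of "{r<..}"] by (simp add: open_openin[symmetric])
      moreover have "S (Y \<omega>) \<in> {F \<in> topspace fell_topology. g F \<in> {r<..}}"
        using elim(2) r by (simp add: topspace_fell_topology)
      ultimately have "\<forall>\<^sub>F m in sequentially. \<forall>A\<in>\<A>. cube_counts m A = cube_counts m (Y \<omega>) \<longrightarrow>
          S A \<in> {F \<in> topspace fell_topology. g F \<in> {r<..}}"
        using elim(1) unfolding fell_cont_at_def by blast
      then show "\<forall>\<^sub>F m in sequentially. y < \<psi> m (cube_counts m (Y \<omega>))"
      proof eventually_elim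
        case (elim m)
        have "y' \<le> (INF A\<in>{A\<in>\<A>. cube_counts m A = cube_counts m (Y \<omega>)}. ennreal (g (S A)))"
          unfolding y'r using elim by (intro INF_greatest) (simp add: ennreal_leI less_imp_le)
        moreover have "ennreal (g (S (Y \<omega>))) \<le> ennreal C"
          using g(2) \<open>closed (S (Y \<omega>))\<close> by (intro ennreal_leI)
        ultimately show ?case
          using y' unfolding \<psi>_def min_less_iff_conj
          by (meson less_le_trans order.strict_trans)
      qed
    qed
  qed
  have fatou_n: "(\<integral>\<^sup>+\<omega>. \<psi> m (cube_counts m (Y \<omega>)) \<partial>N) \<le> liminf (\<lambda>n. \<integral>\<^sup>+\<omega>. ennreal (g (S (X n \<omega>))) \<partial>M n)" for m
  proof -
    have fin: "\<psi> m k < top" for k by (simp add: \<psi>_def min_less_iff_disj)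
    have tend: "(\<lambda>n. \<psi> m k * emeasure (M n) (count_event (M n) (X n) m k))
        \<longlonglongrightarrow> \<psi> m k * emeasure N (count_event N Y m k)" for k
    proof -
      have eq: "emeasure (M n) B = ennreal (measure (M n) B)" "emeasure N B' = ennreal (measure N B')" for n B B'
        using X[of n] Y by (auto simp: point_process_def prob_space_def finite_measure.emeasure_eq_measure)
      show ?thesis unfolding eq using fin conv
        by (intro ennreal_tendsto_cmult tendsto_ennrealI)
    qed
    have "(\<integral>\<^sup>+\<omega>. \<psi> m (cube_counts m (Y \<omega>)) \<partial>N)
        = (\<integral>\<^sup>+k. \<psi> m k * emeasure N (count_event N Y m k) \<partial>count_space (count_vectors m))"
      by (rule count_sum_nn_integral[OF Y])
    also have "\<dots> = (\<integral>\<^sup>+k. liminf (\<lambda>n. \<psi> m k * emeasure (M n) (count_event (M n) (X n) m k))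
        \<partial>count_space (count_vectors m))"
      using lim_imp_Liminf[OF sequentially_bot tend] by simp
    also have "\<dots> \<le> liminf (\<lambda>n. \<integral>\<^sup>+k. \<psi> m k * emeasure (M n) (count_event (M n) (X n) m k)
        \<partial>count_space (count_vectors m))"
      by (intro nn_integral_liminf) simp
    also have "\<dots> = liminf (\<lambda>n. \<integral>\<^sup>+\<omega>. \<psi> m (cube_counts m (X n \<omega>)) \<partial>M n)"
      unfolding count_sum_nn_integral[OF X] ..
    also have "\<dots> \<le> liminf (\<lambda>n. \<integral>\<^sup>+\<omega>. ennreal (g (S (X n \<omega>))) \<partial>M n)"
    proof (rule Liminf_mono, rule always_eventually, rule allI, rule nn_integral_mono_AE)
      fix n show "AE \<omega> in M n. \<psi> m (cube_counts m (X n \<omega>)) \<le> ennreal (g (S (X n \<omega>)))"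
        using aeX[of n]
      proof eventually_elim
        case (elim \<omega>)
        then show ?case unfolding \<psi>_def by (intro min.coboundedI2 INF_lower) simp
      qed
    qed
    finally show ?thesis .
  qed
  have "(\<integral>\<^sup>+\<omega>. ennreal (g (S (Y \<omega>))) \<partial>N) \<le> (\<integral>\<^sup>+\<omega>. liminf (\<lambda>m. \<psi> m (cube_counts m (Y \<omega>))) \<partial>N)"
    by (rule nn_integral_mono_AE[OF lower])
  also have "\<dots> \<le> liminf (\<lambda>m. \<integral>\<^sup>+\<omega>. \<psi> m (cube_counts m (Y \<omega>)) \<partial>N)"
    by (intro nn_integral_liminf measurable_compose[OF cube_counts_measurable[OF Y]]) simp
  also have "\<dots> \<le> liminf (\<lambda>n. \<integral>\<^sup>+\<omega>. ennreal (g (S (X n \<omega>))) \<partial>M n)"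
    using Liminf_mono[OF always_eventually[OF allI[OF fatou_n]], of sequentially] by (simp add: Liminf_const)
  finally show ?thesis .
qed

text \<open>The lower semicontinuity bound is applied to \<open>g\<close> and to \<open>- g\<close>,
  each shifted by a constant to become positive; together the two bounds give convergence of the
  integrals.\<close>

lemma weak_conv_of_fell_cont:
  fixes S :: "'b::euclidean_space set \<Rightarrow> 'a::euclidean_space set"
  assumes X: "\<And>n. point_process (M n) (X n)" and Y: "point_process N Y"
    and aeX: "\<And>n. AE \<omega> in M n. X n \<omega> \<in> \<A> \<and> fell_cont_at S \<A> (X n \<omega>)"
    and aeY: "AE \<omega> in N. Y \<omega> \<in> \<A> \<and> fell_cont_at S \<A> (Y \<omega>)"
    and cl: "\<And>A. A \<in> \<A> \<Longrightarrow> closed (S A)"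
    and conv: "\<And>m k. (\<lambda>n. measure (M n) (count_event (M n) (X n) m k))
        \<longlonglongrightarrow> measure N (count_event N Y m k)"
  shows "weak_conv_closed_sets M (\<lambda>n \<omega>. S (X n \<omega>)) N (\<lambda>\<omega>. S (Y \<omega>))"
proof -
  have "\<exists>Z. Z \<in> measurable (M n) fell_borel \<and> (AE \<omega> in M n. S (X n \<omega>) = Z \<omega>)" for n
    using random_closed_set_of_fell_cont[OF X cl aeX] by metis
  then obtain Z where Z: "\<And>n. Z n \<in> measurable (M n) fell_borel" "\<And>n. AE \<omega> in M n. S (X n \<omega>) = Z n \<omega>"
    by metis
  obtain W where W: "W \<in> measurable N fell_borel" "AE \<omega> in N. S (Y \<omega>) = W \<omega>"
    using random_closed_set_of_fell_cont[OF Y cl aeY] by metis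
  have aeX': "AE \<omega> in M n. X n \<omega> \<in> \<A>" for n using aeX[of n] by eventually_elim simp
  have aeY': "AE \<omega> in N. fell_cont_at S \<A> (Y \<omega>)" using aeY by eventually_elim simp
  have clY: "AE \<omega> in N. closed (S (Y \<omega>))" using aeY by eventually_elim (simp add: cl)
  have "weak_conv_in fell_topology (\<lambda>n. distr (M n) fell_borel (Z n)) (distr N fell_borel W)"
    unfolding weak_conv_in_def
  proof (intro allI impI, elim conjE)
    fix g :: "'a set \<Rightarrow> real"
    assume g: "continuous_map fell_topology euclideanreal g" "bounded (g ` topspace fell_topology)"
    then obtain C where C: "\<And>F. closed F \<Longrightarrow> \<bar>g F\<bar> \<le> C"
      by (auto simp: bounded_iff topspace_fell_topology)
    have gm: "g \<in> borel_measurable fell_borel" by (rule continuous_map_fell_measurable[OF g(1)])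
    \<comment> \<open>The factor \<open>c\<close> is 1 or -1. Since \<open>c * g\<close> is at least
      \<open>- C\<close> on closed sets, the shift by \<open>C + 1\<close> ensures that passing to
      \<open>ennreal\<close> loses nothing.\<close>
    have shifted: "(\<integral>\<^sup>+\<omega>. ennreal (h (S (V \<omega>))) \<partial>P) = ennreal (c * (\<integral>F. g F \<partial>distr P fell_borel Q) + (C + 1))"
      if P: "prob_space P" and Q: "Q \<in> measurable P fell_borel" "AE \<omega> in P. S (V \<omega>) = Q \<omega>"
        and h: "h = (\<lambda>F. c * g F + (C + 1))" "\<bar>c\<bar> = 1" for P :: "'p measure" and V Q h c
    proof -
      interpret prob_space P by fact
      have closedQ: "closed (Q \<omega>)" if "\<omega> \<in> space P" for \<omega>
        using measurable_space[OF Q(1) that] by (simp add: space_fell_borel)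
      have gQ: "(\<lambda>\<omega>. g (Q \<omega>)) \<in> borel_measurable P" by (rule measurable_compose[OF Q(1) gm])
      have int: "integrable P (\<lambda>\<omega>. g (Q \<omega>))"
        by (rule integrable_const_bound[where B = C]) (use C closedQ gQ in auto)
      have "(\<integral>\<^sup>+\<omega>. ennreal (h (S (V \<omega>))) \<partial>P) = (\<integral>\<^sup>+\<omega>. ennreal (c * g (Q \<omega>) + (C + 1)) \<partial>P)"
        using Q(2) unfolding h(1) by (intro nn_integral_cong_AE) (auto elim: eventually_mono)
      also have "\<dots> = ennreal (\<integral>\<omega>. c * g (Q \<omega>) + (C + 1) \<partial>P)"
      proof (rule nn_integral_eq_integral)
        show "integrable P (\<lambda>\<omega>. c * g (Q \<omega>) + (C + 1))" using int by auto
        show "AE \<omega> in P. 0 \<le> c * g (Q \<omega>) + (C + 1)"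
        proof (rule AE_I2)
          fix \<omega> assume "\<omega> \<in> space P"
          then have "\<bar>c * g (Q \<omega>)\<bar> \<le> C" using C closedQ h(2) by (simp add: abs_mult)
          then show "0 \<le> c * g (Q \<omega>) + (C + 1)" by linarith
        qed
      qed
      also have "(\<integral>\<omega>. c * g (Q \<omega>) + (C + 1) \<partial>P) = c * (\<integral>\<omega>. g (Q \<omega>) \<partial>P) + (C + 1)"
        using int by (simp add: prob_space)
      also have "(\<integral>\<omega>. g (Q \<omega>) \<partial>P) = (\<integral>F. g F \<partial>distr P fell_borel Q)"
        using integral_distr[OF Q(1) gm] by simp
      finally show ?thesis .
    qed
    have pM: "prob_space (M n)" and pN: "prob_space N" for n
      using X Y by (auto simp: point_process_def)
    define a where "a n = (\<integral>F. g F \<partial>distr (M n) fell_borel (Z n))" for n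
    define b where "b = (\<integral>F. g F \<partial>distr N fell_borel W)"
    have bound: "\<bar>b\<bar> \<le> C"
    proof -
      interpret prob_space N by (rule pN)
      have gW: "\<bar>g (W \<omega>)\<bar> \<le> C" if "\<omega> \<in> space N" for \<omega>
        using C measurable_space[OF W(1) that] by (simp add: space_fell_borel)
      have m: "(\<lambda>\<omega>. g (W \<omega>)) \<in> borel_measurable N" by (rule measurable_compose[OF W(1) gm])
      have "integrable N (\<lambda>\<omega>. g (W \<omega>))"
        by (rule integrable_const_bound[where B = C]) (use gW m in auto)
      then have "(\<integral>\<omega>. \<bar>g (W \<omega>)\<bar> \<partial>N) \<le> C"
        by (intro integral_le_const integrable_abs AE_I2 gW)
      then have "\<bar>\<integral>\<omega>. g (W \<omega>) \<partial>N\<bar> \<le> C"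
        using integral_abs_bound[of N "\<lambda>\<omega>. g (W \<omega>)"] by linarith
      then show ?thesis unfolding b_def using integral_distr[OF W(1) gm] by simp
    qed
    have one_sided: "\<forall>\<^sub>F n in sequentially. c * b - e < c * a n" if c: "\<bar>c\<bar> = 1" and e: "0 < e" for c e
    proof -
      define h where "h F = c * g F + (C + 1)" for F
      have hfun: "h = (\<lambda>F. c * g F + (C + 1))" by (simp add: h_def fun_eq_iff)
      have hc: "continuous_map fell_topology euclideanreal h"
        unfolding hfun by (intro continuous_intros g(1))
      have hb: "h F \<le> 2 * C + 1" if "closed F" for F
      proof -
        have "\<bar>c * g F\<bar> \<le> C" using C[OF that] c by (simp add: abs_mult)
        then show ?thesis unfolding h_def by linarith
      qed
      from nn_integral_le_liminf_of_fell_cont[OF X Y aeX' aeY' clY conv hc hb]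
      have "ennreal (c * b + (C + 1)) \<le> liminf (\<lambda>n. ennreal (c * a n + (C + 1)))"
        unfolding shifted[OF pN W hfun c] shifted[OF pM Z hfun c] a_def b_def .
      \<comment> \<open>The extra 1 in the shift makes the right-hand side strictly positive, so the
        strict inequality survives in \<open>ennreal\<close> even if the left-hand side is truncated
        at 0.\<close>
      moreover have "\<bar>c * b\<bar> \<le> C" using bound c by (simp add: abs_mult)
      then have "ennreal (c * b - e + (C + 1)) < ennreal (c * b + (C + 1))"
        using e by (intro ennreal_lessI) auto
      ultimately have "\<forall>\<^sub>F n in sequentially. ennreal (c * b - e + (C + 1)) < ennreal (c * a n + (C + 1))"
        unfolding le_Liminf_iff by blast
      then show ?thesis
      proof eventually_elim
        case (elim n)
        then have "c * b - e + (C + 1) < c * a n + (C + 1)" by (metis ennreal_leI not_less)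
        then show ?case by simp
      qed
    qed
    have "a \<longlonglongrightarrow> b"
    proof (rule tendstoI)
      fix e :: real assume "0 < e"
      from one_sided[OF _ this, of 1] one_sided[OF _ this, of "-1"]
      have "\<forall>\<^sub>F n in sequentially. b - e < a n" "\<forall>\<^sub>F n in sequentially. - b - e < - a n" by simp_all
      then show "\<forall>\<^sub>F n in sequentially. dist (a n) b < e"
        by eventually_elim (simp add: dist_real_def abs_less_iff)
    qed
    then show "(\<lambda>n. \<integral>F. g F \<partial>distr (M n) fell_borel (Z n)) \<longlonglongrightarrow> (\<integral>F. g F \<partial>distr N fell_borel W)"
      unfolding a_def b_def .
  qed
  moreover have "closed_set_law (M n) (\<lambda>\<omega>. S (X n \<omega>)) (distr (M n) fell_borel (Z n))" for n
    unfolding closed_set_law_def using Z by blast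
  moreover have "closed_set_law N (\<lambda>\<omega>. S (Y \<omega>)) (distr N fell_borel W)"
    unfolding closed_set_law_def using W by blast
  ultimately show ?thesis
    unfolding weak_conv_closed_sets_def by (intro exI conjI allI)
qed

section \<open>Poisson processes hit null configurations with probability zero\<close>

text \<open>Unlike in \<open>poisson_process\<close>, independence is stated for indexed families, so that it passes
  to the preimages of disjoint sets, several of which may be empty.\<close>

definition poisson_law :: "'w measure \<Rightarrow> 'b::euclidean_space measure \<Rightarrow> ('w \<Rightarrow> 'b set) \<Rightarrow> bool" where
  "poisson_law M \<Lambda> X \<longleftrightarrow> point_process M X \<and> sets \<Lambda> = sets borel \<and>
     (\<forall>B\<in>sets borel. emeasure \<Lambda> B < \<infinity> \<longrightarrow> (\<forall>k::nat.
        measure M {\<omega> \<in> space M. num_points (X \<omega>) B = of_nat k} = measure \<Lambda> B ^ k / fact k * exp (- measure \<Lambda> B))) \<and>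
     (\<forall>B\<in>sets borel. emeasure \<Lambda> B = \<infinity> \<longrightarrow> (AE \<omega> in M. num_points (X \<omega>) B = \<infinity>)) \<and>
     (\<forall>(J::'b set) B E. finite J \<and> (\<forall>j\<in>J. B j \<in> sets borel \<and> E j \<in> sets borel) \<and> disjoint_family_on B J \<longrightarrow>
        measure M {\<omega> \<in> space M. \<forall>j\<in>J. num_points (X \<omega>) (B j) \<in> E j} =
        (\<Prod>j\<in>J. measure M {\<omega> \<in> space M. num_points (X \<omega>) (B j) \<in> E j}))"

lemma poisson_lawD:
  assumes "poisson_law M \<Lambda> X"
  shows "point_process M X" "sets \<Lambda> = sets borel" "prob_space M"
    and "\<And>B k. B \<in> sets borel \<Longrightarrow> emeasure \<Lambda> B < \<infinity> \<Longrightarrow>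
      measure M {\<omega> \<in> space M. num_points (X \<omega>) B = of_nat k} = measure \<Lambda> B ^ k / fact k * exp (- measure \<Lambda> B)"
    and "\<And>B. B \<in> sets borel \<Longrightarrow> emeasure \<Lambda> B = \<infinity> \<Longrightarrow> AE \<omega> in M. num_points (X \<omega>) B = \<infinity>"
  using assms unfolding poisson_law_def point_process_def by simp_all

lemma poisson_law_indep:
  fixes X :: "'w \<Rightarrow> 'b::euclidean_space set" and J :: "'b set"
  assumes "poisson_law M \<Lambda> X" "finite J" "\<And>j. j \<in> J \<Longrightarrow> B j \<in> sets borel" "\<And>j. j \<in> J \<Longrightarrow> E j \<in> sets borel"
    "disjoint_family_on B J"
  shows "measure M {\<omega> \<in> space M. \<forall>j\<in>J. num_points (X \<omega>) (B j) \<in> E j} =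
        (\<Prod>j\<in>J. measure M {\<omega> \<in> space M. num_points (X \<omega>) (B j) \<in> E j})"
proof -
  have "\<forall>(J::'b set) B E. finite J \<and> (\<forall>j\<in>J. B j \<in> sets borel \<and> E j \<in> sets borel) \<and> disjoint_family_on B J \<longrightarrow>
        measure M {\<omega> \<in> space M. \<forall>j\<in>J. num_points (X \<omega>) (B j) \<in> E j} =
        (\<Prod>j\<in>J. measure M {\<omega> \<in> space M. num_points (X \<omega>) (B j) \<in> E j})"
    using assms(1) unfolding poisson_law_def by (elim conjE)
  then show ?thesis using assms(2-5) by blast
qed

lemma num_points_empty [simp]: "num_points A {} = 0"
  by (simp add: num_points_def)

lemma num_points_eq_0_iff: "num_points A B = 0 \<longleftrightarrow> A \<inter> B = {}"
  by (simp add: num_points_def emeasure_count_space_eq_0)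

text \<open>In a disjoint family only empty sets can repeat. Those indices are split off: their
  counts are constantly 0, so their events have probability 0 or 1, and \<open>B\<close> is
  injective on the remaining indices.\<close>

lemma poisson_process_indep_family:
  assumes "poisson_process M \<Lambda> X" and J: "finite J"
    and B: "\<And>j. j \<in> J \<Longrightarrow> B j \<in> sets borel" and E: "\<And>j. j \<in> J \<Longrightarrow> E j \<in> sets borel" and disj: "disjoint_family_on B J"
  shows "measure M {\<omega> \<in> space M. \<forall>j\<in>J. num_points (X \<omega>) (B j) \<in> E j} =
    (\<Prod>j\<in>J. measure M {\<omega> \<in> space M. num_points (X \<omega>) (B j) \<in> E j})"
proof -
  interpret prob_space M using assms(1) by (simp add: poisson_process_def point_process_def)
  define J1 where "J1 = {j \<in> J. B j \<noteq> {}}"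
  have J1: "finite J1" "J1 \<subseteq> J" using J by (auto simp: J1_def)
  have inj: "inj_on B J1"
  proof (rule inj_onI, rule ccontr)
    fix i j assume ij: "i \<in> J1" "j \<in> J1" "B i = B j" "i \<noteq> j"
    then have "B i \<inter> B j = {}" using disj unfolding disjoint_family_on_def J1_def by blast
    then show False using ij by (auto simp: J1_def)
  qed
  have one: "measure M {\<omega> \<in> space M. num_points (X \<omega>) (B j) \<in> E j} = (if 0 \<in> E j then 1 else 0)" if "j \<in> J - J1" for j
    using that by (auto simp: J1_def prob_space)
  have prod1: "measure M {\<omega> \<in> space M. \<forall>j\<in>J1. num_points (X \<omega>) (B j) \<in> E j} =
    (\<Prod>j\<in>J1. measure M {\<omega> \<in> space M. num_points (X \<omega>) (B j) \<in> E j})"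
  proof (cases "J1 = {}")
    case True
    then show ?thesis by (simp add: prob_space)
  next
    case False
    have "disjoint (B ` J1)"
      unfolding disjoint_def
    proof (intro ballI impI)
      fix C C' assume "C \<in> B ` J1" "C' \<in> B ` J1" "C \<noteq> C'"
      then obtain i j where "i \<in> J1" "j \<in> J1" "i \<noteq> j" "C = B i" "C' = B j" by fast
      then show "C \<inter> C' = {}"
        using disj J1(2) unfolding disjoint_family_on_def by (metis subsetD)
    qed
    moreover have "B ` J1 \<subseteq> sets borel" using B J1 by blast
    moreover have "finite (B ` J1)" using J1(1) by simp
    moreover have "\<forall>F. finite F \<and> F \<subseteq> sets borel \<and> disjoint F \<longrightarrow>
        indep_vars (\<lambda>_. borel) (\<lambda>B \<omega>. num_points (X \<omega>) B) F"
      using assms(1) unfolding poisson_process_def by (elim conjE)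
    ultimately have ind: "indep_vars (\<lambda>_. borel) (\<lambda>B \<omega>. num_points (X \<omega>) B) (B ` J1)"
      by simp
    have EE: "E (inv_into J1 B C) \<in> sets borel" if "C \<in> B ` J1" for C
      using E inv_into_into[OF that] J1(2) by (metis subsetD)
    have "measure M (\<Inter>C\<in>B ` J1. (\<lambda>\<omega>. num_points (X \<omega>) C) -` E (inv_into J1 B C) \<inter> space M)
        = (\<Prod>C\<in>B ` J1. measure M ((\<lambda>\<omega>. num_points (X \<omega>) C) -` E (inv_into J1 B C) \<inter> space M))"
      using False J1(1) EE by (intro indep_varsD_finite[OF ind]) auto
    also have "\<dots> = (\<Prod>j\<in>J1. measure M ((\<lambda>\<omega>. num_points (X \<omega>) (B j)) -` E j \<inter> space M))"
      using inj by (subst prod.reindex) (auto intro!: prod.cong)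
    also have "(\<Inter>C\<in>B ` J1. (\<lambda>\<omega>. num_points (X \<omega>) C) -` E (inv_into J1 B C) \<inter> space M)
        = {\<omega> \<in> space M. \<forall>j\<in>J1. num_points (X \<omega>) (B j) \<in> E j}"
      using inj False by auto
    finally show ?thesis by (simp add: vimage_def Int_def conj_commute)
  qed
  have split: "(\<Prod>j\<in>J. measure M {\<omega> \<in> space M. num_points (X \<omega>) (B j) \<in> E j})
      = (\<Prod>j\<in>J - J1. if 0 \<in> E j then 1 else 0) * (\<Prod>j\<in>J1. measure M {\<omega> \<in> space M. num_points (X \<omega>) (B j) \<in> E j})"
    unfolding prod.subset_diff[OF J1(2) J] by (simp only: prod.cong[OF refl one])
  show ?thesis
  proof (cases "\<forall>j\<in>J - J1. 0 \<in> E j")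
    case True
    then have "num_points (X \<omega>) (B j) \<in> E j" if "j \<in> J - J1" for \<omega> j
      using that by (auto simp: J1_def)
    then have "{\<omega> \<in> space M. \<forall>j\<in>J. num_points (X \<omega>) (B j) \<in> E j} = {\<omega> \<in> space M. \<forall>j\<in>J1. num_points (X \<omega>) (B j) \<in> E j}"
      using J1(2) by (intro Collect_cong) (metis DiffI subsetD)
    then show ?thesis unfolding split using True prod1 by simp
  next
    case False
    then obtain j where j: "j \<in> J - J1" "0 \<notin> E j" by blast
    then have "num_points (X \<omega>) (B j) \<notin> E j" for \<omega> by (simp add: J1_def)
    then have "{\<omega> \<in> space M. \<forall>j\<in>J. num_points (X \<omega>) (B j) \<in> E j} = {}"
      using j(1) by blast
    moreover have "(\<Prod>j\<in>J - J1. if 0 \<in> E j then 1 else 0) = (0::real)"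
      using j J by (intro prod_zero) auto
    ultimately show ?thesis unfolding split by (simp only: measure_empty mult_zero_left)
  qed
qed

lemma poisson_law_of_process:
  fixes X :: "'w \<Rightarrow> 'b::euclidean_space set"
  assumes "poisson_process M \<Lambda> X" "sets \<Lambda> = sets borel"
  shows "poisson_law M \<Lambda> X"
proof -
  have J: "\<forall>(J::'b set) B E. finite J \<and> (\<forall>j\<in>J. B j \<in> sets borel \<and> E j \<in> sets borel) \<and> disjoint_family_on B J \<longrightarrow>
        measure M {\<omega> \<in> space M. \<forall>j\<in>J. num_points (X \<omega>) (B j) \<in> E j} =
        (\<Prod>j\<in>J. measure M {\<omega> \<in> space M. num_points (X \<omega>) (B j) \<in> E j})"
    by (intro allI impI poisson_process_indep_family[OF assms(1)]) auto
  note c = assms(1)[unfolded poisson_process_def]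
  show ?thesis
    unfolding poisson_law_def
    by (rule conjI[OF conjunct1[OF c] conjI[OF assms(2) conjI[OF conjunct1[OF conjunct2[OF c]]
          conjI[OF conjunct1[OF conjunct2[OF conjunct2[OF c]]] J]]]])
qed

text \<open>This is \<open>1 - exp (- t) <= t\<close>; a set of infinite mass satisfies the bound
  trivially.\<close>

lemma poisson_hit_bound:
  assumes P: "poisson_law M \<Lambda> X" and B: "B \<in> sets borel"
  shows "emeasure M {\<omega> \<in> space M. num_points (X \<omega>) B \<noteq> 0} \<le> emeasure \<Lambda> B"
proof (cases "emeasure \<Lambda> B < \<infinity>")
  case True
  interpret prob_space M by (rule poisson_lawD[OF P])
  have ev: "{\<omega> \<in> space M. num_points (X \<omega>) B = 0} \<in> events"
    by (rule num_points_event[OF poisson_lawD(1)[OF P] B])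
  have "measure M {\<omega> \<in> space M. num_points (X \<omega>) B \<noteq> 0} = 1 - measure M {\<omega> \<in> space M. num_points (X \<omega>) B = 0}"
    using prob_neg[OF ev] by simp
  also have "\<dots> = 1 - exp (- measure \<Lambda> B)"
    using poisson_lawD(4)[OF P B True, of 0] by simp
  also have "\<dots> \<le> measure \<Lambda> B" using exp_ge_add_one_self[of "- measure \<Lambda> B"] by linarith
  finally show ?thesis
    using True by (simp add: emeasure_eq_measure emeasure_eq_ennreal_measure ennreal_leI less_top)
qed (simp add: not_less top_unique)

section \<open>Degenerate tuples seen through occupied cubes\<close>

lemma norm_le_of_gridpt_in_window:
  fixes x :: "'b::euclidean_space"
  assumes "gridpt m x \<in> grid_window m R"
  shows "norm x \<le> real DIM('b) * R + real DIM('b)"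
proof -
  have "norm (gridpt m x) \<le> (\<Sum>b\<in>Basis. \<bar>gridpt m x \<bullet> b\<bar>)" by (rule norm_le_l1)
  also have "\<dots> \<le> (\<Sum>b\<in>(Basis::'b set). R)"
    using assms by (intro sum_mono) (auto simp: grid_window_def)
  finally have "norm (gridpt m x) \<le> real DIM('b) * R" by simp
  moreover have "norm x \<le> norm (gridpt m x) + dist (gridpt m x) x"
    by (metis dist_commute dist_norm norm_triangle_sub)
  moreover have "real DIM('b) / real (Suc m) \<le> real DIM('b)" by (simp add: divide_le_eq)
  ultimately show ?thesis using dist_gridpt[of m x] by linarith
qed

lemma disjoint_cubes: "disjoint_family_on (cube m) J"
  by (auto simp: disjoint_family_on_def cube_def)

text \<open>Here \<open>D x y\<close> says that \<open>y\<close> completes the tuple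
  \<open>x\<close> to a degenerate one. If only the cubes \<open>z\<close> of the tuple are known,
  these are the cubes where a completing point may lie: a discretised neighbourhood of a section of
  \<open>D\<close>.\<close>

definition completing_cubes ::
    "'i set \<Rightarrow> (('i \<Rightarrow> 'b::euclidean_space) \<Rightarrow> 'b \<Rightarrow> bool) \<Rightarrow> nat \<Rightarrow> real \<Rightarrow> ('i \<Rightarrow> 'b) \<Rightarrow> 'b set" where
  "completing_cubes I D m R z = {z0 \<in> grid_window m R.
     \<exists>x y. (\<forall>i\<in>I. gridpt m (x i) = z i) \<and> gridpt m y = z0 \<and> D x y}"

lemma finite_completing_cubes: "finite (completing_cubes I D m R z)"
  using finite_grid_window[of m R] unfolding completing_cubes_def by (rule rev_finite_subset) auto

text \<open>Uniformity in \<open>z\<close> comes from compactness. Given bad tuples of cubes at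
  infinitely many levels, representatives converge to some tuple \<open>l\<close>; by closedness of
  \<open>D\<close>, a point in infinitely many of the bad unions is related to \<open>l\<close>.
  Such points form a null set, and dominated convergence inside a fixed ball makes the masses of the
  unions vanish.\<close>

lemma completing_cubes_small:
  fixes D :: "('i \<Rightarrow> 'b::euclidean_space) \<Rightarrow> 'b \<Rightarrow> bool"
  assumes \<Lambda>: "sets \<Lambda> = sets borel" "\<And>K. compact K \<Longrightarrow> emeasure \<Lambda> K < \<infinity>"
    and I: "finite I"
    and closed: "\<And>xs x ys y. (\<And>i. i \<in> I \<Longrightarrow> (\<lambda>j. xs j i) \<longlonglongrightarrow> x i) \<Longrightarrow> ys \<longlonglongrightarrow> y \<Longrightarrow> (\<And>j. D (xs j) (ys j)) \<Longrightarrow> D x y"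
    and null: "\<And>x. emeasure \<Lambda> {y. D x y} = 0"
    and e: "0 < e"
  shows "\<forall>\<^sub>F m in sequentially. \<forall>z\<in>I \<rightarrow> grid_window m R. emeasure \<Lambda> (\<Union>z0\<in>completing_cubes I D m R z. cube m z0) \<le> e"
proof (rule ccontr)
  assume "\<not> ?thesis"
  from subseq_of_not_eventually[OF this] obtain r :: "nat \<Rightarrow> nat" where r: "strict_mono r"
    and "\<And>j. \<exists>z. z \<in> I \<rightarrow> grid_window (r j) R \<and>
      e < emeasure \<Lambda> (\<Union>z0\<in>completing_cubes I D (r j) R z. cube (r j) z0)" by (metis not_less)
  then obtain z where z: "\<And>j. z j \<in> I \<rightarrow> grid_window (r j) R"
    "\<And>j. e < emeasure \<Lambda> (\<Union>z0\<in>completing_cubes I D (r j) R (z j). cube (r j) z0)" by metis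
  have "completing_cubes I D (r j) R (z j) \<noteq> {}" for j using z(2)[of j] e by (intro notI) simp
  then have "\<exists>x. \<forall>i\<in>I. gridpt (r j) (x i) = z j i" for j unfolding completing_cubes_def by blast
  then obtain x where x: "\<And>j i. i \<in> I \<Longrightarrow> gridpt (r j) (x j i) = z j i" by metis
  define B where "B = real DIM('b) * R + real DIM('b)"
  have "norm (x j i) \<le> B" if "i \<in> I" for i j
    unfolding B_def by (rule norm_le_of_gridpt_in_window[of "r j"]) (use x[OF that] z(1) that in auto)
  then have bd: "bounded (range (\<lambda>j. x j i))" if "i \<in> I" for i
    unfolding bounded_iff using that by blast
  have "\<exists>k l. strict_mono (k :: nat \<Rightarrow> nat) \<and> (\<forall>i\<in>I. (\<lambda>j. x (k j) i) \<longlonglongrightarrow> l i)"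
    by (rule bounded_tuple_subseq[where x = x, OF I bd], assumption) (intro exI conjI ballI; assumption)
  then obtain k l where k: "strict_mono (k :: nat \<Rightarrow> nat)" "\<And>i. i \<in> I \<Longrightarrow> (\<lambda>j. x (k j) i) \<longlonglongrightarrow> l i" by blast
  define n where "n j = r (k j)" for j
  have n: "filterlim n at_top sequentially"
    unfolding n_def using filterlim_subseq[OF strict_mono_o[OF r k(1)]] by (simp add: o_def)
  define U where "U j = (\<Union>z0\<in>completing_cubes I D (n j) R (z (k j)). cube (n j) z0)" for j
  have Um: "U j \<in> sets \<Lambda>" for j
    unfolding U_def \<Lambda>(1) by (intro sets.finite_UN finite_completing_cubes cube_borel)
  have Usub: "U j \<subseteq> cball 0 B" for j
  proof
    fix y assume "y \<in> U j"
    then have "gridpt (n j) y \<in> grid_window (n j) R"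
      by (auto simp: U_def completing_cubes_def cube_def)
    from norm_le_of_gridpt_in_window[OF this] show "y \<in> cball 0 B" by (simp add: B_def)
  qed
  have lim: "\<forall>\<^sub>F j in sequentially. y \<notin> U j" if y: "\<not> D l y" for y
  proof (rule ccontr)
    assume "\<not> ?thesis"
    from subseq_of_not_eventually[OF this] obtain s :: "nat \<Rightarrow> nat" where s: "strict_mono s"
      and U: "\<And>j. y \<in> U (s j)" by metis
    have "\<exists>x' y'. (\<forall>i\<in>I. gridpt (n (s j)) (x' i) = z (k (s j)) i) \<and> gridpt (n (s j)) y' = gridpt (n (s j)) y \<and> D x' y'" for j
      using U[of j] unfolding U_def completing_cubes_def cube_def by auto
    then obtain x' y' where x': "\<And>j i. i \<in> I \<Longrightarrow> gridpt (n (s j)) (x' j i) = z (k (s j)) i"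
      and y': "\<And>j. gridpt (n (s j)) y = gridpt (n (s j)) (y' j)" and D: "\<And>j. D (x' j) (y' j)" by metis
    have ns: "filterlim (\<lambda>j. n (s j)) at_top sequentially"
      using filterlim_compose[OF n filterlim_subseq[OF s]] .
    have "(\<lambda>j. x' j i) \<longlonglongrightarrow> l i" if i: "i \<in> I" for i
    proof (rule gridpt_tendsto[OF ns])
      show "(\<lambda>j. x (k (s j)) i) \<longlonglongrightarrow> l i"
        using LIMSEQ_subseq_LIMSEQ[OF k(2)[OF i] s] by (simp add: o_def)
      show "gridpt (n (s j)) (x (k (s j)) i) = gridpt (n (s j)) (x' j i)" for j
        using x'[OF i] x[OF i] by (simp add: n_def)
    qed
    moreover have "y' \<longlonglongrightarrow> y" by (rule gridpt_tendsto[OF ns y' tendsto_const])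
    ultimately show False using closed[of x' l y' y] D y by blast
  qed
  have nullset: "{y. D l y} \<in> null_sets \<Lambda>"
  proof -
    have "closed {y. D l y}"
      unfolding closed_sequential_limits using closed[of "\<lambda>_. l" l] by auto
    then show ?thesis using null[of l] by (auto simp: null_sets_def \<Lambda>(1) borel_closed)
  qed
  have "(\<lambda>j. \<integral>\<^sup>+y. indicator (U j) y \<partial>\<Lambda>) \<longlonglongrightarrow> (\<integral>\<^sup>+y. 0 \<partial>\<Lambda>)"
  proof (rule nn_integral_dominated_convergence[where w = "indicator (cball 0 B)"])
    show "(\<integral>\<^sup>+y. indicator (cball 0 B) y \<partial>\<Lambda>) < \<infinity>"
      using \<Lambda>(2)[of "cball 0 B"] by (simp add: \<Lambda>(1) borel_closed)
    show "AE y in \<Lambda>. (\<lambda>j. indicator (U j) y :: ennreal) \<longlonglongrightarrow> 0"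
      using AE_not_in[OF nullset]
    proof eventually_elim
      case (elim y)
      then have "\<forall>\<^sub>F j in sequentially. indicator (U j) y = (0::ennreal)"
        using lim[of y] by (auto elim: eventually_mono)
      then show ?case by (rule tendsto_eventually)
    qed
    show "AE y in \<Lambda>. indicator (U j) y \<le> (indicator (cball 0 B) y :: ennreal)" for j
      using Usub[of j] by (intro AE_I2) (auto simp: indicator_def)
    show "indicator (cball 0 B) \<in> borel_measurable \<Lambda>"
      by (rule borel_measurable_indicator) (simp add: \<Lambda>(1) borel_closed)
    show "indicator (U j) \<in> borel_measurable \<Lambda>" for j
      by (rule borel_measurable_indicator[OF Um])
  qed simp
  then have "(\<lambda>j. emeasure \<Lambda> (U j)) \<longlonglongrightarrow> 0" using Um by simp
  then have "\<forall>\<^sub>F j in sequentially. emeasure \<Lambda> (U j) < e" using e by (rule order_tendstoD)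
  then obtain j where "emeasure \<Lambda> (U j) < e" by (auto simp: eventually_sequentially)
  then show False using z(2)[of "k j"] by (simp add: U_def n_def)
qed

text \<open>Distinct cubes are disjoint, so the hitting events are independent and each factor is
  bounded by the mass of its cube.\<close>

lemma joint_hit_bound:
  fixes X :: "'w \<Rightarrow> 'b::euclidean_space set"
  assumes P: "poisson_law M \<Lambda> X" and I: "finite I" and z: "inj_on z I" "z0 \<notin> z ` I"
  shows "emeasure M {\<omega> \<in> space M. (\<forall>i\<in>I. num_points (X \<omega>) (cube m (z i)) \<noteq> 0) \<and> num_points (X \<omega>) (cube m z0) \<noteq> 0}
    \<le> (\<Prod>i\<in>I. emeasure \<Lambda> (cube m (z i))) * emeasure \<Lambda> (cube m z0)"
proof -
  interpret prob_space M by (rule poisson_lawD[OF P])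
  let ?J = "insert z0 (z ` I)"
  let ?hit = "\<lambda>j. {\<omega> \<in> space M. num_points (X \<omega>) (cube m j) \<in> UNIV - {0}}"
  have "measure M {\<omega> \<in> space M. \<forall>j\<in>?J. num_points (X \<omega>) (cube m j) \<in> UNIV - {0}} = (\<Prod>j\<in>?J. measure M (?hit j))"
    using I by (intro poisson_law_indep[OF P] disjoint_cubes) auto
  also have "\<dots> = measure M (?hit z0) * (\<Prod>i\<in>I. measure M (?hit (z i)))"
    using z I by (subst prod.insert) (auto simp: prod.reindex)
  finally have "emeasure M {\<omega> \<in> space M. \<forall>j\<in>?J. num_points (X \<omega>) (cube m j) \<in> UNIV - {0}}
      = emeasure M (?hit z0) * (\<Prod>i\<in>I. emeasure M (?hit (z i)))"
    by (simp add: emeasure_eq_measure ennreal_mult prod_nonneg prod_ennreal)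
  also have "\<dots> \<le> emeasure \<Lambda> (cube m z0) * (\<Prod>i\<in>I. emeasure \<Lambda> (cube m (z i)))"
    using poisson_hit_bound[OF P cube_borel] by (intro mult_mono prod_mono_ennreal) auto
  finally show ?thesis by (simp add: mult.commute conj_commute)
qed

text \<open>In the union bound over tuples of cubes, the sum over the last cube costs at most
  \<open>e\<close>; the sum of products over the other cubes factorises into a power of the mass of
  a fixed ball.\<close>

lemma degenerate_event_bound:
  fixes X :: "'w \<Rightarrow> 'b::euclidean_space set"
  assumes P: "poisson_law M \<Lambda> X" and I: "finite I"
    and small: "\<forall>z\<in>I \<rightarrow> grid_window m R. emeasure \<Lambda> (\<Union>z0\<in>completing_cubes I D m R z. cube m z0) \<le> e"
  shows "emeasure M {\<omega> \<in> space M. \<exists>z\<in>I \<rightarrow>\<^sub>E grid_window m R. inj_on z I \<and> (\<exists>z0\<in>completing_cubes I D m R z.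
      z0 \<notin> z ` I \<and> (\<forall>i\<in>I. num_points (X \<omega>) (cube m (z i)) \<noteq> 0) \<and> num_points (X \<omega>) (cube m z0) \<noteq> 0)}
    \<le> emeasure \<Lambda> (cball 0 (real DIM('b) * R + real DIM('b))) ^ card I * e"
proof -
  let ?W = "grid_window m R :: 'b set"
  define hit where "hit z z0 = {\<omega> \<in> space M. (\<forall>i\<in>I. num_points (X \<omega>) (cube m (z i)) \<noteq> 0) \<and> num_points (X \<omega>) (cube m z0) \<noteq> 0}" for z z0
  define V where "V = {z \<in> I \<rightarrow>\<^sub>E ?W. inj_on z I}"
  define C where "C z = {z0 \<in> completing_cubes I D m R z. z0 \<notin> z ` I}" for z
  have sets\<Lambda>: "cube m z \<in> sets \<Lambda>" for z using poisson_lawD(2)[OF P] by simp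
  have finP: "finite (I \<rightarrow>\<^sub>E ?W)" using I finite_grid_window by (intro finite_PiE) auto
  have finV: "finite V" using finP by (simp add: V_def)
  have finC: "finite (C z)" for z
    unfolding C_def by (rule finite_subset[OF _ finite_completing_cubes]) auto
  have "{\<omega> \<in> space M. num_points (X \<omega>) (cube m z) \<noteq> 0} \<in> sets M" for z
    using num_points_event[OF poisson_lawD(1)[OF P] cube_borel, where c = 0] by (rule sets.sets_Collect_neg)
  then have hitm: "hit z z0 \<in> sets M" for z z0
    unfolding hit_def using I by (intro sets.sets_Collect_conj sets.sets_Collect_finite_All)
  have "{\<omega> \<in> space M. \<exists>z\<in>I \<rightarrow>\<^sub>E ?W. inj_on z I \<and> (\<exists>z0\<in>completing_cubes I D m R z.
      z0 \<notin> z ` I \<and> (\<forall>i\<in>I. num_points (X \<omega>) (cube m (z i)) \<noteq> 0) \<and> num_points (X \<omega>) (cube m z0) \<noteq> 0)}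
    = (\<Union>z\<in>V. \<Union>z0\<in>C z. hit z z0)"
    unfolding V_def C_def hit_def by auto
  also have "emeasure M \<dots> \<le> (\<Sum>z\<in>V. emeasure M (\<Union>z0\<in>C z. hit z z0))"
    using finV finC hitm by (intro emeasure_subadditive_finite) (auto intro!: sets.finite_UN)
  also have "\<dots> \<le> (\<Sum>z\<in>V. (\<Prod>i\<in>I. emeasure \<Lambda> (cube m (z i))) * e)"
  proof (rule sum_mono)
    fix z assume z: "z \<in> V"
    have "emeasure M (\<Union>z0\<in>C z. hit z z0) \<le> (\<Sum>z0\<in>C z. emeasure M (hit z z0))"
      using finC hitm by (intro emeasure_subadditive_finite) auto
    also have "\<dots> \<le> (\<Sum>z0\<in>C z. (\<Prod>i\<in>I. emeasure \<Lambda> (cube m (z i))) * emeasure \<Lambda> (cube m z0))"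
      unfolding hit_def using z by (intro sum_mono joint_hit_bound[OF P I]) (auto simp: V_def C_def)
    also have "\<dots> = (\<Prod>i\<in>I. emeasure \<Lambda> (cube m (z i))) * (\<Sum>z0\<in>C z. emeasure \<Lambda> (cube m z0))"
      by (simp add: sum_distrib_left)
    also have "(\<Sum>z0\<in>C z. emeasure \<Lambda> (cube m z0)) = emeasure \<Lambda> (\<Union>z0\<in>C z. cube m z0)"
      using finC sets\<Lambda> by (intro sum_emeasure disjoint_cubes) auto
    also have "\<dots> \<le> emeasure \<Lambda> (\<Union>z0\<in>completing_cubes I D m R z. cube m z0)"
      using finite_completing_cubes sets\<Lambda> by (intro emeasure_mono sets.finite_UN) (auto simp: C_def)
    also have "\<dots> \<le> e" using small z by (auto simp: V_def PiE_def)
    finally show "emeasure M (\<Union>z0\<in>C z. hit z z0) \<le> (\<Prod>i\<in>I. emeasure \<Lambda> (cube m (z i))) * e"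
      by (simp add: mult_left_mono)
  qed
  also have "\<dots> \<le> (\<Sum>z\<in>I \<rightarrow>\<^sub>E ?W. (\<Prod>i\<in>I. emeasure \<Lambda> (cube m (z i))) * e)"
    using finP by (intro sum_mono2) (auto simp: V_def)
  also have "\<dots> = (\<Sum>z\<in>I \<rightarrow>\<^sub>E ?W. (\<Prod>i\<in>I. emeasure \<Lambda> (cube m (z i)))) * e"
    by (simp add: sum_distrib_right)
  also have "(\<Sum>z\<in>I \<rightarrow>\<^sub>E ?W. (\<Prod>i\<in>I. emeasure \<Lambda> (cube m (z i)))) = (\<Prod>i\<in>I. \<Sum>w\<in>?W. emeasure \<Lambda> (cube m w))"
    using I finite_grid_window by (subst prod_sum_PiE) auto
  also have "\<dots> = (\<Sum>w\<in>?W. emeasure \<Lambda> (cube m w)) ^ card I" by simp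
  also have "(\<Sum>w\<in>?W. emeasure \<Lambda> (cube m w)) = emeasure \<Lambda> (\<Union>w\<in>?W. cube m w)"
    using finite_grid_window sets\<Lambda> by (intro sum_emeasure disjoint_cubes) auto
  also have "\<dots> ^ card I * e \<le> emeasure \<Lambda> (cball 0 (real DIM('b) * R + real DIM('b))) ^ card I * e"
  proof (intro mult_right_mono power_mono emeasure_mono)
    show "(\<Union>w\<in>?W. cube m w) \<subseteq> cball 0 (real DIM('b) * R + real DIM('b))"
      using norm_le_of_gridpt_in_window[of m _ R] by (auto simp: cube_def)
  qed (use poisson_lawD(2)[OF P] in \<open>auto simp: borel_closed\<close>)
  finally show ?thesis .
qed

lemma eventually_gridpt_neq:
  assumes "x \<noteq> y"
  shows "\<forall>\<^sub>F m in sequentially. gridpt m x \<noteq> gridpt m y"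
proof (rule ccontr)
  assume "\<not> ?thesis"
  from subseq_of_not_eventually[OF this] obtain r :: "nat \<Rightarrow> nat" where r: "strict_mono r"
    "\<And>j. gridpt (r j) x = gridpt (r j) y" by metis
  have "(\<lambda>_. y) \<longlonglongrightarrow> x"
    by (rule gridpt_tendsto[OF filterlim_subseq[OF r(1)] _ tendsto_const]) (simp add: r(2))
  then show False using assms by (simp add: LIMSEQ_const_iff)
qed

text \<open>Distinct points lie in distinct cubes at all fine levels, so a degenerate tuple of points gives
  tuples of distinct occupied cubes that meet \<open>D\<close> at all these levels; the union bound over such
  tuples of cubes tends to \<open>0\<close>. This avoids moment measures of the process.\<close>

lemma no_degenerate_tuple:
  fixes X :: "'w \<Rightarrow> 'b::euclidean_space set" and D :: "('i \<Rightarrow> 'b) \<Rightarrow> 'b \<Rightarrow> bool"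
  assumes P: "poisson_law M \<Lambda> X" and \<Lambda>: "\<And>K. compact K \<Longrightarrow> emeasure \<Lambda> K < \<infinity>"
    and I: "finite I"
    and closed: "\<And>xs x ys y. (\<And>i. i \<in> I \<Longrightarrow> (\<lambda>j. xs j i) \<longlonglongrightarrow> x i) \<Longrightarrow> ys \<longlonglongrightarrow> y \<Longrightarrow> (\<And>j. D (xs j) (ys j)) \<Longrightarrow> D x y"
    and null: "\<And>x. emeasure \<Lambda> {y. D x y} = 0"
  shows "AE \<omega> in M. \<forall>x y. inj_on x I \<and> x ` I \<subseteq> X \<omega> \<and> y \<in> X \<omega> - x ` I \<longrightarrow> \<not> D x y"
proof -
  \<comment> \<open>Restriction to tuples inside a ball keeps the cubes in a window of fixed radius
    at all levels; a countable intersection over \<open>k\<close> removes it.\<close>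
  have "AE \<omega> in M. \<forall>x y. inj_on x I \<and> x ` I \<subseteq> X \<omega> \<and> y \<in> X \<omega> - x ` I \<and> (\<forall>i\<in>I. norm (x i) \<le> real k) \<and> norm y \<le> real k \<longrightarrow> \<not> D x y" for k :: nat
  proof -
    define R where "R = real k + real DIM('b)"
    define Deg where "Deg m = {\<omega> \<in> space M. \<exists>z\<in>I \<rightarrow>\<^sub>E grid_window m R. inj_on z I \<and> (\<exists>z0\<in>completing_cubes I D m R z.
      z0 \<notin> z ` I \<and> (\<forall>i\<in>I. num_points (X \<omega>) (cube m (z i)) \<noteq> 0) \<and> num_points (X \<omega>) (cube m z0) \<noteq> 0)}" for m
    have "{\<omega> \<in> space M. num_points (X \<omega>) (cube m z) \<noteq> 0} \<in> sets M" for m z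
      using num_points_event[OF poisson_lawD(1)[OF P] cube_borel, where c = 0] by (rule sets.sets_Collect_neg)
    then have Degm: "Deg m \<in> sets M" for m
      unfolding Deg_def using I finite_completing_cubes finite_grid_window
      by (intro sets.sets_Collect_finite_Ex sets.sets_Collect_conj sets.sets_Collect_const
          sets.sets_Collect_finite_All finite_PiE) auto
    define c where "c = emeasure \<Lambda> (cball 0 (real DIM('b) * R + real DIM('b))) ^ card I"
    have c: "c < top" unfolding c_def using \<Lambda>[of "cball 0 (real DIM('b) * R + real DIM('b))"]
      by (simp add: power_less_top_ennreal)
    \<comment> \<open>The events \<open>Deg m\<close> need be neither null nor monotone. A
      degenerate tuple lies in all of them from some level on, and such a tail intersection is
      contained in events of arbitrarily small probability.\<close>
    have Deg0: "(\<Inter>m\<in>{m0..}. Deg m) \<in> null_sets M" for m0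
    proof -
      have le: "emeasure M (\<Inter>m\<in>{m0..}. Deg m) \<le> c * ennreal (1 / real (Suc n))" for n
      proof -
        have "\<forall>\<^sub>F m in sequentially. \<forall>z\<in>I \<rightarrow> grid_window m R.
            emeasure \<Lambda> (\<Union>z0\<in>completing_cubes I D m R z. cube m z0) \<le> ennreal (1 / real (Suc n))"
        proof (rule completing_cubes_small[OF poisson_lawD(2)[OF P] \<Lambda> I _ null])
          show "D x y" if "\<And>i. i \<in> I \<Longrightarrow> (\<lambda>j. xs j i) \<longlonglongrightarrow> x i" "ys \<longlonglongrightarrow> y" "\<And>j. D (xs j) (ys j)" for xs x ys y
            by (rule closed[OF that])
        qed auto
        then obtain m1 where m1: "\<And>m. m1 \<le> m \<Longrightarrow> \<forall>z\<in>I \<rightarrow> grid_window m R.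
            emeasure \<Lambda> (\<Union>z0\<in>completing_cubes I D m R z. cube m z0) \<le> ennreal (1 / real (Suc n))"
          unfolding eventually_sequentially by blast
        have "emeasure M (\<Inter>m\<in>{m0..}. Deg m) \<le> emeasure M (Deg (max m0 m1))"
          by (intro emeasure_mono Degm) auto
        also have "\<dots> \<le> c * ennreal (1 / real (Suc n))"
          unfolding Deg_def c_def by (rule degenerate_event_bound[OF P I m1]) simp
        finally show ?thesis .
      qed
      have "(\<lambda>n. c * ennreal (1 / real (Suc n))) \<longlonglongrightarrow> c * ennreal 0"
        using LIMSEQ_Suc[OF lim_const_over_n[of 1]] c by (intro ennreal_tendsto_cmult tendsto_ennrealI) auto
      from LIMSEQ_le_const[OF this] have "emeasure M (\<Inter>m\<in>{m0..}. Deg m) \<le> 0" using le by auto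
      then show ?thesis using Degm by (auto intro!: null_setsI sets.countable_INT')
    qed
    have "AE \<omega> in M. \<forall>m0. \<omega> \<notin> (\<Inter>m\<in>{m0..}. Deg m)"
      unfolding AE_all_countable using AE_not_in[OF Deg0] by blast
    then show ?thesis using AE_space
    proof eventually_elim
      case (elim \<omega>)
      show ?case
      proof (intro allI impI, elim conjE, rule notI)
        fix x y assume x: "inj_on x I" "x ` I \<subseteq> X \<omega>" "\<forall>i\<in>I. norm (x i) \<le> real k"
          and y: "y \<in> X \<omega> - x ` I" "norm y \<le> real k" and D: "D x y"
        have "\<forall>\<^sub>F m in sequentially. \<forall>i\<in>I. \<forall>i'\<in>I. i \<noteq> i' \<longrightarrow> gridpt m (x i) \<noteq> gridpt m (x i')"
        proof (intro eventually_ball_finite I ballI)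
          fix i i' assume "i \<in> I" "i' \<in> I"
          then show "\<forall>\<^sub>F m in sequentially. i \<noteq> i' \<longrightarrow> gridpt m (x i) \<noteq> gridpt m (x i')"
            using eventually_gridpt_neq[of "x i" "x i'"] inj_onD[OF x(1), of i i'] by (cases "i = i'") auto
        qed
        moreover have "\<forall>\<^sub>F m in sequentially. \<forall>i\<in>I. gridpt m y \<noteq> gridpt m (x i)"
          using y(1) by (intro eventually_ball_finite I ballI eventually_gridpt_neq) auto
        ultimately have "\<forall>\<^sub>F m in sequentially. \<omega> \<in> Deg m"
        proof eventually_elim
          case (elim m)
          have win: "gridpt m p \<in> grid_window m R" if "norm p \<le> real k" for p :: 'b
          proof (rule gridpt_in_window)
            have "real DIM('b) / real (Suc m) \<le> real DIM('b)" by (simp add: divide_le_eq)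
            then show "norm p + real DIM('b) / real (Suc m) \<le> R" using that by (simp add: R_def)
          qed
          have occupied: "num_points (X \<omega>) (cube m (gridpt m p)) \<noteq> 0" if "p \<in> X \<omega>" for p
            using that by (auto simp: num_points_eq_0_iff cube_def)
          define z where "z = restrict (\<lambda>i. gridpt m (x i)) I"
          have z: "z i = gridpt m (x i)" if "i \<in> I" for i using that by (simp add: z_def)
          have "z \<in> I \<rightarrow>\<^sub>E grid_window m R" unfolding z_def using x(3) win by auto
          moreover have "inj_on z I" using elim(1) by (intro inj_onI) (metis z)
          moreover have "gridpt m y \<in> completing_cubes I D m R z"
            unfolding completing_cubes_def using win[OF y(2)] z D by auto
          moreover have "gridpt m y \<notin> z ` I" using elim(2) by (auto simp: z)
          moreover have "\<forall>i\<in>I. num_points (X \<omega>) (cube m (z i)) \<noteq> 0"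
            using x(2) occupied z by auto
          moreover have "num_points (X \<omega>) (cube m (gridpt m y)) \<noteq> 0" using y(1) occupied by blast
          ultimately show ?case unfolding Deg_def using \<open>\<omega> \<in> space M\<close> by blast
        qed
        then show False using \<open>\<forall>m0. \<omega> \<notin> (\<Inter>m\<in>{m0..}. Deg m)\<close> by (auto simp: eventually_sequentially)
      qed
    qed
  qed
  then have "AE \<omega> in M. \<forall>k::nat. \<forall>x y. inj_on x I \<and> x ` I \<subseteq> X \<omega> \<and> y \<in> X \<omega> - x ` I \<and> (\<forall>i\<in>I. norm (x i) \<le> real k) \<and> norm y \<le> real k \<longrightarrow> \<not> D x y"
    unfolding AE_all_countable by blast
  then show ?thesis
  proof eventually_elim
    case (elim \<omega>)
    show ?case
    proof (intro allI impI)
      fix x y assume xy: "inj_on x I \<and> x ` I \<subseteq> X \<omega> \<and> y \<in> X \<omega> - x ` I"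
      obtain k :: nat where k: "norm y + (\<Sum>i\<in>I. norm (x i)) \<le> real k" using real_arch_simple by blast
      have "norm (x i) \<le> real k" if "i \<in> I" for i
      proof -
        have "norm (x i) \<le> (\<Sum>i\<in>I. norm (x i))" using that I by (intro member_le_sum) auto
        then show ?thesis using k norm_ge_zero[of y] by linarith
      qed
      moreover have "norm y \<le> real k" using k sum_nonneg[of I "\<lambda>i. norm (x i)"] by fastforce
      ultimately show "\<not> D x y" using elim xy by blast
    qed
  qed
qed

section \<open>Almost sure genericity\<close>

text \<open>Covers the densities \<open>f\<close> as well as \<open>\<gamma>\<close> times the point mass at \<open>0\<close>.\<close>

definition height_measure :: "real measure \<Rightarrow> bool" where
  "height_measure \<rho> \<longleftrightarrow> sets \<rho> = sets borel \<and> (\<forall>a b. emeasure \<rho> {a..b} < \<infinity>) \<and>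
     emeasure \<rho> UNIV \<noteq> 0 \<and> emeasure \<rho> {..<0} = 0"

lemma height_measure_sigma_finite:
  assumes "height_measure \<rho>"
  shows "sigma_finite_measure \<rho>"
proof
  have "\<exists>n. x \<in> {- real n..real n}" for x :: real
    using real_arch_simple[of "\<bar>x\<bar>"] by (auto simp: abs_le_iff minus_le_iff)
  then have "\<Union> (range (\<lambda>n. {- real n..real n})) = (UNIV :: real set)" by auto
  moreover have "space \<rho> = UNIV"
    using assms sets_eq_imp_space_eq[of \<rho> borel] by (simp add: height_measure_def)
  ultimately show "\<exists>A. countable A \<and> A \<subseteq> sets \<rho> \<and> \<Union>A = space \<rho> \<and> (\<forall>a\<in>A. emeasure \<rho> a \<noteq> \<infinity>)"
    using assms by (intro exI[of _ "range (\<lambda>n. {- real n..real n})"]) (auto simp: height_measure_def less_top)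
qed

lemma emeasure_lborel_pair_Times:
  assumes "height_measure \<rho>" "A \<in> sets borel" "B \<in> sets borel"
  shows "emeasure (lborel \<Otimes>\<^sub>M \<rho>) (A \<times> B) = emeasure lborel A * emeasure \<rho> B"
proof -
  interpret sigma_finite_measure \<rho> by (rule height_measure_sigma_finite[OF assms(1)])
  show ?thesis
    using assms by (intro emeasure_pair_measure_Times) (auto simp: height_measure_def)
qed

lemma sets_lborel_pair:
  assumes "height_measure \<rho>"
  shows "sets (lborel \<Otimes>\<^sub>M \<rho>) = sets (borel :: ('a::euclidean_space \<times> real) measure)"
proof -
  have "sets (lborel \<Otimes>\<^sub>M \<rho>) = sets (borel \<Otimes>\<^sub>M (borel :: real measure))"
    using assms by (intro sets_pair_measure_cong) (auto simp: height_measure_def)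
  then show ?thesis by (simp only: borel_prod)
qed

lemma emeasure_lborel_pair_compact:
  fixes K :: "('a::euclidean_space \<times> real) set"
  assumes "height_measure \<rho>" "compact K"
  shows "emeasure (lborel \<Otimes>\<^sub>M \<rho>) K < \<infinity>"
proof -
  obtain r where r: "\<And>p. p \<in> K \<Longrightarrow> norm p \<le> r"
    using compact_imp_bounded[OF assms(2)] by (auto simp: bounded_iff)
  have sub: "K \<subseteq> cball 0 r \<times> {- r..r}"
  proof
    fix p assume "p \<in> K"
    then have "norm (fst p) \<le> r" "norm (snd p) \<le> r"
      using r[of p] norm_fst_le[of "fst p" "snd p"] norm_snd_le[of "snd p" "fst p"] by auto
    then show "p \<in> cball 0 r \<times> {- r..r}" by (cases p) auto
  qed
  have "emeasure (lborel \<Otimes>\<^sub>M \<rho>) K \<le> emeasure (lborel \<Otimes>\<^sub>M \<rho>) (cball (0::'a) r \<times> {- r..r})"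
    unfolding sets_lborel_pair[OF assms(1)]
    by (rule emeasure_mono[OF sub]) (simp only: sets_lborel_pair[OF assms(1)] borel_closed closed_Times closed_cball closed_atLeastAtMost)
  also have "\<dots> = emeasure lborel (cball (0::'a) r) * emeasure \<rho> {- r..r}"
    by (intro emeasure_lborel_pair_Times[OF assms(1)]) (auto simp: borel_closed)
  also have "\<dots> < \<infinity>"
    using assms(1) emeasure_bounded_finite[of "cball (0::'a) r"]
    by (auto simp: height_measure_def ennreal_mult_less_top)
  finally show ?thesis .
qed

lemma emeasure_lborel_negligible:
  assumes "closed T" "negligible T"
  shows "emeasure lborel T = 0"
  using assms by (auto simp: negligible_iff_null_sets null_sets_completion_iff borel_closed)

lemma emeasure_pair_vertical_null:
  fixes T :: "'a::euclidean_space set"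
  assumes "height_measure \<rho>" "closed T" "negligible T"
  shows "emeasure (lborel \<Otimes>\<^sub>M \<rho>) {y. fst y \<in> T} = 0"
proof -
  have "{y. fst y \<in> T} = T \<times> (UNIV :: real set)" by auto
  then show ?thesis
    using emeasure_lborel_negligible[OF assms(2,3)] assms(2)
    by (simp add: emeasure_lborel_pair_Times[OF assms(1)] borel_closed)
qed

text \<open>With the height integrated last, each slice in the centre variable lies in a Euclidean
  sphere and is null. Atoms of \<rho> therefore do no harm.\<close>

lemma emeasure_pair_power_sphere:
  fixes w :: "'a::euclidean_space"
  assumes "height_measure \<rho>"
  shows "emeasure (lborel \<Otimes>\<^sub>M \<rho>) {y. power_fun w y = c} = 0"
proof -
  interpret \<rho>: sigma_finite_measure \<rho> by (rule height_measure_sigma_finite[OF assms])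
  interpret pair_sigma_finite "lborel :: 'a measure" \<rho> ..
  have "closed {y. power_fun w y = c}"
    unfolding power_fun_def by (intro closed_Collect_eq continuous_intros)
  then have "{y. power_fun w y = c} \<in> sets (lborel \<Otimes>\<^sub>M \<rho>)"
    unfolding sets_lborel_pair[OF assms] by (rule borel_closed)
  from emeasure_pair_measure_alt2[OF this]
  have "emeasure (lborel \<Otimes>\<^sub>M \<rho>) {y. power_fun w y = c}
      = (\<integral>\<^sup>+h. emeasure lborel ((\<lambda>v. (v, h)) -` {y. power_fun w y = c}) \<partial>\<rho>)" .
  also have "\<dots> = (\<integral>\<^sup>+h. 0 \<partial>\<rho>)"
  proof (rule nn_integral_cong)
    fix h
    have "(\<lambda>v. (v, h)) -` {y. power_fun w y = c} = {v. (norm (w - v))\<^sup>2 + h = c}"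
      by (auto simp: power_fun_def)
    moreover have "closed {v. (norm (w - v))\<^sup>2 + h = c}"
      by (intro closed_Collect_eq continuous_intros)
    moreover have "{v. (norm (w - v))\<^sup>2 + h = c} \<subseteq> sphere w (sqrt (c - h))"
      by (auto simp: dist_norm)
    then have "negligible {v. (norm (w - v))\<^sup>2 + h = c}"
      using negligible_sphere negligible_subset by blast
    ultimately show "emeasure lborel ((\<lambda>v. (v, h)) -` {y. power_fun w y = c}) = 0"
      using emeasure_lborel_negligible by simp
  qed
  finally show ?thesis by simp
qed

text \<open>The bounds by \<open>N\<close> make these degeneracy relations closed.\<close>

abbreviation affinely_dependent :: "nat \<Rightarrow> 'a \<Rightarrow> ('a \<Rightarrow> 'a::euclidean_space \<times> real) \<Rightarrow> 'a \<times> real \<Rightarrow> bool" where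
  "affinely_dependent N b0 x y \<equiv>
     \<exists>c\<in>cball 0 (real N). fst y - fst (x 0) = (\<Sum>b\<in>Basis - {b0}. (c \<bullet> b) *\<^sub>R (fst (x b) - fst (x 0)))"

abbreviation cospherical :: "nat \<Rightarrow> ('a \<Rightarrow> 'a::euclidean_space \<times> real) \<Rightarrow> 'a \<times> real \<Rightarrow> bool" where
  "cospherical N x y \<equiv>
     \<exists>w\<in>cball 0 (real N). (\<forall>i\<in>vertex_ix. power_fun w (x i) = power_fun w y) \<and>
        (\<forall>u. norm u \<le> real N * norm (edge_map x u))"

context
  fixes M :: "'w measure" and \<rho> :: "real measure" and X :: "'w \<Rightarrow> ('a::euclidean_space \<times> real) set"
  assumes \<rho>: "height_measure \<rho>" and P: "poisson_law M (lborel \<Otimes>\<^sub>M \<rho>) X"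
begin

text \<open>The vertex \<open>b0\<close> plays the last point. For fixed other vertices its centre
  must avoid an affine subspace spanned by at most \<open>d - 1\<close> edges, which is a null
  set.\<close>

lemma AE_affine_independent:
  fixes b0 :: 'a
  assumes b0: "b0 \<in> Basis"
  shows "AE \<omega> in M. \<forall>x y. inj_on x (vertex_ix - {b0}) \<and> x ` (vertex_ix - {b0}) \<subseteq> X \<omega> \<and> y \<in> X \<omega> - x ` (vertex_ix - {b0}) \<longrightarrow>
    \<not> affinely_dependent N b0 x y"
proof (rule no_degenerate_tuple[OF P emeasure_lborel_pair_compact[OF \<rho>]])
  show "finite (vertex_ix - {b0})" by simp
  have zero: "0 \<in> vertex_ix - {b0}" using b0 zero_notin_Basis[where 'a = 'a] by auto
  {
    fix xs :: "nat \<Rightarrow> 'a \<Rightarrow> 'a \<times> real" and x ys y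
    assume xs: "\<And>i. i \<in> vertex_ix - {b0} \<Longrightarrow> (\<lambda>j. xs j i) \<longlonglongrightarrow> x i" and ys: "ys \<longlonglongrightarrow> y"
      and "\<And>j. affinely_dependent N b0 (xs j) (ys j)"
    then have "\<forall>j. \<exists>c. c \<in> cball 0 (real N) \<and> fst (ys j) - fst (xs j 0) = (\<Sum>b\<in>Basis - {b0}. (c \<bullet> b) *\<^sub>R (fst (xs j b) - fst (xs j 0)))"
      by (simp only: Bex_def) simp
    from choice[OF this] obtain c where c: "\<And>j. c j \<in> cball 0 (real N)"
      "\<And>j. fst (ys j) - fst (xs j 0) = (\<Sum>b\<in>Basis - {b0}. (c j \<bullet> b) *\<^sub>R (fst (xs j b) - fst (xs j 0)))" by blast
    obtain l r where l: "l \<in> cball 0 (real N)" "strict_mono r" "(c \<circ> r) \<longlonglongrightarrow> l"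
      using compact_cball[of 0 "real N"] c(1) unfolding compact_def by metis
    have "(\<lambda>j. fst (ys (r j)) - fst (xs (r j) 0)) \<longlonglongrightarrow> fst y - fst (x 0)"
      using LIMSEQ_subseq_LIMSEQ[OF ys l(2)] LIMSEQ_subseq_LIMSEQ[OF xs[OF zero] l(2)]
      by (intro tendsto_intros) (auto simp: o_def)
    moreover have "(\<lambda>j. \<Sum>b\<in>Basis - {b0}. ((c \<circ> r) j \<bullet> b) *\<^sub>R (fst (xs (r j) b) - fst (xs (r j) 0)))
      \<longlonglongrightarrow> (\<Sum>b\<in>Basis - {b0}. (l \<bullet> b) *\<^sub>R (fst (x b) - fst (x 0)))"
      using LIMSEQ_subseq_LIMSEQ[OF xs l(2)] zero by (intro tendsto_intros l(3)) (auto simp: o_def)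
    then have "(\<lambda>j. fst (ys (r j)) - fst (xs (r j) 0)) \<longlonglongrightarrow> (\<Sum>b\<in>Basis - {b0}. (l \<bullet> b) *\<^sub>R (fst (x b) - fst (x 0)))"
      by (simp add: c(2))
    ultimately have "fst y - fst (x 0) = (\<Sum>b\<in>Basis - {b0}. (l \<bullet> b) *\<^sub>R (fst (x b) - fst (x 0)))"
      by (rule LIMSEQ_unique)
    then show "affinely_dependent N b0 x y"
      using l(1) by blast
  }
  fix x :: "'a \<Rightarrow> 'a \<times> real"
  define W where "W = (\<lambda>b. fst (x b) - fst (x 0)) ` (Basis - {b0})"
  define s where "s c = fst (x 0) + (\<Sum>b\<in>Basis - {b0}. (c \<bullet> b) *\<^sub>R (fst (x b) - fst (x 0)))" for c :: 'a
  have "closed (s ` cball 0 (real N))"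
    unfolding s_def by (intro compact_imp_closed compact_continuous_image continuous_intros compact_cball)
  moreover have "negligible (s ` cball 0 (real N))"
  proof (rule negligible_subset)
    have "finite W" by (simp add: W_def)
    have "dim (span W) \<le> card W" using dim_le_card'[OF \<open>finite W\<close>] by simp
    also have "\<dots> \<le> card (Basis - {b0})" unfolding W_def by (rule card_image_le) simp
    also have "\<dots> < DIM('a)" using b0 by (intro psubset_card_mono) auto
    finally show "negligible ((+) (fst (x 0)) ` span W)"
      by (intro negligible_translation negligible_lowdim)
    show "s ` cball 0 (real N) \<subseteq> (+) (fst (x 0)) ` span W"
      unfolding s_def W_def by (intro image_subsetI imageI span_sum span_scale span_base) auto
  qed
  ultimately have "emeasure (lborel \<Otimes>\<^sub>M \<rho>) {y. fst y \<in> s ` cball 0 (real N)} = 0"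
    by (rule emeasure_pair_vertical_null[OF \<rho>])
  also have "{y :: 'a \<times> real. fst y \<in> s ` cball 0 (real N)} =
      {y. affinely_dependent N b0 x y}"
    unfolding s_def by (auto simp: algebra_simps)
  finally show "emeasure (lborel \<Otimes>\<^sub>M \<rho>) {y. affinely_dependent N b0 x y} = 0" .
qed

text \<open>The bound on \<open>edge_map x\<close> makes the point of equal power for
  \<open>x\<close> unique, so a completing \<open>y\<close> has to lie on one fixed power
  sphere.\<close>

lemma AE_no_cospherical:
  "AE \<omega> in M. \<forall>x y. inj_on x vertex_ix \<and> x ` vertex_ix \<subseteq> X \<omega> \<and> y \<in> X \<omega> - x ` vertex_ix \<longrightarrow>
    \<not> cospherical N x y"
proof (rule no_degenerate_tuple[OF P emeasure_lborel_pair_compact[OF \<rho>]])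
  show "finite (vertex_ix :: 'a set)" by simp
  {
    fix xs :: "nat \<Rightarrow> 'a \<Rightarrow> 'a \<times> real" and x ys y
    assume xs: "\<And>i. i \<in> vertex_ix \<Longrightarrow> (\<lambda>j. xs j i) \<longlonglongrightarrow> x i" and ys: "ys \<longlonglongrightarrow> y"
      and *: "\<And>j. cospherical N (xs j) (ys j)"
    have edge: "norm u \<le> real N * norm (edge_map x u)" for u
    proof (rule LIMSEQ_le_const)
      show "(\<lambda>j. real N * norm (edge_map (xs j) u)) \<longlonglongrightarrow> real N * norm (edge_map x u)"
        unfolding edge_map_def by (intro tendsto_intros xs) auto
      show "\<exists>n0. \<forall>j\<ge>n0. norm u \<le> real N * norm (edge_map (xs j) u)" using * by blast
    qed
    obtain w where w: "\<And>j. w j \<in> cball 0 (real N)" "\<And>j. \<forall>i\<in>vertex_ix. power_fun (w j) (xs j i) = power_fun (w j) (ys j)"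
      using * by metis
    obtain l r where l: "l \<in> cball 0 (real N)" "strict_mono r" "(w \<circ> r) \<longlonglongrightarrow> l"
      using compact_cball[of 0 "real N"] w(1) unfolding compact_def by metis
    have "power_fun l (x i) = power_fun l y" if i: "i \<in> vertex_ix" for i
    proof (rule LIMSEQ_unique)
      show "(\<lambda>j. power_fun ((w \<circ> r) j) (xs (r j) i)) \<longlonglongrightarrow> power_fun l (x i)"
        using LIMSEQ_subseq_LIMSEQ[OF xs[OF i] l(2)] by (intro tendsto_intros l(3)) (simp add: o_def)
      have "(\<lambda>j. power_fun ((w \<circ> r) j) (ys (r j))) \<longlonglongrightarrow> power_fun l y"
        using LIMSEQ_subseq_LIMSEQ[OF ys l(2)] by (intro tendsto_intros l(3)) (simp add: o_def)
      moreover have "power_fun ((w \<circ> r) j) (xs (r j) i) = power_fun ((w \<circ> r) j) (ys (r j))" for j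
        using w(2)[of "r j"] i by (metis comp_apply)
      ultimately show "(\<lambda>j. power_fun ((w \<circ> r) j) (xs (r j) i)) \<longlonglongrightarrow> power_fun l y" by simp
    qed
    then show "cospherical N x y"
      using l(1) edge by blast
  }
  fix x :: "'a \<Rightarrow> 'a \<times> real"
  let ?D = "{y. cospherical N x y}"
  show "emeasure (lborel \<Otimes>\<^sub>M \<rho>) ?D = 0"
  proof (cases "?D = {}")
    case False
    then obtain w y where y: "\<forall>i\<in>vertex_ix. power_fun w (x i) = power_fun w y"
      and inj: "\<And>u. norm u \<le> real N * norm (edge_map x u)" by blast
    have w: "\<forall>i\<in>vertex_ix. power_fun w (x i) = power_fun w (x 0)" using y by simp
    have "?D \<subseteq> {y. power_fun w y = power_fun w (x 0)}"
    proof
      fix y assume "y \<in> ?D"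
      then obtain w' where w': "\<forall>i\<in>vertex_ix. power_fun w' (x i) = power_fun w' y" by blast
      then have "\<forall>i\<in>vertex_ix. power_fun w' (x i) = power_fun w' (x 0)" by simp
      then have "edge_map x w' = edge_map x w"
        using w unfolding equal_power_iff by simp
      then have "edge_map x (w' - w) = 0" using linear_diff[OF linear_edge_map, of x w' w] by simp
      then have "w' = w" using inj[of "w' - w"] by simp
      then show "y \<in> {y. power_fun w y = power_fun w (x 0)}" using w' by simp
    qed
    moreover have "closed {y. power_fun w y = power_fun w (x 0)}"
      unfolding power_fun_def by (intro closed_Collect_eq continuous_intros)
    ultimately have "emeasure (lborel \<Otimes>\<^sub>M \<rho>) ?D \<le> emeasure (lborel \<Otimes>\<^sub>M \<rho>) {y. power_fun w y = power_fun w (x 0)}"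
      by (intro emeasure_mono) (simp_all only: sets_lborel_pair[OF \<rho>] borel_closed)
    then show ?thesis using emeasure_pair_power_sphere[OF \<rho>, of w] by simp
  qed (simp only: emeasure_empty)
qed

text \<open>The bounds by \<open>N\<close> disappear in a countable intersection: every coefficient
  vector, centre and inverse lower bound is below some natural number.\<close>

lemma AE_generic: "AE \<omega> in M. generic (X \<omega>)"
proof -
  have "AE \<omega> in M. \<forall>N. \<forall>b0\<in>(Basis :: 'a set). \<forall>x y. inj_on x (vertex_ix - {b0}) \<and> x ` (vertex_ix - {b0}) \<subseteq> X \<omega> \<and> y \<in> X \<omega> - x ` (vertex_ix - {b0}) \<longrightarrow>
    \<not> affinely_dependent N b0 x y"
    unfolding AE_all_countable by (intro allI AE_finite_allI finite_Basis AE_affine_independent)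
  moreover have "AE \<omega> in M. \<forall>N. \<forall>x y. inj_on x vertex_ix \<and> x ` vertex_ix \<subseteq> X \<omega> \<and> y \<in> X \<omega> - x ` vertex_ix \<longrightarrow>
    \<not> cospherical N x y"
    unfolding AE_all_countable by (intro allI AE_no_cospherical)
  ultimately show ?thesis
  proof eventually_elim
    case (elim \<omega>)
    show ?case unfolding generic_def
    proof (intro allI impI, elim conjE)
      fix s :: "'a \<Rightarrow> 'a \<times> real" assume s: "inj_on s vertex_ix" "s ` vertex_ix \<subseteq> X \<omega>"
      have inj: "u = 0" if u: "edge_map s u = 0" for u
      proof (rule ccontr)
        assume "u \<noteq> 0"
        \<comment> \<open>The adjoint of \<open>edge_map s\<close>: a kernel vector \<open>u\<close>
          is orthogonal to its range, so it is not surjective, hence not injective, and the edges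
          satisfy a nontrivial linear relation.\<close>
        define T where "T c = (\<Sum>b\<in>Basis. (c \<bullet> b) *\<^sub>R (fst (s b) - fst (s 0)))" for c
        have linT: "linear T"
          unfolding T_def by (intro linearI) (simp_all add: inner_add_left scaleR_add_left sum.distrib scaleR_sum_right)
        have "u \<bullet> (fst (s b) - fst (s 0)) = 0" if "b \<in> Basis" for b
          using arg_cong[OF u, of "\<lambda>v. v \<bullet> b"] that by (simp add: edge_map_def inner_sum_left_Basis)
        then have "u \<bullet> T c = 0" for c by (simp add: T_def inner_sum_right)
        then have "u \<notin> range T" using \<open>u \<noteq> 0\<close> by (metis imageE inner_eq_zero_iff)
        then have "\<not> inj T" using linear_injective_imp_surjective[OF linT] by blast
        then obtain c where c: "c \<noteq> 0" "T c = 0" using linear_injective_0[OF linT] by blast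
        then obtain b0 where b0: "b0 \<in> Basis" "c \<bullet> b0 \<noteq> 0" using euclidean_all_zero_iff[of c] by blast
        \<comment> \<open>The relation is solved for the edge \<open>b0\<close>, whose coefficient
          is nonzero.\<close>
        define c' where "c' = (- 1 / (c \<bullet> b0)) *\<^sub>R c"
        have "0 = (c \<bullet> b0) *\<^sub>R (fst (s b0) - fst (s 0)) + (\<Sum>b\<in>Basis - {b0}. (c \<bullet> b) *\<^sub>R (fst (s b) - fst (s 0)))"
          using c(2) b0(1) by (simp add: T_def sum.remove)
        then have "(c \<bullet> b0) *\<^sub>R (fst (s b0) - fst (s 0)) = - (\<Sum>b\<in>Basis - {b0}. (c \<bullet> b) *\<^sub>R (fst (s b) - fst (s 0)))"
          by (simp add: eq_neg_iff_add_eq_0)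
        then have "(1 / (c \<bullet> b0)) *\<^sub>R (c \<bullet> b0) *\<^sub>R (fst (s b0) - fst (s 0))
            = (1 / (c \<bullet> b0)) *\<^sub>R - (\<Sum>b\<in>Basis - {b0}. (c \<bullet> b) *\<^sub>R (fst (s b) - fst (s 0)))" by simp
        then have eq: "fst (s b0) - fst (s 0) = (\<Sum>b\<in>Basis - {b0}. (c' \<bullet> b) *\<^sub>R (fst (s b) - fst (s 0)))"
          using b0(2) by (simp add: c'_def scaleR_sum_right sum_negf)
        obtain N where N: "norm c' \<le> real N" using real_arch_simple by blast
        have "inj_on s (vertex_ix - {b0})" using s(1) by (rule inj_on_subset) auto
        moreover have "s ` (vertex_ix - {b0}) \<subseteq> X \<omega>" using s(2) by blast
        moreover have "s b0 \<notin> s ` (vertex_ix - {b0})"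
        proof
          assume "s b0 \<in> s ` (vertex_ix - {b0})"
          then obtain i where "i \<in> vertex_ix" "i \<noteq> b0" "s b0 = s i" by blast
          then show False using inj_onD[OF s(1), of b0 i] b0(1) by blast
        qed
        then have "s b0 \<in> X \<omega> - s ` (vertex_ix - {b0})" using s(2) b0(1) by blast
        moreover have "c' \<in> cball 0 (real N)" using N by simp
        ultimately show False using elim(1) b0(1) eq by blast
      qed
      have no: "\<exists>i\<in>vertex_ix. power_fun w (s i) \<noteq> power_fun w q" if q: "q \<in> X \<omega> - s ` vertex_ix" for q w
      proof (rule ccontr)
        assume neg: "\<not> ?thesis"
        have "inj (edge_map s)" using inj linear_injective_0[OF linear_edge_map] by blast
        then obtain B where B: "0 < B" "\<And>u. B * norm u \<le> norm (edge_map s u)"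
          using linear_inj_bounded_below_pos[OF linear_edge_map] by blast
        obtain N where N: "max (norm w) (1 / B) \<le> real N" using real_arch_simple by blast
        have "norm u \<le> real N * norm (edge_map s u)" for u
        proof -
          have "norm u \<le> (1 / B) * norm (edge_map s u)" using B by (simp add: field_simps)
          also have "\<dots> \<le> real N * norm (edge_map s u)" using N by (intro mult_right_mono) auto
          finally show ?thesis .
        qed
        moreover have "w \<in> cball 0 (real N)" using N by simp
        ultimately show False using elim(2) s q neg by blast
      qed
      show "(\<forall>u. edge_map s u = 0 \<longrightarrow> u = 0) \<and>
          (\<forall>q\<in>X \<omega> - s ` vertex_ix. \<forall>w. \<exists>i\<in>vertex_ix. power_fun w (s i) \<noteq> power_fun w q)"
        using inj no by blast
    qed
  qed
qed

section \<open>Almost sure admissibility\<close>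

lemma AE_heights_nonneg: "AE \<omega> in M. \<forall>p\<in>X \<omega>. 0 \<le> snd p"
proof -
  interpret prob_space M by (rule poisson_lawD[OF P])
  let ?B = "(UNIV :: 'a set) \<times> {..<0::real}"
  have B: "?B \<in> sets borel" by (intro borel_open open_Times) auto
  have zero: "emeasure (lborel \<Otimes>\<^sub>M \<rho>) ?B = 0"
    using \<rho> by (simp add: emeasure_lborel_pair_Times[OF \<rho>] height_measure_def)
  then have "measure M {\<omega> \<in> space M. num_points (X \<omega>) ?B = 0} = 1"
    using poisson_lawD(4)[OF P B, of 0] by (simp add: measure_def)
  then have "AE \<omega> in M. num_points (X \<omega>) ?B = 0"
    using num_points_event[OF poisson_lawD(1)[OF P] B, of 0] by (simp add: prob_eq_1 AE_iff_null cong: AE_cong)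
  then show ?thesis
  proof eventually_elim
    case (elim \<omega>)
    then show ?case by (auto simp: num_points_eq_0_iff not_le[symmetric])
  qed
qed

text \<open>Uncountably many half-spaces are handled by countably many shifted orthants. The orthant
  with the signs of \<open>u\<close>, shifted beyond the norm of \<open>x\<close>, lies in the
  half-space; it has infinite volume and \<rho> is nonzero, so the process almost surely has points
  above it.\<close>

lemma AE_no_halfspace: "AE \<omega> in M. \<forall>u x. u \<noteq> 0 \<longrightarrow> (\<exists>p\<in>X \<omega>. u \<bullet> x < u \<bullet> fst p)"
proof -
  define Orth where "Orth T k = {v :: 'a. \<forall>b\<in>Basis. if b \<in> T then real k < v \<bullet> b else v \<bullet> b < - real k}" for T and k :: nat
  have openOrth: "open (Orth T k)" for T k
  proof -
    have "Orth T k = (\<Inter>b\<in>Basis. if b \<in> T then {v. real k < v \<bullet> b} else {v. v \<bullet> b < - real k})"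
      by (auto simp: Orth_def)
    then show ?thesis by (auto intro!: open_INT open_Collect_less continuous_intros)
  qed
  have infOrth: "emeasure lborel (Orth T k) = \<infinity>" for T k
  proof (rule ccontr)
    assume "emeasure lborel (Orth T k) \<noteq> \<infinity>"
    then obtain r where r: "emeasure lborel (Orth T k) = ennreal r" "0 \<le> r" by (cases "emeasure lborel (Orth T k)") auto
    \<comment> \<open>A cube of side \<open>n\<close> fits into the orthant, and
      \<open>n > 1\<close> gives \<open>n <= n ^ d\<close>, more than the supposed finite volume
      \<open>r\<close>.\<close>
    obtain n :: nat where n: "max r 1 < real n" using reals_Archimedean2 by blast
    define a where "a = (\<Sum>b\<in>(Basis::'a set). (if b \<in> T then real k else - real k - real n) *\<^sub>R b)"
    define c where "c = (\<Sum>b\<in>(Basis::'a set). (if b \<in> T then real k + real n else - real k) *\<^sub>R b)"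
    have ac: "a \<bullet> b = (if b \<in> T then real k else - real k - real n)" "c \<bullet> b = (if b \<in> T then real k + real n else - real k)"
      if "b \<in> Basis" for b
      using that by (simp_all add: a_def c_def inner_sum_left_Basis)
    have "emeasure lborel (box a c) = ennreal (\<Prod>b\<in>(Basis::'a set). (c - a) \<bullet> b)"
      by (intro emeasure_lborel_box) (simp add: ac)
    also have "(\<Prod>b\<in>(Basis::'a set). (c - a) \<bullet> b) = real n ^ DIM('a)"
    proof -
      have "(c - a) \<bullet> b = real n" if "b \<in> Basis" for b
        using ac[OF that] by (simp add: inner_diff_left)
      then show ?thesis by simp
    qed
    finally have "emeasure lborel (box a c) = ennreal (real n ^ DIM('a))" .
    moreover have "box a c \<subseteq> Orth T k"
      by (auto simp: mem_box Orth_def ac split: if_splits)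
    ultimately have "ennreal (real n ^ DIM('a)) \<le> ennreal r"
      using emeasure_mono[of "box a c" "Orth T k" lborel] openOrth r by (simp add: borel_open)
    then have "real n ^ DIM('a) \<le> r" using r(2) by (simp add: ennreal_le_iff)
    moreover have "real n \<le> real n ^ DIM('a)" using n by (intro self_le_power) auto
    moreover have "r < real n" using n by simp
    ultimately show False by linarith
  qed
  have "AE \<omega> in M. num_points (X \<omega>) (Orth T k \<times> UNIV) = \<infinity>" for T k
  proof (rule poisson_lawD(5)[OF P])
    show "Orth T k \<times> UNIV \<in> sets borel" using openOrth by (intro borel_open open_Times) auto
    show "emeasure (lborel \<Otimes>\<^sub>M \<rho>) (Orth T k \<times> UNIV) = \<infinity>"
      using \<rho> infOrth[of T k] openOrth[of T k]
      by (simp add: emeasure_lborel_pair_Times[OF \<rho>] borel_open height_measure_def ennreal_top_mult)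
  qed
  then have "AE \<omega> in M. \<forall>k. \<forall>T\<in>Pow Basis. num_points (X \<omega>) (Orth T k \<times> UNIV) = \<infinity>"
    unfolding AE_all_countable by (intro allI AE_finite_allI) auto
  then show ?thesis
  proof eventually_elim
    case (elim \<omega>)
    show ?case
    proof (intro allI impI)
      fix u x :: 'a assume "u \<noteq> 0"
      obtain k where k: "norm x \<le> real k" using real_arch_simple by blast
      define T where "T = {b\<in>Basis. 0 < u \<bullet> b}"
      have "num_points (X \<omega>) (Orth T k \<times> UNIV) = \<infinity>" using elim by (auto simp: T_def)
      then have "X \<omega> \<inter> (Orth T k \<times> UNIV) \<noteq> {}" by (auto simp: num_points_eq_0_iff[symmetric])
      then obtain p where p: "p \<in> X \<omega>" "fst p \<in> Orth T k" by auto
      have xb: "\<bar>x \<bullet> b\<bar> \<le> real k" if "b \<in> Basis" for b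
        using Basis_le_norm[OF that, of x] k by linarith
      have weak: "(u \<bullet> b) * (x \<bullet> b) \<le> (u \<bullet> b) * (fst p \<bullet> b)"
        and strict: "u \<bullet> b \<noteq> 0 \<Longrightarrow> (u \<bullet> b) * (x \<bullet> b) < (u \<bullet> b) * (fst p \<bullet> b)" if b: "b \<in> Basis" for b
        using p(2) xb[OF b] b by (auto simp: Orth_def T_def mult_left_mono mult_left_mono_neg split: if_splits dest!: bspec[of Basis _ b])
      obtain b1 where "b1 \<in> Basis" "u \<bullet> b1 \<noteq> 0" using \<open>u \<noteq> 0\<close> euclidean_all_zero_iff[of u] by blast
      then have "(\<Sum>b\<in>Basis. (u \<bullet> b) * (x \<bullet> b)) < (\<Sum>b\<in>Basis. (u \<bullet> b) * (fst p \<bullet> b))"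
        using weak strict by (intro sum_strict_mono_ex1 finite_Basis) blast+
      then have "u \<bullet> x < u \<bullet> fst p" by (simp only: euclidean_inner[of u x] euclidean_inner[of u "fst p"])
      then show "\<exists>p\<in>X \<omega>. u \<bullet> x < u \<bullet> fst p" using p(1) by blast
    qed
  qed
qed

lemma AE_admissible: "AE \<omega> in M. admissible (X \<omega>)"
  using AE_space AE_heights_nonneg AE_no_halfspace
proof eventually_elim
  case (elim \<omega>)
  then show ?case
    using point_process_locally_finite[OF poisson_lawD(1)[OF P]] by (simp add: admissible_def)
qed

end

section \<open>Convergence of the skeletons\<close>

lemma gridpt_Pair: "gridpt m (v, h) = (gridpt m v, gridpt m h)"
proof (rule euclidean_eqI)
  fix b :: "'a \<times> 'b" assume "b \<in> Basis"
  then show "gridpt m (v, h) \<bullet> b = (gridpt m v, gridpt m h) \<bullet> b"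
    unfolding gridpt_inner[OF \<open>b \<in> Basis\<close>]
    by (auto simp: Basis_prod_def gridpt_inner simp del: of_nat_Suc)
qed

lemma cube_Pair: "cube m z = cube m (fst z) \<times> cube m (snd z)"
  by (auto simp: cube_def gridpt_Pair prod_eq_iff)

lemma cube_real: "cube m (gridpt m h) = {gridpt m h..<gridpt m h + 1 / real (Suc m)}" for h :: real
  unfolding cube_eq_box by auto

lemma emeasure_cube_finite:
  assumes "\<And>K. compact K \<Longrightarrow> emeasure \<Lambda> K < \<infinity>" "sets \<Lambda> = sets borel"
  shows "emeasure \<Lambda> (cube m z) < \<infinity>"
proof -
  have "emeasure \<Lambda> (cube m z) \<le> emeasure \<Lambda> (closure (cube m z))"
    by (rule emeasure_mono[OF closure_subset]) (simp add: assms(2) borel_closed)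
  also have "\<dots> < \<infinity>"
    by (rule assms(1)) (simp add: compact_closure bounded_cube)
  finally show ?thesis .
qed

abbreviation count_weight :: "'b::euclidean_space measure \<Rightarrow> nat \<Rightarrow> ('b \<Rightarrow> nat) \<Rightarrow> real" where
  "count_weight \<Lambda> m k \<equiv>
     \<Prod>z\<in>grid_window m (real m). measure \<Lambda> (cube m z) ^ k z / fact (k z) * exp (- measure \<Lambda> (cube m z))"

lemma cube_counts_law:
  fixes X :: "'w \<Rightarrow> 'b::euclidean_space set"
  assumes P: "poisson_law M \<Lambda> X" and \<Lambda>: "\<And>K. compact K \<Longrightarrow> emeasure \<Lambda> K < \<infinity>" and k: "k \<in> count_vectors m"
  shows "measure M (count_event M X m k) =
    count_weight \<Lambda> m k"
proof -
  have "count_event M X m k =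
      {\<omega> \<in> space M. \<forall>z\<in>grid_window m (real m). num_points (X \<omega>) (cube m z) \<in> {of_nat (k z)}}"
    using cube_counts_eq_iff[OF point_process_locally_finite[OF poisson_lawD(1)[OF P]] k] by auto
  also have "measure M \<dots> = (\<Prod>z\<in>grid_window m (real m). measure M {\<omega> \<in> space M. num_points (X \<omega>) (cube m z) \<in> {of_nat (k z)}})"
    by (intro poisson_law_indep[OF P] finite_grid_window cube_borel disjoint_cubes) simp
  also have "\<dots> = count_weight \<Lambda> m k"
    using poisson_lawD(4)[OF P cube_borel emeasure_cube_finite[OF \<Lambda> poisson_lawD(2)[OF P]]]
    by (intro prod.cong) simp_all
  finally show ?thesis .
qed

lemma measure_lborel_pair_cube:
  assumes "height_measure \<rho>"
  shows "measure (lborel \<Otimes>\<^sub>M \<rho>) (cube m z) = measure lborel (cube m (fst z)) * measure \<rho> (cube m (snd z))"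
  unfolding cube_Pair[of m z] measure_def emeasure_lborel_pair_Times[OF assms cube_borel cube_borel]
  by (rule enn2real_mult)

text \<open>The horizontal factor is Lebesgue measure throughout, so only the masses of
  one-dimensional height cubes have to converge.\<close>

lemma skeletons_weak_conv:
  fixes X :: "nat \<Rightarrow> 'w \<Rightarrow> ('a::euclidean_space \<times> real) set" and Y :: "'v \<Rightarrow> ('a \<times> real) set"
  assumes \<rho>: "\<And>n. height_measure (\<rho> n)" "height_measure \<rho>'"
    and X: "\<And>n. poisson_law (M n) (lborel \<Otimes>\<^sub>M \<rho> n) (X n)" and Y: "poisson_law N (lborel \<Otimes>\<^sub>M \<rho>') Y"
    and conv: "\<And>m z. (\<lambda>n. measure (\<rho> n) (cube m z)) \<longlonglongrightarrow> measure \<rho>' (cube m z)"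
  shows "weak_conv_closed_sets M (\<lambda>n \<omega>. skel (laguerre_diagram (X n \<omega>))) N (\<lambda>\<omega>. skel (laguerre_diagram (Y \<omega>)))"
    and "weak_conv_closed_sets M (\<lambda>n \<omega>. skel (dual_laguerre (X n \<omega>))) N (\<lambda>\<omega>. skel (dual_laguerre (Y \<omega>)))"
proof -
  have law: "(\<lambda>n. measure (M n) (count_event (M n) (X n) m k))
      \<longlonglongrightarrow> measure N (count_event N Y m k)" for m k
  proof (cases "k \<in> count_vectors m")
    case True
    have "(\<lambda>n. measure (lborel \<Otimes>\<^sub>M \<rho> n) (cube m z)) \<longlonglongrightarrow> measure (lborel \<Otimes>\<^sub>M \<rho>') (cube m z)" for z :: "'a \<times> real"
      unfolding measure_lborel_pair_cube[OF \<rho>(1)] measure_lborel_pair_cube[OF \<rho>(2)]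
      by (intro tendsto_intros conv)
    then have "(\<lambda>n. count_weight (lborel \<Otimes>\<^sub>M \<rho> n) m k)
      \<longlonglongrightarrow> count_weight (lborel \<Otimes>\<^sub>M \<rho>') m k"
      by (intro tendsto_intros) auto
    moreover have "measure (M n) (count_event (M n) (X n) m k) =
        count_weight (lborel \<Otimes>\<^sub>M \<rho> n) m k" for n
      by (rule cube_counts_law[OF X _ True]) (rule emeasure_lborel_pair_compact[OF \<rho>(1)])
    moreover have "measure N (count_event N Y m k) =
        count_weight (lborel \<Otimes>\<^sub>M \<rho>') m k"
      by (rule cube_counts_law[OF Y _ True]) (rule emeasure_lborel_pair_compact[OF \<rho>(2)])
    ultimately show ?thesis by (simp only:)
  next
    case False
    then have "count_event (M n) (X n) m k = {}" "count_event N Y m k = {}" for n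
      using cube_counts_in by blast+
    then show ?thesis by (simp only: measure_empty tendsto_const)
  qed
  note pp = poisson_lawD(1)[OF X] poisson_lawD(1)[OF Y]
  have *: "weak_conv_closed_sets M (\<lambda>n \<omega>. S (X n \<omega>)) N (\<lambda>\<omega>. S (Y \<omega>))"
    if "\<And>A. admissible A \<Longrightarrow> closed (S A)"
      "\<And>A. admissible A \<Longrightarrow> generic A \<Longrightarrow> fell_cont_at S {A. admissible A} A" for S :: "('a \<times> real) set \<Rightarrow> 'a set"
  proof (rule weak_conv_of_fell_cont[where S = S and \<A> = "{A. admissible A}", OF pp _ _ _ law])
    show "AE \<omega> in M n. X n \<omega> \<in> {A. admissible A} \<and> fell_cont_at S {A. admissible A} (X n \<omega>)" for n
      using AE_admissible[OF \<rho>(1) X] AE_generic[OF \<rho>(1) X] by eventually_elim (simp add: that(2))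
    show "AE \<omega> in N. Y \<omega> \<in> {A. admissible A} \<and> fell_cont_at S {A. admissible A} (Y \<omega>)"
      using AE_admissible[OF \<rho>(2) Y] AE_generic[OF \<rho>(2) Y] by eventually_elim (simp add: that(2))
  qed (simp add: that(1))
  show "weak_conv_closed_sets M (\<lambda>n \<omega>. skel (laguerre_diagram (X n \<omega>))) N (\<lambda>\<omega>. skel (laguerre_diagram (Y \<omega>)))"
    by (rule *[where S = "\<lambda>A. skel (laguerre_diagram A)", OF closed_skel_laguerre fell_cont_skel_laguerre])
  show "weak_conv_closed_sets M (\<lambda>n \<omega>. skel (dual_laguerre (X n \<omega>))) N (\<lambda>\<omega>. skel (dual_laguerre (Y \<omega>)))"
    by (rule *[where S = "\<lambda>A. skel (dual_laguerre A)", OF closed_skel_dual fell_cont_skel_dual])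
qed

section \<open>The two height measures\<close>

lemma L1_loc_plusD:
  assumes "f \<in> L1_loc_plus"
  shows "0 \<le> f x" "x \<le> 0 \<Longrightarrow> f x = 0" "set_integrable lborel {0..r} f" "f \<in> borel_measurable borel"
    "set_integrable lborel {..r} f"
proof -
  show nn: "0 \<le> f x" and z: "x \<le> 0 \<Longrightarrow> f x = 0" for x using assms by (auto simp: L1_loc_plus_def)
  have "\<forall>K. compact K \<and> K \<subseteq> {0..} \<longrightarrow> set_integrable lborel K f"
    using assms by (simp add: L1_loc_plus_def)
  then show int: "set_integrable lborel {0..r} f" for r by simp
  have "(\<lambda>x. indicat_real {0..r} x *\<^sub>R f x) = (\<lambda>x. indicat_real {..r} x *\<^sub>R f x)"
    using z by (auto simp: indicator_def fun_eq_iff)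
  then show "set_integrable lborel {..r} f" using int[of r] by (simp only: set_integrable_def)
  \<comment> \<open>Local integrability only makes the truncations of \<open>f\<close> measurable;
    \<open>f\<close> is their pointwise limit.\<close>
  show "f \<in> borel_measurable borel"
  proof (rule borel_measurable_LIMSEQ_real)
    show "(\<lambda>x. indicator {0..real k} x *\<^sub>R f x) \<in> borel_measurable borel" for k
      using int[of "real k"] by (auto simp: set_integrable_def dest: borel_measurable_integrable)
    fix x :: real
    obtain k0 where k0: "x \<le> real k0" using real_arch_simple by blast
    have "\<forall>\<^sub>F k in sequentially. indicator {0..real k} x *\<^sub>R f x = f x"
      using eventually_ge_at_top[of k0]
    proof eventually_elim
      case (elim k)
      then have "x \<le> real k" using k0 by linarith
      then show ?case using z[of x] by (auto simp: indicator_def)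
    qed
    then show "(\<lambda>k. indicator {0..real k} x *\<^sub>R f x) \<longlonglongrightarrow> f x" by (rule tendsto_eventually)
  qed
qed

lemma emeasure_density_atMost:
  assumes f: "f \<in> L1_loc_plus"
  shows "emeasure (density lborel f) {..x} = ennreal (I1 f x)"
proof -
  note [measurable] = L1_loc_plusD(4)[OF f]
  have "emeasure (density lborel f) {..x} = (\<integral>\<^sup>+t. ennreal (f t) * indicator {..x} t \<partial>lborel)"
    by (rule emeasure_density) measurable
  also have "\<dots> = (\<integral>\<^sup>+t. ennreal (indicator {..x} t *\<^sub>R f t) \<partial>lborel)"
    by (intro nn_integral_cong) (auto simp: indicator_def)
  also have "\<dots> = ennreal (\<integral>t. indicator {..x} t *\<^sub>R f t \<partial>lborel)"
    using L1_loc_plusD(5)[OF f, of x] L1_loc_plusD(1)[OF f]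
    by (intro nn_integral_eq_integral) (auto simp: set_integrable_def indicator_def)
  finally show ?thesis by (simp add: I1_def set_lebesgue_integral_def)
qed

lemma I1_nonneg: "f \<in> L1_loc_plus \<Longrightarrow> 0 \<le> I1 f x"
  unfolding I1_def set_lebesgue_integral_def
  by (intro integral_nonneg_AE AE_I2) (simp add: L1_loc_plusD(1))

lemma I1_nonpos: "f \<in> L1_loc_plus \<Longrightarrow> x \<le> 0 \<Longrightarrow> I1 f x = 0"
  unfolding I1_def set_lebesgue_integral_def
  by (rule integral_eq_zero_AE, rule AE_I2) (auto simp: indicator_def L1_loc_plusD(2))

lemma measure_density_Ico:
  assumes f: "f \<in> L1_loc_plus" and ab: "a \<le> b"
  shows "measure (density lborel f) {a..<b} = I1 f b - I1 f a"
proof -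
  let ?\<rho> = "density lborel f"
  note [measurable] = L1_loc_plusD(4)[OF f]
  have less: "emeasure ?\<rho> {..<x} = ennreal (I1 f x)" for x
  proof -
    have "emeasure ?\<rho> {x} = 0" by (subst emeasure_density) auto
    then have "emeasure ?\<rho> ({..<x} \<union> {x}) = emeasure ?\<rho> {..<x}"
      by (intro emeasure_Un_null_set) auto
    moreover have "{..<x} \<union> {x} = {..x}" by auto
    ultimately show ?thesis using emeasure_density_atMost[OF f, of x] by metis
  qed
  have "{a..<b} = {..<b} - {..<a}" by auto
  also have "measure ?\<rho> \<dots> = measure ?\<rho> {..<b} - measure ?\<rho> {..<a}"
    using ab by (intro measure_Diff) (auto simp: less)
  also have "\<dots> = I1 f b - I1 f a" by (simp add: measure_def less I1_nonneg[OF f])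
  finally show ?thesis .
qed

lemma intensity_eq_pair:
  assumes f: "f \<in> L1_loc_plus"
  shows "(intensity f :: ('a::euclidean_space \<times> real) measure) = lborel \<Otimes>\<^sub>M density lborel f"
proof -
  note [measurable] = L1_loc_plusD(4)[OF f]
  have sf: "sigma_finite_measure (density lborel (\<lambda>x. ennreal (f x)))"
    by (subst sigma_finite_measure.sigma_finite_iff_density_finite[OF sigma_finite_lborel]) auto
  have "lborel \<Otimes>\<^sub>M density lborel f = density lborel (\<lambda>_::'a. 1) \<Otimes>\<^sub>M density lborel f"
    by (simp add: density_1)
  also have "\<dots> = density (lborel \<Otimes>\<^sub>M lborel) (\<lambda>(x, y). 1 * ennreal (f y))"
    by (intro pair_measure_density sf sigma_finite_lborel) auto
  finally show ?thesis by (simp add: intensity_def)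
qed

lemma height_measure_density:
  assumes f: "f \<in> L1_loc_plus" and nz: "emeasure (intensity f :: ('a::euclidean_space \<times> real) measure) UNIV \<noteq> 0"
  shows "height_measure (density lborel f)"
  unfolding height_measure_def
proof (intro conjI allI)
  note [measurable] = L1_loc_plusD(4)[OF f]
  show "sets (density lborel f) = sets borel" by simp
  fix a b
  have "emeasure (density lborel f) {a..b} \<le> emeasure (density lborel f) {..b}"
    by (intro emeasure_mono) auto
  also have "\<dots> < \<infinity>" by (simp add: emeasure_density_atMost[OF f])
  finally show "emeasure (density lborel f) {a..b} < \<infinity>" .
  have "emeasure (density lborel f) {..<0} \<le> emeasure (density lborel f) {..0}"
    by (intro emeasure_mono) auto
  then show "emeasure (density lborel f) {..<0} = 0"
    by (simp add: emeasure_density_atMost[OF f] I1_nonpos[OF f])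
  \<comment> \<open>A density vanishing almost everywhere would make the intensity on the product
    trivial.\<close>
  show "emeasure (density lborel f) UNIV \<noteq> 0"
  proof
    assume "emeasure (density lborel f) UNIV = 0"
    then have "AE x in lborel. ennreal (f x) = 0"
      by (subst (asm) emeasure_density) (auto simp: nn_integral_0_iff_AE)
    then have "density lborel f = density lborel (\<lambda>_. 0)"
      by (intro density_cong) auto
    then have "(intensity f :: ('a \<times> real) measure) = lborel \<Otimes>\<^sub>M density lborel (\<lambda>_. 0)"
      unfolding intensity_eq_pair[OF f] by simp
    moreover have "emeasure (lborel \<Otimes>\<^sub>M density lborel (\<lambda>_. 0)) (UNIV :: ('a \<times> real) set) = 0"
    proof -
      interpret sigma_finite_measure "density lborel (\<lambda>_. 0) :: real measure"
        by (rule finite_measure.sigma_finite_measure) (auto intro!: finite_measureI simp: emeasure_density)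
      have "emeasure (lborel \<Otimes>\<^sub>M density lborel (\<lambda>_. 0)) ((UNIV :: 'a set) \<times> (UNIV :: real set)) = 0"
        by (subst emeasure_pair_measure_Times) (auto simp: emeasure_density)
      then show ?thesis by simp
    qed
    ultimately show False using nz by simp
  qed
qed

text \<open>Paired with Lebesgue measure, this is the intensity of the homogeneous process placed at
  height 0.\<close>

definition origin_heights :: "real \<Rightarrow> real measure" where
  "origin_heights \<gamma> = scale_measure (ennreal \<gamma>) (return borel 0)"

lemma emeasure_origin_heights: "B \<in> sets borel \<Longrightarrow> emeasure (origin_heights \<gamma>) B = ennreal \<gamma> * indicator B 0"
  by (simp add: origin_heights_def)

lemma height_measure_origin: "0 < \<gamma> \<Longrightarrow> height_measure (origin_heights \<gamma>)"
  by (auto simp: height_measure_def emeasure_origin_heights indicator_def) (simp_all add: origin_heights_def)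

lemma emeasure_origin_pair:
  fixes B :: "('a::euclidean_space \<times> real) set"
  assumes "0 < \<gamma>" "B \<in> sets borel"
  shows "emeasure (lborel \<Otimes>\<^sub>M origin_heights \<gamma>) B = emeasure (scale_measure (ennreal \<gamma>) lborel) ((\<lambda>v. (v, 0)) -` B)"
proof -
  have \<rho>: "height_measure (origin_heights \<gamma>)" by (rule height_measure_origin[OF assms(1)])
  interpret \<rho>: sigma_finite_measure "origin_heights \<gamma>" by (rule height_measure_sigma_finite[OF \<rho>])
  interpret pair_sigma_finite "lborel :: 'a measure" "origin_heights \<gamma>" ..
  have B: "B \<in> sets (lborel \<Otimes>\<^sub>M origin_heights \<gamma>)" unfolding sets_lborel_pair[OF \<rho>] by (rule assms)
  have m: "(\<lambda>h. emeasure lborel ((\<lambda>v. (v, h)) -` B)) \<in> borel_measurable borel"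
    using measurable_emeasure_Pair2[OF B] by (simp add: origin_heights_def cong: measurable_cong_sets)
  have "emeasure (lborel \<Otimes>\<^sub>M origin_heights \<gamma>) B = (\<integral>\<^sup>+h. emeasure lborel ((\<lambda>v. (v, h)) -` B) \<partial>origin_heights \<gamma>)"
    by (rule emeasure_pair_measure_alt2[OF B])
  also have "\<dots> = ennreal \<gamma> * (\<integral>\<^sup>+h. emeasure lborel ((\<lambda>v. (v, h)) -` B) \<partial>return borel 0)"
    unfolding origin_heights_def using m by (intro nn_integral_scale_measure) simp
  also have "(\<integral>\<^sup>+h. emeasure lborel ((\<lambda>v. (v, h)) -` B) \<partial>return borel 0) = emeasure lborel ((\<lambda>v. (v, 0)) -` B)"
    by (rule nn_integral_return[OF _ m]) simp
  finally show ?thesis by simp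
qed

lemma num_points_zero_weight: "num_points (zero_weight A) B = num_points A ((\<lambda>v. (v, 0)) -` B)"
proof -
  have "zero_weight A \<inter> B = (\<lambda>v. (v, 0)) ` (A \<inter> (\<lambda>v. (v, 0)) -` B)"
    by (auto simp: zero_weight_def)
  moreover have "inj_on (\<lambda>v. (v, 0::real)) S" for S :: "'a set" by (simp add: inj_on_def)
  ultimately show ?thesis
    by (simp add: num_points_def emeasure_count_space finite_image_iff card_image)
qed

text \<open>An instance of the mapping theorem for Poisson processes: counts in \<open>B\<close> are
  counts in the preimage under \<open>v \<mapsto> (v, 0)\<close>, and preimages of disjoint sets are
  disjoint, though possibly empty.\<close>

lemma poisson_law_zero_weight:
  fixes X :: "'w \<Rightarrow> 'a::euclidean_space set"
  assumes \<gamma>: "0 < \<gamma>" and P: "poisson_process M (scale_measure (ennreal \<gamma>) lborel) X"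
  shows "poisson_law M (lborel \<Otimes>\<^sub>M origin_heights \<gamma>) (\<lambda>\<omega>. zero_weight (X \<omega>))"
proof -
  let ?e = "\<lambda>v::'a. (v, 0::real)"
  have Q: "poisson_law M (scale_measure (ennreal \<gamma>) lborel) X"
    by (rule poisson_law_of_process[OF P]) simp
  have e: "?e \<in> borel_measurable borel" by (intro borel_measurable_continuous_onI continuous_intros)
  have pre: "?e -` B \<in> sets borel" if "B \<in> sets borel" for B
    using measurable_sets[OF e that] by simp
  have "finite (zero_weight (X \<omega>) \<inter> K)" if "\<omega> \<in> space M" "compact K" for \<omega> K
  proof -
    have "zero_weight (X \<omega>) \<inter> K \<subseteq> ?e ` (X \<omega> \<inter> fst ` K)" by (force simp: zero_weight_def)
    moreover have "compact (fst ` K)" using that(2) by (intro compact_continuous_image continuous_intros)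
    then have "finite (X \<omega> \<inter> fst ` K)"
      using point_process_locally_finite[OF poisson_lawD(1)[OF Q] that(1)] by (simp add: locally_finite_def)
    ultimately show ?thesis by (meson finite_imageI finite_subset)
  qed
  then have pp: "point_process M (\<lambda>\<omega>. zero_weight (X \<omega>))"
    using poisson_lawD(3)[OF Q] measurable_num_points[OF poisson_lawD(1)[OF Q] pre]
    unfolding point_process_def num_points_zero_weight by blast
  have em: "emeasure (lborel \<Otimes>\<^sub>M origin_heights \<gamma>) B = emeasure (scale_measure (ennreal \<gamma>) lborel) (?e -` B)"
    "measure (lborel \<Otimes>\<^sub>M origin_heights \<gamma>) B = measure (scale_measure (ennreal \<gamma>) lborel) (?e -` B)"
    if "B \<in> sets borel" for B
    using emeasure_origin_pair[OF \<gamma> that] by (simp_all add: measure_def)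
  show ?thesis
    unfolding poisson_law_def num_points_zero_weight
  proof (intro conjI ballI impI allI pp)
    show "sets (lborel \<Otimes>\<^sub>M origin_heights \<gamma>) = sets (borel :: ('a \<times> real) measure)"
      by (rule sets_lborel_pair[OF height_measure_origin[OF \<gamma>]])
  next
    fix B :: "('a \<times> real) set" and k
    assume B: "B \<in> sets borel" and "emeasure (lborel \<Otimes>\<^sub>M origin_heights \<gamma>) B < \<infinity>"
    then show "measure M {\<omega> \<in> space M. num_points (X \<omega>) (?e -` B) = of_nat k} =
        measure (lborel \<Otimes>\<^sub>M origin_heights \<gamma>) B ^ k / fact k * exp (- measure (lborel \<Otimes>\<^sub>M origin_heights \<gamma>) B)"
      unfolding em[OF B] by (intro poisson_lawD(4)[OF Q pre[OF B]])
  next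
    fix B :: "('a \<times> real) set"
    assume B: "B \<in> sets borel" and "emeasure (lborel \<Otimes>\<^sub>M origin_heights \<gamma>) B = \<infinity>"
    then show "AE \<omega> in M. num_points (X \<omega>) (?e -` B) = \<infinity>"
      unfolding em[OF B] by (intro poisson_lawD(5)[OF Q pre[OF B]])
  next
    fix J :: "('a \<times> real) set" and B :: "'a \<times> real \<Rightarrow> ('a \<times> real) set"
      and E :: "'a \<times> real \<Rightarrow> ennreal set"
    assume J: "finite J \<and> (\<forall>j\<in>J. B j \<in> sets borel \<and> E j \<in> sets borel) \<and> disjoint_family_on B J"
    then have "disjoint_family_on (\<lambda>j. ?e -` B j) J"
      unfolding disjoint_family_on_def by blast
    then show "measure M {\<omega> \<in> space M. \<forall>j\<in>J. num_points (X \<omega>) (?e -` B j) \<in> E j} =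
        (\<Prod>j\<in>J. measure M {\<omega> \<in> space M. num_points (X \<omega>) (?e -` B j) \<in> E j})"
      using J pre by (intro poisson_process_indep_family[OF P]) auto
  qed
qed

text \<open>No height cube has 0 in its interior. Below 0 both sides vanish; on the cube starting at
  0 the mass is \<open>I1 (f n) b\<close> with \<open>b > 0\<close> and tends to \<gamma>; on a cube
  with positive endpoints two limits \<gamma> cancel.\<close>

lemma measure_heights_tendsto:
  fixes f :: "nat \<Rightarrow> real \<Rightarrow> real"
  assumes \<gamma>: "0 < \<gamma>" and f: "\<And>n. f n \<in> L1_loc_plus"
    and conv: "\<And>x. 0 < x \<Longrightarrow> (\<lambda>n. I1 (f n) x) \<longlonglongrightarrow> \<gamma>"
  shows "(\<lambda>n. measure (density lborel (f n)) (cube m z)) \<longlonglongrightarrow> measure (origin_heights \<gamma>) (cube m z)"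
proof (cases "z \<in> range (gridpt m)")
  case False
  then have "cube m z = {}" by (auto simp: cube_def)
  then show ?thesis by simp
next
  case True
  then obtain h where z: "z = gridpt m h" by blast
  define b where "b = z + 1 / real (Suc m)"
  have cube: "cube m z = {z..<b}" unfolding z b_def by (rule cube_real)
  have zb: "z < b" by (simp add: b_def)
  have zi: "z = of_int \<lfloor>h * real (Suc m)\<rfloor> / real (Suc m)"
    using gridpt_inner[of 1 m h] by (simp add: z)
  \<comment> \<open>A negative lower endpoint is an integer multiple of the mesh with numerator at
    most -1, so the upper endpoint does not pass 0.\<close>
  have b0: "b \<le> 0" if "z < 0"
  proof -
    have "\<lfloor>h * real (Suc m)\<rfloor> < 0"
      using that unfolding zi by (simp add: divide_less_0_iff)
    then have "of_int \<lfloor>h * real (Suc m)\<rfloor> + 1 \<le> (0::real)" by linarith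
    moreover have "b = (of_int \<lfloor>h * real (Suc m)\<rfloor> + 1) / real (Suc m)"
      unfolding b_def zi by (simp add: add_divide_distrib)
    ultimately show ?thesis by (simp add: divide_nonpos_pos)
  qed
  have lim: "(\<lambda>n. I1 (f n) x) \<longlonglongrightarrow> (if 0 < x then \<gamma> else 0)" for x
    using conv[of x] I1_nonpos[OF f, of x] by auto
  have "(\<lambda>n. I1 (f n) b - I1 (f n) z) \<longlonglongrightarrow> (if 0 < b then \<gamma> else 0) - (if 0 < z then \<gamma> else 0)"
    by (intro tendsto_diff lim)
  moreover have "measure (origin_heights \<gamma>) {z..<b} = (if 0 < b then \<gamma> else 0) - (if 0 < z then \<gamma> else 0)"
    using \<gamma> b0 zb by (auto simp: measure_def emeasure_origin_heights indicator_def)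
  ultimately show ?thesis
    unfolding cube measure_density_Ico[OF f less_imp_le[OF zb]] by simp
qed

theorem theorem3p8:
  fixes \<gamma> :: real
    and f :: "nat \<Rightarrow> real \<Rightarrow> real"
    and M :: "nat \<Rightarrow> 'w measure"
    and \<eta> :: "nat \<Rightarrow> 'w \<Rightarrow> ('a::euclidean_space \<times> real) set"
    and N :: "'v measure"
    and \<eta>\<gamma> :: "'v \<Rightarrow> 'a set"
  assumes "2 \<le> DIM('a)"
    and "0 < \<gamma>"
    and "\<And>n. f n \<in> L1_loc_plus"
    and "\<And>n. emeasure (intensity (f n) :: ('a \<times> real) measure) UNIV \<noteq> 0"
    and "\<And>x. 0 < x \<Longrightarrow> (\<lambda>n. I1 (f n) x) \<longlonglongrightarrow> \<gamma>"
    and "\<And>n. poisson_process (M n) (intensity (f n)) (\<eta> n)"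
    and "poisson_process N (scale_measure (ennreal \<gamma>) lborel) \<eta>\<gamma>"
  shows "weak_conv_closed_sets M (\<lambda>n \<omega>. skel (laguerre_diagram (\<eta> n \<omega>)))
           N (\<lambda>\<omega>. skel (laguerre_diagram (zero_weight (\<eta>\<gamma> \<omega>))))
       \<and> weak_conv_closed_sets M (\<lambda>n \<omega>. skel (dual_laguerre (\<eta> n \<omega>)))
           N (\<lambda>\<omega>. skel (dual_laguerre (zero_weight (\<eta>\<gamma> \<omega>))))"
proof -
  have \<rho>: "height_measure (density lborel (f n))" for n
    by (rule height_measure_density[OF assms(3,4)])
  have X: "poisson_law (M n) (lborel \<Otimes>\<^sub>M density lborel (f n)) (\<eta> n)" for n
    using poisson_law_of_process[OF assms(6), of n] sets_lborel_pair[OF \<rho>, of n]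
    unfolding intensity_eq_pair[OF assms(3)] by simp
  note conv = skeletons_weak_conv[OF \<rho> height_measure_origin[OF assms(2)] X poisson_law_zero_weight[OF assms(2,7)]
      measure_heights_tendsto[OF assms(2,3,5)]]
  show ?thesis using conv by blast
qed

end
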